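(* Suppose that $r>0$, $1<p<\infty$, $0<q<\infty$ and that $\mu\in\mathcal{M}_+$. Then the following conditions are equivalent: (i) $T_\mu$ is bounded on $A^p(\mathcal{U})$. (ii) The Berezin transform $\widetilde{\mu}$ is a bounded function on $\mathcal{U}$. (iii) The averaging function $\widehat{\mu}_r$ is a bounded function on $\mathcal{U}$. (iv) $\mu$ is a Carleson measure for $A^q(\mathcal{U})$.
   Context: Write $z=(z',z_n)\in\mathbb{C}^{n-1}\times\mathbb{C}$ and $z\cdot\overline{w}=\sum_j z_j\overline{w}_j$. The Siegel upper half-space is $\mathcal{U}=\{z\in\mathbb{C}^n:\operatorname{Im} z_n>|z'|^2\}$. Put $\boldsymbol{\rho}(z,w)=\frac{i}{2}(\overline{w}_n-z_n)-z'\cdot\overline{w'}$ and $\boldsymbol{\rho}(z)=\boldsymbol{\rho}(z,z)=\operatorname{Im}z_n-|z'|^2$. $V$ is Lebesgue measure on $\mathbb{C}^n$. For $0<p<\infty$, $A^p(\mathcal{U})$ is the space of holomorphic $f$ on $\mathcal{U}$ with $\|f\|_p=(\int_{\mathcal{U}}|f|^p\,dV)^{1/p}<\infty$. The Bergman kernel of $\mathcal{U}$ is $K(z,w)=\frac{n!}{4\pi^n}\boldsymbol{\rho}(z,w)^{-n-1}$. $\mathcal{M}_+$ is the set of positive Borel measures $\mu$ on $\mathcal{U}$ such that $\int_{\mathcal{U}}|z_n+i|^{-\alpha}d\mu(z)<\infty$ for some $\alpha>0$. Toeplitz operator: for $\mu\in\mathcal{M}_+$, $T_\mu f(z)=\int_{\mathcal{U}}K(z,w)f(w)\,d\mu(w)$.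 Its domain in $A^p(\mathcal{U})$ ($1<p<\infty$) is the set of $f\in A^p(\mathcal{U})$ for which this integral converges absolutely for every $z\in\mathcal{U}$; this domain is dense in $A^p(\mathcal{U})$. "$T_\mu$ is bounded on $A^p(\mathcal{U})$" means that there is a constant $C$ such that $T_\mu f\in A^p(\mathcal{U})$ and $\|T_\mu f\|_p\le C\|f\|_p$ for all $f$ in this domain (so $T_\mu$ extends uniquely to a bounded operator on $A^p(\mathcal{U})$). Berezin transform: $\widetilde{\mu}(z)=\int_{\mathcal{U}}|k_z(w)|^2d\mu(w)$, where $k_z(w)=K(z,w)/\sqrt{K(z,z)}$. Bergman metric: $\beta$ is the distance on $\mathcal{U}$ induced by the Hermitian metric with matrix $\left(\frac{1}{n+1}\frac{\partial^2\log K(z,z)}{\partial z_j\partial\overline{z}_k}\right)_{j,k}$; explicitly $\beta(z,w)=\tanh^{-1}\sqrt{1-\boldsymbol{\rho}(z)\boldsymbol{\rho}(w)/|\boldsymbol{\rho}(z,w)|^2}$. $D(z,r)=\{w\in\mathcal{U}:\beta(z,w)<r\}$, and the averaging function is $\widehat{\mu}_r(z)=\mu(D(z,r))/V(D(z,r))$. Carleson measure: a positive Borel measure $\mu$ is a Carleson measure for $A^q(\mathcal{U})$ if there is $C>0$ with $\int_{\mathcal{U}}|f|^qd\mu\le C\int_{\mathcal{U}}|f|^qdV$ for all $f\in A^q(\mathcal{U})$. *)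

theory Defs
  imports "HOL-Analysis.Analysis"
begin

text \<open>
  The space \<open>\<complex>\<^sup>n\<close> is \<^typ>\<open>complex ^ 'n\<close> with \<open>n = CARD('n) \<ge> 1\<close>. The linear order on the index
  type serves only to single out the last coordinate \<open>z\<^sub>n\<close>; the remaining coordinates form \<open>z'\<close>
  (there are none if \<open>n = 1\<close>).
\<close>

definition last_ix :: "'n::{finite,linorder}" where
  "last_ix = Max UNIV"

definition hdot :: "complex ^ 'n::{finite,linorder} \<Rightarrow> complex ^ 'n::{finite,linorder} \<Rightarrow> complex" where
  \<comment> \<open>\<open>z' \<cdot> cnj w'\<close>\<close>
  "hdot z w = (\<Sum>j \<in> UNIV - {last_ix}. z $ j * cnj (w $ j))"

definition hnorm :: "complex ^ 'n::{finite,linorder} \<Rightarrow> real" where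
  \<comment> \<open>\<open>\<bar>z'\<bar>\<close>\<close>
  "hnorm z = sqrt (\<Sum>j \<in> UNIV - {last_ix}. (cmod (z $ j))\<^sup>2)"

definition siegel :: "(complex ^ 'n::{finite,linorder}) set" where
  "siegel = {z. Im (z $ last_ix) > (hnorm z)\<^sup>2}"

definition rho :: "complex ^ 'n::{finite,linorder} \<Rightarrow> complex ^ 'n::{finite,linorder} \<Rightarrow> complex" where
  "rho z w = \<i> / 2 * (cnj (w $ last_ix) - z $ last_ix) - hdot z w"

definition rho_diag :: "complex ^ 'n::{finite,linorder} \<Rightarrow> real" where
  "rho_diag z = Im (z $ last_ix) - (hnorm z)\<^sup>2"

lemma rho_self: "rho z z = complex_of_real (rho_diag z)"
proof -
  have "hdot z z = complex_of_real ((hnorm z)\<^sup>2)"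
    by (simp add: hdot_def hnorm_def sum_nonneg complex_norm_square flip: of_real_power)
  moreover have "\<i> / 2 * (cnj (z $ last_ix) - z $ last_ix) = complex_of_real (Im (z $ last_ix))"
    by (simp add: complex_eq_iff)
  ultimately show ?thesis
    by (simp add: rho_def rho_diag_def)
qed

text \<open>Holomorphy in several variables: the real Frechet derivative exists and is complex linear.\<close>

definition holomorphic_vec :: "(complex ^ 'n::finite \<Rightarrow> complex) \<Rightarrow> (complex ^ 'n) set \<Rightarrow> bool" where
  "holomorphic_vec f S \<longleftrightarrow>
     (\<forall>z\<in>S. \<exists>f'. (f has_derivative f') (at z within S) \<and> (\<forall>c v. f' (c *s v) = c * f' v))"

definition pintegral :: "real \<Rightarrow> (complex ^ 'n::{finite,linorder} \<Rightarrow> complex) \<Rightarrow> ennreal" where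
  "pintegral p f = (\<integral>\<^sup>+ z\<in>siegel. ennreal (cmod (f z) powr p) \<partial>lborel)"

text \<open>Elements of \<open>A\<^sup>p\<close> are total functions; only their values on \<^const>\<open>siegel\<close> matter.\<close>

definition bergman_space :: "real \<Rightarrow> (complex ^ 'n::{finite,linorder} \<Rightarrow> complex) set" where
  "bergman_space p = {f. holomorphic_vec f siegel \<and> pintegral p f < \<infinity>}"

definition bergman_norm :: "real \<Rightarrow> (complex ^ 'n::{finite,linorder} \<Rightarrow> complex) \<Rightarrow> real" where
  "bergman_norm p f = enn2real (pintegral p f) powr (1 / p)"

definition bergman_kernel :: "complex ^ 'n::{finite,linorder} \<Rightarrow> complex ^ 'n::{finite,linorder} \<Rightarrow> complex" where
  "bergman_kernel z w =
     complex_of_real (fact CARD('n) / (4 * pi ^ CARD('n))) * rho z w powi (- int CARD('n) - 1)"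

text \<open>A Borel measure on the half-space lives on the subspace, so its space is \<^const>\<open>siegel\<close> itself.\<close>

definition M_plus :: "(complex ^ 'n::{finite,linorder}) measure set" where
  "M_plus = {\<mu>. sets \<mu> = sets (restrict_space borel siegel) \<and>
     (\<exists>\<alpha>>0. (\<integral>\<^sup>+ z. ennreal (cmod (z $ last_ix + \<i>) powr (- \<alpha>)) \<partial>\<mu>) < \<infinity>)}"

definition toeplitz ::
  "(complex ^ 'n::{finite,linorder}) measure \<Rightarrow> (complex ^ 'n::{finite,linorder} \<Rightarrow> complex) \<Rightarrow> complex ^ 'n::{finite,linorder} \<Rightarrow> complex" where
  "toeplitz \<mu> f z = (LINT w|\<mu>. bergman_kernel z w * f w)"

definition toeplitz_domain ::
  "real \<Rightarrow> (complex ^ 'n::{finite,linorder}) measure \<Rightarrow> (complex ^ 'n::{finite,linorder} \<Rightarrow> complex) set" where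
  "toeplitz_domain p \<mu> =
     {f \<in> bergman_space p. \<forall>z\<in>siegel. integrable \<mu> (\<lambda>w. bergman_kernel z w * f w)}"

definition toeplitz_bounded :: "real \<Rightarrow> (complex ^ 'n::{finite,linorder}) measure \<Rightarrow> bool" where
  "toeplitz_bounded p \<mu> \<longleftrightarrow>
     (\<exists>C. \<forall>f \<in> toeplitz_domain p \<mu>.
        toeplitz \<mu> f \<in> bergman_space p \<and> bergman_norm p (toeplitz \<mu> f) \<le> C * bergman_norm p f)"

text \<open>
  For \<open>z\<close> in \<^const>\<open>siegel\<close> the number \<open>K(z,z)\<close> is a positive real, so \<^const>\<open>csqrt\<close> is its positive root.
\<close>

definition normalized_kernel :: "complex ^ 'n::{finite,linorder} \<Rightarrow> complex ^ 'n::{finite,linorder} \<Rightarrow> complex" where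
  "normalized_kernel z w = bergman_kernel z w / csqrt (bergman_kernel z z)"

text \<open>
  The Berezin transform and the averaging function may a priori take the value \<open>\<infinity>\<close>; boundedness
  of such a function is by a finite constant.
\<close>

definition berezin ::
  "(complex ^ 'n::{finite,linorder}) measure \<Rightarrow> complex ^ 'n::{finite,linorder} \<Rightarrow> ennreal" where
  "berezin \<mu> z = (\<integral>\<^sup>+ w. ennreal ((cmod (normalized_kernel z w))\<^sup>2) \<partial>\<mu>)"

text \<open>
  The closed form of the distance induced by the Hermitian metric with matrix
  \<open>\<partial>\<^sup>2 log K(z,z) / \<partial>z\<^sub>j \<partial>cnj z\<^sub>k\<close> divided by \<open>n + 1\<close>; on \<^const>\<open>siegel\<close> the argument of
  \<^const>\<open>artanh\<close> lies in \<open>[0,1)\<close>.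
\<close>

definition bergman_dist :: "complex ^ 'n::{finite,linorder} \<Rightarrow> complex ^ 'n::{finite,linorder} \<Rightarrow> real" where
  "bergman_dist z w = artanh (sqrt (1 - rho_diag z * rho_diag w / (cmod (rho z w))\<^sup>2))"

definition bergman_ball :: "complex ^ 'n::{finite,linorder} \<Rightarrow> real \<Rightarrow> (complex ^ 'n::{finite,linorder}) set" where
  "bergman_ball z r = {w \<in> siegel. bergman_dist z w < r}"

definition averaging ::
  "(complex ^ 'n::{finite,linorder}) measure \<Rightarrow> real \<Rightarrow> complex ^ 'n::{finite,linorder} \<Rightarrow> ennreal" where
  "averaging \<mu> r z = emeasure \<mu> (bergman_ball z r) / emeasure lborel (bergman_ball z r)"

definition bounded_on_siegel :: "(complex ^ 'n::{finite,linorder} \<Rightarrow> ennreal) \<Rightarrow> bool" where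
  "bounded_on_siegel F \<longleftrightarrow> (\<exists>C::real. \<forall>z\<in>siegel. F z \<le> ennreal C)"

definition carleson :: "real \<Rightarrow> (complex ^ 'n::{finite,linorder}) measure \<Rightarrow> bool" where
  "carleson q \<mu> \<longleftrightarrow>
     (\<exists>C>0. \<forall>f \<in> bergman_space q.
        (\<integral>\<^sup>+ z. ennreal (cmod (f z) powr q) \<partial>\<mu>) \<le> ennreal C * pintegral q f)"

end

theory Submission
  imports Defs "HOL-Complex_Analysis.Complex_Analysis"
begin

text \<open>
  Everything is compared with condition (iii), i.e. \<open>\<mu>(D(z,r)) \<le> C \<rho>(z)\<^bsup>n+1\<^esup>\<close>.

  The affine automorphisms of the half-space act transitively, multiply \<open>rho\<close> by a constant and change
  Lebesgue measure by a constant factor, so the volume of \<open>D(z,r)\<close>, the Forelli-Rudin integrals and the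
  inequality \<open>\<bar>f(z)\<bar>\<^bsup>q\<^esup> \<rho>(z)\<^bsup>n+1\<^esup> \<le> C \<integral> \<bar>f\<bar>\<^bsup>q\<^esup> dV\<close> over \<open>D(z,r)\<close> need only be examined at one base point.
  Integrating the last inequality against \<open>\<mu>\<close> and using Tonelli turns (iii) into the Carleson
  inequality for every exponent \<open>q\<close> and all holomorphic functions. With exponent 2 and a kernel as test
  function this gives (ii); with exponent 1 and the function \<open>K(\<cdot>,z) f\<close> it bounds \<open>\<bar>T\<^sub>\<mu> f(z)\<bar>\<close> by
  the positive Bergman operator applied to \<open>\<bar>f\<bar>\<close>, to which Schur's test applies, giving (i).

  Conversely each of (i), (ii), (iv) yields \<open>\<integral> \<bar>rho(u,w)\<bar>\<^bsup>-s\<^esup> d\<mu>(w) \<le> C \<rho>(u)\<^bsup>n+1-s\<^esup>\<close> for some \<open>s\<close>, and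
  restricting the integral to \<open>D(u,r)\<close>, where \<open>\<bar>rho(u,w)\<bar>\<close> is comparable to \<open>\<rho>(u)\<close>, gives (iii).
\<close>

section \<open>Invariance of Lebesgue measure\<close>

text \<open>The delicate implication is the one from (i). Pairing T_mu k_z with k_z would call for
  duality or a reproducing formula. Here the test function is a power \<open>rho w u\<close> to the
  -m with m = n+1+k, and T_mu f is differentiated k times in the last coordinate: the kernel
  exponent rises from n+1 to m, so the integrand at u becomes a squared modulus and cannot cancel.
  Cauchy's estimate on a disc of radius comparable to rho(u) takes the place of the pairing. The
  growth condition in \<open>M_plus\<close> enters twice: it puts these test functions, for large m,
  into the domain of T_mu, and it makes mu sigma-finite, so that Tonelli applies. In the Carleson
  inequality the symmetry of the relation w in D(z,r) does the work of a covering by balls with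
  bounded overlap. The right-hand side may be infinite there, so the product of a kernel with f can
  be inserted before its integrability is known.\<close>

lemma nn_integral_lborel_translate:
  fixes F :: "'a::euclidean_space \<Rightarrow> ennreal"
  assumes [measurable]: "F \<in> borel_measurable borel"
  shows "(\<integral>\<^sup>+x. F (x + a) \<partial>lborel) = (\<integral>\<^sup>+x. F x \<partial>lborel)"
proof -
  have "(\<integral>\<^sup>+x. F x \<partial>lborel) = (\<integral>\<^sup>+x. F x \<partial>(distr lborel borel ((+) a)))"
    by (simp add: lborel_distr_plus)
  also have "\<dots> = (\<integral>\<^sup>+x. F (x + a) \<partial>lborel)"
    by (subst nn_integral_distr) (simp_all add: add.commute)
  finally show ?thesis ..
qed

lemma nn_integral_lborel_real_translate_reflect:
  fixes F :: "real \<Rightarrow> ennreal"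
  assumes [measurable]: "F \<in> borel_measurable borel"
  shows "(\<integral>\<^sup>+t. F (c - t) \<partial>lborel) = (\<integral>\<^sup>+t. F (- t) \<partial>lborel)"
  using nn_integral_real_affine[of F "-1" c] nn_integral_real_affine[of F "-1" 0] by simp

lemma lborel_Fubini:
  fixes f :: "'a::euclidean_space \<Rightarrow> 'b::euclidean_space \<Rightarrow> ennreal"
  assumes "case_prod f \<in> borel_measurable (borel \<Otimes>\<^sub>M borel)"
  shows "(\<integral>\<^sup>+x. \<integral>\<^sup>+y. f x y \<partial>lborel \<partial>lborel) = (\<integral>\<^sup>+y. \<integral>\<^sup>+x. f x y \<partial>lborel \<partial>lborel)"
proof -
  have "case_prod f \<in> borel_measurable ((lborel :: 'a measure) \<Otimes>\<^sub>M (lborel :: 'b measure))"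
    using assms by (simp cong: measurable_cong_sets)
  from lborel_pair.Fubini'[OF this] show ?thesis by simp
qed

text \<open>
  Averaging over the translates along \<open>v\<close>, weighted by a window that moves with \<open>x \<bullet> v\<close>, reduces the
  shear to a translation in the averaging parameter.
\<close>

lemma nn_integral_lborel_shear:
  fixes F :: "'a::euclidean_space \<Rightarrow> ennreal" and g :: "'a \<Rightarrow> real"
  assumes [measurable]: "F \<in> borel_measurable borel" "g \<in> borel_measurable borel"
    and g: "\<And>x t. g (x + t *\<^sub>R v) = g x" and v: "v \<noteq> 0"
  shows "(\<integral>\<^sup>+x. F (x + g x *\<^sub>R v) \<partial>lborel) = (\<integral>\<^sup>+x. F x \<partial>lborel)"
proof -
  define l where "l x = (x \<bullet> v) / (v \<bullet> v)" for x
  have l: "l (x + t *\<^sub>R v) = l x + t" for x t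
    using v by (simp add: l_def inner_add_left add_divide_distrib)
  have [measurable]: "l \<in> borel_measurable borel"
    unfolding l_def by (intro borel_measurable_continuous_onI continuous_intros) (use v in auto)
  define w :: "real \<Rightarrow> ennreal" where "w = indicator {0..1}"
  have [measurable]: "w \<in> borel_measurable borel" by (simp add: w_def)
  have win: "(\<integral>\<^sup>+t. w (c + t) \<partial>lborel) = 1" for c
    using nn_integral_lborel_translate[of w c] by (simp add: w_def add.commute)
  \<comment> \<open>The right-hand side does not involve \<open>h\<close>, so the choices
    \<open>h = g\<close> and \<open>h = 0\<close> give the two sides of the claim.\<close>
  have main: "(\<integral>\<^sup>+x. F (x + h x *\<^sub>R v) \<partial>lborel)
      = (\<integral>\<^sup>+x. w (l x) * (\<integral>\<^sup>+t. F (x - t *\<^sub>R v) \<partial>lborel) \<partial>lborel)"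
    if [measurable]: "h \<in> borel_measurable borel" and h: "\<And>x t. h (x + t *\<^sub>R v) = h x" for h
  proof -
    have h': "h (x - t *\<^sub>R v) = h x" for x t
      using h[of x "- t"] by simp
    have l': "l (x - t *\<^sub>R v) = l x - t" for x t
      using l[of x "- t"] by simp
    have "(\<integral>\<^sup>+x. F (x + h x *\<^sub>R v) \<partial>lborel)
        = (\<integral>\<^sup>+x. (\<integral>\<^sup>+t. F (x + h x *\<^sub>R v) * w (l x + t) \<partial>lborel) \<partial>lborel)"
      by (simp add: nn_integral_cmult win)
    also have "\<dots> = (\<integral>\<^sup>+t. (\<integral>\<^sup>+x. F (x + h x *\<^sub>R v) * w (l x + t) \<partial>lborel) \<partial>lborel)"
      by (rule lborel_Fubini) measurable
    also have "\<dots> = (\<integral>\<^sup>+t. (\<integral>\<^sup>+x. F ((x - t *\<^sub>R v) + h x *\<^sub>R v) * w (l x) \<partial>lborel) \<partial>lborel)"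
    proof (rule nn_integral_cong)
      fix t :: real
      show "(\<integral>\<^sup>+x. F (x + h x *\<^sub>R v) * w (l x + t) \<partial>lborel)
          = (\<integral>\<^sup>+x. F ((x - t *\<^sub>R v) + h x *\<^sub>R v) * w (l x) \<partial>lborel)"
        using nn_integral_lborel_translate[of "\<lambda>x. F (x + h x *\<^sub>R v) * w (l x + t)" "- t *\<^sub>R v"]
        by (simp add: h' l')
    qed
    also have "\<dots> = (\<integral>\<^sup>+x. (\<integral>\<^sup>+t. F ((x - t *\<^sub>R v) + h x *\<^sub>R v) * w (l x) \<partial>lborel) \<partial>lborel)"
      by (rule lborel_Fubini) measurable
    also have "\<dots> = (\<integral>\<^sup>+x. w (l x) * (\<integral>\<^sup>+t. F (x - t *\<^sub>R v) \<partial>lborel) \<partial>lborel)"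
    proof (rule nn_integral_cong)
      fix x :: 'a
      have "(\<integral>\<^sup>+t. F ((x - t *\<^sub>R v) + h x *\<^sub>R v) * w (l x) \<partial>lborel)
          = (\<integral>\<^sup>+t. w (l x) * F (x + (h x - t) *\<^sub>R v) \<partial>lborel)"
        by (intro nn_integral_cong) (simp add: algebra_simps)
      also have "\<dots> = w (l x) * (\<integral>\<^sup>+t. F (x + (h x - t) *\<^sub>R v) \<partial>lborel)"
        by (intro nn_integral_cmult) measurable
      \<comment> \<open>Here \<open>h\<close> disappears: for fixed \<open>x\<close> it is a
        constant shift of the variable \<open>t\<close> along the line.\<close>
      also have "(\<integral>\<^sup>+t. F (x + (h x - t) *\<^sub>R v) \<partial>lborel) = (\<integral>\<^sup>+t. F (x + (- t) *\<^sub>R v) \<partial>lborel)"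
        by (rule nn_integral_lborel_real_translate_reflect) measurable
      finally show "(\<integral>\<^sup>+t. F ((x - t *\<^sub>R v) + h x *\<^sub>R v) * w (l x) \<partial>lborel)
          = w (l x) * (\<integral>\<^sup>+t. F (x - t *\<^sub>R v) \<partial>lborel)"
        by simp
    qed
    finally show ?thesis .
  qed
  show ?thesis
    using main[of g] main[of "\<lambda>_. 0"] g by simp
qed

section \<open>Invariance under unimodular scalars\<close>

lemma norm_vector_smult: "norm (c *s x) = cmod c * norm (x :: complex ^ 'n)"
  by (simp add: norm_vec_def norm_mult L2_set_right_distrib)

lemma continuous_on_vector_smult [continuous_intros]:
  fixes f :: "'a::topological_space \<Rightarrow> complex" and g :: "'a \<Rightarrow> complex ^ 'n"
  assumes "continuous_on S f" "continuous_on S g"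
  shows "continuous_on S (\<lambda>x. f x *s g x)"
  unfolding vector_scalar_mult_def by (intro continuous_intros assms)

text \<open>
  Both \<open>F \<mapsto> \<integral> F(c x) dx\<close> and Lebesgue measure are translation invariant, hence proportional; the unit
  ball, being invariant under the rotation, shows that the factor is 1.
\<close>

lemma nn_integral_lborel_rotate:
  fixes F :: "complex ^ 'n \<Rightarrow> ennreal"
  assumes [measurable]: "F \<in> borel_measurable borel" and c: "cmod c = 1"
  shows "(\<integral>\<^sup>+x. F (c *s x) \<partial>lborel) = (\<integral>\<^sup>+x. F x \<partial>lborel)"
proof -
  define w :: "complex ^ 'n \<Rightarrow> ennreal" where "w = indicator (ball 0 1)"
  have [measurable]: "w \<in> borel_measurable borel"
    unfolding w_def by (intro borel_measurable_indicator borel_open open_ball)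
  have [measurable]: "(\<lambda>x. c *s x) \<in> borel_measurable (borel :: (complex ^ 'n) measure)"
    by (intro borel_measurable_continuous_onI continuous_intros)
  define V where "V = emeasure lborel (ball (0 :: complex ^ 'n) 1)"
  have wV: "(\<integral>\<^sup>+x. w x \<partial>lborel) = V" by (simp add: w_def V_def)
  have V: "V \<noteq> 0" "V \<noteq> \<infinity>"
    by (auto simp: V_def emeasure_ball ennreal_eq_0_iff not_le)
  have cc: "c * cnj c = 1" using c by (simp add: complex_norm_square [symmetric])
  have wc: "w (- (c *s x)) = w x" for x
    by (simp add: w_def indicator_def norm_vector_smult c)
  have "(\<integral>\<^sup>+x. F (c *s x) \<partial>lborel) * V = (\<integral>\<^sup>+x. F (c *s x) * V \<partial>lborel)"
    by (rule nn_integral_multc [symmetric]) measurable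
  also have "\<dots> = (\<integral>\<^sup>+x. (\<integral>\<^sup>+y. F (c *s x) * w (y - c *s x) \<partial>lborel) \<partial>lborel)"
  proof (rule nn_integral_cong)
    fix x :: "complex ^ 'n"
    show "F (c *s x) * V = (\<integral>\<^sup>+y. F (c *s x) * w (y - c *s x) \<partial>lborel)"
      using nn_integral_lborel_translate[of w "- (c *s x)"]
      by (simp add: nn_integral_cmult wV)
  qed
  also have "\<dots> = (\<integral>\<^sup>+y. (\<integral>\<^sup>+x. F (c *s x) * w (y - c *s x) \<partial>lborel) \<partial>lborel)"
    by (rule lborel_Fubini) measurable
  \<comment> \<open>Substitute \<open>x + cnj c *s y\<close> for \<open>x\<close>. As
    \<open>c * cnj c = 1\<close>, \<open>F\<close> is evaluated at \<open>c *s x + y\<close> and the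
    window at \<open>- (c *s x)\<close>, where it has the same value as at \<open>x\<close>.\<close>
  also have "\<dots> = (\<integral>\<^sup>+y. (\<integral>\<^sup>+x. F (c *s x + y) * w x \<partial>lborel) \<partial>lborel)"
  proof (rule nn_integral_cong)
    fix y :: "complex ^ 'n"
    show "(\<integral>\<^sup>+x. F (c *s x) * w (y - c *s x) \<partial>lborel) = (\<integral>\<^sup>+x. F (c *s x + y) * w x \<partial>lborel)"
      using nn_integral_lborel_translate[of "\<lambda>x. F (c *s x) * w (y - c *s x)" "cnj c *s y"]
      by (simp add: cc wc)
  qed
  also have "\<dots> = (\<integral>\<^sup>+x. (\<integral>\<^sup>+y. F (c *s x + y) * w x \<partial>lborel) \<partial>lborel)"
    by (rule lborel_Fubini) measurable
  also have "\<dots> = (\<integral>\<^sup>+x. (\<integral>\<^sup>+y. F y \<partial>lborel) * w x \<partial>lborel)"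
  proof (rule nn_integral_cong)
    fix x :: "complex ^ 'n"
    show "(\<integral>\<^sup>+y. F (c *s x + y) * w x \<partial>lborel) = (\<integral>\<^sup>+y. F y \<partial>lborel) * w x"
      using nn_integral_lborel_translate[of F "c *s x"]
      by (simp add: nn_integral_multc add.commute)
  qed
  also have "\<dots> = (\<integral>\<^sup>+x. F x \<partial>lborel) * V"
    by (simp add: nn_integral_cmult wV)
  finally show ?thesis
    using V by (auto simp: mult.commute[of _ V] ennreal_mult_cancel_left)
qed

section \<open>Geometry of the Siegel half-space\<close>

lemma Basis_complex_vec: "(Basis :: (complex ^ 'n) set) = (\<lambda>(i, u). axis i u) ` (UNIV \<times> {1, \<i>})"
  by (auto simp: Basis_vec_def Basis_complex_def)

text \<open>Groups the 2n real directions by complex coordinate; this is how the Jacobian of the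
  dilation and the product integral in the Forelli-Rudin estimate are evaluated.\<close>

lemma prod_Basis_complex_vec:
  fixes f :: "complex ^ 'n \<Rightarrow> 'a::comm_monoid_mult"
  shows "prod f Basis = (\<Prod>i\<in>UNIV. f (axis i 1) * f (axis i \<i>))"
proof -
  have inj: "inj_on (\<lambda>(i, u). axis i u :: complex ^ 'n) (UNIV \<times> {1, \<i>})"
    by (auto simp: inj_on_def axis_eq_axis)
  have "prod f Basis = (\<Prod>(i, u)\<in>UNIV \<times> {1, \<i>}. f (axis i u))"
    unfolding Basis_complex_vec
    by (subst prod.reindex[OF inj]) (simp add: case_prod_unfold)
  also have "\<dots> = (\<Prod>i\<in>UNIV. \<Prod>u\<in>{1, \<i>}. f (axis i u))"
    by (rule prod.cartesian_product [symmetric])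
  finally show ?thesis by (simp add: complex_eq_iff)
qed

lemma hdot_add_left: "hdot (x + y) z = hdot x z + hdot y z"
  by (simp add: hdot_def sum.distrib algebra_simps)

lemma hdot_add_right: "hdot z (x + y) = hdot z x + hdot z y"
  by (simp add: hdot_def sum.distrib algebra_simps)

lemma hdot_diff_left: "hdot (x - y) z = hdot x z - hdot y z"
  by (simp add: hdot_def sum_subtractf algebra_simps)

lemma hdot_diff_right: "hdot z (x - y) = hdot z x - hdot z y"
  by (simp add: hdot_def sum_subtractf algebra_simps)

lemma hdot_smult_left: "hdot (c *s x) z = c * hdot x z"
  by (simp add: hdot_def sum_distrib_left mult.assoc)

lemma hdot_scaleR_left: "hdot (c *\<^sub>R x) z = complex_of_real c * hdot x z"
  unfolding hdot_def sum_distrib_left by (intro sum.cong) (simp_all add: scaleR_conv_of_real[where 'a=complex] mult_ac)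

lemma cnj_hdot: "cnj (hdot z w) = hdot w z"
  by (simp add: hdot_def mult.commute)

lemma hdot_self: "hdot z z = complex_of_real ((hnorm z)\<^sup>2)"
  by (simp add: hdot_def hnorm_def sum_nonneg complex_norm_square flip: of_real_power)

lemma hnorm_L2_set: "hnorm z = L2_set (\<lambda>j. cmod (z $ j)) (UNIV - {last_ix})"
  by (simp add: hnorm_def L2_set_def)

lemma hnorm_nonneg [simp]: "0 \<le> hnorm z"
  by (simp add: hnorm_def sum_nonneg)

lemma hnorm_le_norm: "hnorm z \<le> norm z"
  unfolding hnorm_L2_set norm_vec_def L2_set_def
  by (intro real_sqrt_le_mono sum_mono2) auto

lemma hnorm_triangle: "hnorm (z + w) \<le> hnorm z + hnorm w"
proof -
  have "hnorm (z + w) \<le> L2_set (\<lambda>j. cmod (z $ j) + cmod (w $ j)) (UNIV - {last_ix})"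
    unfolding hnorm_L2_set by (intro L2_set_mono) (auto simp: norm_triangle_ineq)
  also have "\<dots> \<le> hnorm z + hnorm w"
    unfolding hnorm_L2_set by (rule L2_set_triangle_ineq)
  finally show ?thesis .
qed

lemma hnorm_minus_commute: "hnorm (z - w) = hnorm (w - z)"
  by (simp add: hnorm_def norm_minus_commute)

lemma cmod_hdot_le: "cmod (hdot z w) \<le> hnorm z * hnorm w"
proof -
  have "cmod (hdot z w) \<le> (\<Sum>j \<in> UNIV - {last_ix}. cmod (z $ j) * cmod (w $ j))"
    unfolding hdot_def by (rule order_trans[OF norm_sum]) (simp add: norm_mult)
  also have "\<dots> \<le> hnorm z * hnorm w"
    unfolding hnorm_L2_set using L2_set_mult_ineq[of "\<lambda>j. cmod (z $ j)" "\<lambda>j. cmod (w $ j)"] by simp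
  finally show ?thesis .
qed

lemma continuous_on_hdot [continuous_intros]:
  assumes "continuous_on S f" "continuous_on S g"
  shows "continuous_on S (\<lambda>x. hdot (f x) (g x))"
  unfolding hdot_def by (intro continuous_intros assms)

lemma continuous_on_rho [continuous_intros]:
  assumes "continuous_on S f" "continuous_on S g"
  shows "continuous_on S (\<lambda>x. rho (f x) (g x))"
  unfolding rho_def by (intro continuous_intros assms)

lemma continuous_on_hnorm [continuous_intros]:
  assumes "continuous_on S f"
  shows "continuous_on S (\<lambda>x. hnorm (f x))"
  unfolding hnorm_def by (intro continuous_intros assms)

lemma continuous_on_rho_diag [continuous_intros]:
  assumes "continuous_on S f"
  shows "continuous_on S (\<lambda>x. rho_diag (f x))"
  unfolding rho_diag_def by (intro continuous_intros assms)

lemma measurable_rho [measurable]: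
  assumes [measurable]: "f \<in> borel_measurable M" "g \<in> borel_measurable M"
  shows "(\<lambda>x. rho (f x) (g x)) \<in> borel_measurable M"
  by (rule borel_measurable_continuous_Pair[OF assms]) (intro continuous_intros)

lemma measurable_rho_diag [measurable]: "rho_diag \<in> borel_measurable borel"
  by (intro borel_measurable_continuous_onI continuous_intros)

lemma siegel_iff: "z \<in> siegel \<longleftrightarrow> 0 < rho_diag z"
  by (simp add: siegel_def rho_diag_def)

lemma open_siegel: "open (siegel :: (complex ^ 'n::{finite,linorder}) set)"
proof -
  have "siegel = {z :: complex ^ 'n::{finite,linorder}. 0 < rho_diag z}" by (auto simp: siegel_iff)
  moreover have "open {z :: complex ^ 'n::{finite,linorder}. 0 < rho_diag z}"
    by (intro open_Collect_less continuous_intros)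
  ultimately show ?thesis by simp
qed

lemma siegel_sets [measurable]: "siegel \<in> sets borel"
  by (simp add: open_siegel)

section \<open>Lower bounds for the modulus of rho\<close>

lemma cnj_rho: "cnj (rho z w) = rho w z"
  by (simp add: rho_def cnj_hdot algebra_simps)

lemma cmod_rho_commute: "cmod (rho z w) = cmod (rho w z)"
  by (metis cnj_rho complex_mod_cnj)

text \<open>Polarisation: the cross term \<open>- 2 * Re (hdot z w)\<close> completes the square of
  \<open>hnorm (z - w)\<close>. All three terms on the right are nonnegative on the half-space,
  which is why \<open>rho\<close> has no zero there and dominates both diagonal values.\<close>

lemma two_Re_rho: "2 * Re (rho z w) = rho_diag z + rho_diag w + (hnorm (z - w))\<^sup>2"
proof -
  have "complex_of_real ((hnorm (z - w))\<^sup>2) = hdot (z - w) (z - w)"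
    by (simp add: hdot_self)
  also have "\<dots> = complex_of_real ((hnorm z)\<^sup>2) + complex_of_real ((hnorm w)\<^sup>2) - (hdot z w + cnj (hdot z w))"
    unfolding hdot_self [symmetric] cnj_hdot
    by (simp add: hdot_diff_left hdot_diff_right algebra_simps)
  finally have "(hnorm (z - w))\<^sup>2 = (hnorm z)\<^sup>2 + (hnorm w)\<^sup>2 - 2 * Re (hdot z w)"
    by (simp add: complex_eq_iff del: of_real_power)
  then show ?thesis
    by (simp add: rho_def rho_diag_def)
qed

lemma rho_diag_add_le: "rho_diag z + rho_diag w + (hnorm (z - w))\<^sup>2 \<le> 2 * cmod (rho z w)"
  using two_Re_rho[of z w] complex_Re_le_cmod[of "rho z w"] by linarith

lemma rho_diag_le: "z \<in> siegel \<Longrightarrow> w \<in> siegel \<Longrightarrow> rho_diag z \<le> 2 * cmod (rho z w)"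
  using rho_diag_add_le[of z w] by (simp add: siegel_iff) (smt (verit) zero_le_power2)

lemma rho_diag_le': "z \<in> siegel \<Longrightarrow> w \<in> siegel \<Longrightarrow> rho_diag w \<le> 2 * cmod (rho z w)"
  using rho_diag_add_le[of z w] by (simp add: siegel_iff) (smt (verit) zero_le_power2)

lemma cmod_rho_pos: "z \<in> siegel \<Longrightarrow> w \<in> siegel \<Longrightarrow> 0 < cmod (rho z w)"
  using rho_diag_le[of z w] siegel_iff[of z] by linarith

lemma rho_nonzero: "z \<in> siegel \<Longrightarrow> w \<in> siegel \<Longrightarrow> rho z w \<noteq> 0"
  using cmod_rho_pos by fastforce

text \<open>The complex linear part of \<open>rho\<close> in its first argument: the increment of
  \<open>rho\<close> caused by moving that argument by \<open>v\<close>, hence also its derivative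
  in direction \<open>v\<close>.\<close>

definition rho_lin :: "complex ^ 'n::{finite,linorder} \<Rightarrow> complex ^ 'n::{finite,linorder} \<Rightarrow> complex" where
  "rho_lin w v = - (\<i> / 2) * v $ last_ix - hdot v w"

lemma rho_add_left: "rho (z + v) w = rho z w + rho_lin w v"
  by (simp add: rho_def rho_lin_def hdot_add_left algebra_simps)

lemma rho_lin_add: "rho_lin w (a + b) = rho_lin w a + rho_lin w b"
  by (simp add: rho_lin_def hdot_add_left algebra_simps)

lemma rho_lin_smult: "rho_lin w (c *s a) = c * rho_lin w a"
  by (simp add: rho_lin_def hdot_smult_left algebra_simps)

lemma rho_lin_scaleR: "rho_lin w (c *\<^sub>R a) = complex_of_real c * rho_lin w a"
  by (simp add: rho_lin_def hdot_scaleR_left scaleR_conv_of_real[where 'a=complex] algebra_simps)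

lemma rho_lin_axis_last: "rho_lin w (axis last_ix c) = - (\<i> / 2) * c"
  by (simp add: rho_lin_def hdot_def axis_def)

lemma bounded_linear_rho_lin: "bounded_linear (rho_lin w)"
  by (intro linear_conv_bounded_linear[THEN iffD1] linearI)
    (simp_all add: rho_lin_add rho_lin_scaleR scaleR_conv_of_real[where 'a=complex])

lemma measurable_rho_lin [measurable]: "(\<lambda>w. rho_lin w v) \<in> borel_measurable borel"
  unfolding rho_lin_def by (intro borel_measurable_continuous_onI continuous_intros)

text \<open>The increment is linear in \<open>v\<close> with coefficients of size
  \<open>1/2 + hnorm w\<close>, unbounded in \<open>w\<close>. But
  \<open>(hnorm (w - z))\<^sup>2\<close> is at most twice the modulus of \<open>rho z w\<close>, so
  the kernel itself absorbs the growth and the relative increment is small uniformly in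
  \<open>w\<close>.\<close>

lemma cmod_rho_perturb:
  fixes z :: "complex ^ 'n::{finite,linorder}"
  assumes z: "z \<in> siegel"
  obtains C where "C > 0"
    "\<And>v w. w \<in> siegel \<Longrightarrow> cmod (rho (z + v) w - rho z w) \<le> C * norm v * cmod (rho z w)"
proof
  define C where "C = 2 + (3 + 2 * hnorm z) / rho_diag z"
  have r: "rho_diag z > 0" using z by (simp add: siegel_iff)
  show "C > 0" unfolding C_def using r by (intro add_pos_nonneg divide_nonneg_pos) auto
  fix v w :: "(complex, 'n) vec" assume w: "w \<in> siegel"
  define R where "R = cmod (rho z w)"
  have R1: "rho_diag z \<le> 2 * R" using rho_diag_le[OF z w] by (simp add: R_def)
  have R2: "(hnorm (w - z))\<^sup>2 \<le> 2 * R"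
    using rho_diag_add_le[of z w] r w by (simp add: R_def siegel_iff hnorm_minus_commute)
  have "hnorm w \<le> hnorm z + hnorm (w - z)" using hnorm_triangle[of z "w - z"] by simp
  moreover have "hnorm (w - z) \<le> 1 + (hnorm (w - z))\<^sup>2"
    by (smt (verit) hnorm_nonneg mult_left_mono power2_eq_square zero_le_power2 mult_cancel_left1)
  ultimately have "1/2 + hnorm w \<le> 3/2 + hnorm z + 2 * R" using R2 by linarith
  \<comment> \<open>The constant term is paid for by \<open>rho_diag z / 2 \<le> R\<close>; this is
    the origin of the second summand of \<open>C\<close>.\<close>
  also have "3/2 + hnorm z = (3 + 2 * hnorm z) / rho_diag z * (rho_diag z / 2)"
    using r by (simp add: field_simps)
  also have "\<dots> \<le> (3 + 2 * hnorm z) / rho_diag z * R"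
    by (intro mult_left_mono) (use R1 r in auto)
  finally have *: "1/2 + hnorm w \<le> C * R" by (simp add: C_def algebra_simps)
  have "rho (z + v) w - rho z w = - (\<i> / 2 * v $ last_ix) - hdot v w"
    by (simp add: rho_add_left) (simp add: rho_lin_def)
  also have "cmod \<dots> \<le> cmod (v $ last_ix) / 2 + hnorm v * hnorm w"
    using norm_triangle_ineq4[of "- (\<i> / 2 * v $ last_ix)" "hdot v w"] cmod_hdot_le[of v w]
    by (simp add: norm_mult)
  also have "\<dots> \<le> norm v / 2 + norm v * hnorm w"
    using hnorm_le_norm[of v] Finite_Cartesian_Product.norm_nth_le[of v last_ix]
    by (intro add_mono mult_right_mono) auto
  also have "\<dots> = norm v * (1/2 + hnorm w)" by (simp add: algebra_simps)
  also have "\<dots> \<le> norm v * (C * R)" by (intro mult_left_mono *) simp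
  finally show "cmod (rho (z + v) w - rho z w) \<le> C * norm v * cmod (rho z w)"
    by (simp add: R_def mult_ac)
qed

text \<open>Moves kernel bounds from one centre to another; with \<open>u\<close> the base point it
  compares the weight defining \<open>M_plus\<close> with the modulus of
  \<open>rho z w\<close>.\<close>

lemma cmod_rho_compare:
  fixes z :: "complex ^ 'n::{finite,linorder}"
  assumes z: "z \<in> siegel"
  obtains C where "C > 0" "\<And>w. w \<in> siegel \<Longrightarrow> cmod (rho u w) \<le> C * cmod (rho z w)"
proof -
  from cmod_rho_perturb[OF z] obtain C where C: "C > 0"
    "\<And>v w. w \<in> siegel \<Longrightarrow> cmod (rho (z + v) w - rho z w) \<le> C * norm v * cmod (rho z w)"
    by blast
  show ?thesis
  proof (rule that[of "1 + C * norm (u - z)"])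
    show "1 + C * norm (u - z) > 0" using C(1) by (simp add: add_pos_nonneg)
    fix w :: "(complex, 'n) vec" assume "w \<in> siegel"
    from C(2)[OF this, of "u - z"] show "cmod (rho u w) \<le> (1 + C * norm (u - z)) * cmod (rho z w)"
      using norm_triangle_sub[of "rho u w" "rho z w"] by (simp add: algebra_simps)
  qed
qed

section \<open>The base point and the transitive affine maps\<close>

definition base_point :: "complex ^ 'n::{finite,linorder}" where
  "base_point = axis last_ix \<i>"

lemma hdot_base_point [simp]: "hdot z base_point = 0" "hdot base_point z = 0"
  by (simp_all add: hdot_def base_point_def axis_def)

lemma hnorm_base_point [simp]: "hnorm base_point = 0"
  using hdot_self[of base_point] by simp

lemma rho_diag_base_point [simp]: "rho_diag base_point = 1"
  by (simp add: rho_diag_def) (simp add: base_point_def)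

lemma base_point_in_siegel [simp]: "base_point \<in> siegel"
  by (simp add: siegel_iff)

text \<open>Hence the weight in \<open>M_plus\<close> is, up to a constant, a power of the modulus
  of \<open>rho\<close> at the base point, and the growth condition is a kernel integrability
  condition.\<close>

lemma rho_base_point: "rho z base_point = - (\<i> / 2) * (z $ last_ix + \<i>)"
  by (simp add: rho_def) (simp add: base_point_def algebra_simps)

text \<open>The affine automorphism of the half-space, a Heisenberg translation after a dilation, that
  maps the base point to \<open>z\<close>.\<close>

definition siegel_map :: "complex ^ 'n::{finite,linorder} \<Rightarrow> complex ^ 'n::{finite,linorder} \<Rightarrow> complex ^ 'n::{finite,linorder}" where
  "siegel_map z v = (\<chi> j. if j = last_ix
     then complex_of_real (Re (z $ last_ix)) + \<i> * complex_of_real ((hnorm z)\<^sup>2)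
        + complex_of_real (rho_diag z) * v $ last_ix
        + 2 * \<i> * complex_of_real (sqrt (rho_diag z)) * hdot v z
     else z $ j + complex_of_real (sqrt (rho_diag z)) * v $ j)"

lemma hdot_siegel_map:
  "hdot (siegel_map z v) (siegel_map z w) =
     hdot (z + sqrt (rho_diag z) *\<^sub>R v) (z + sqrt (rho_diag z) *\<^sub>R w)"
  unfolding hdot_def by (intro sum.cong) (auto simp: siegel_map_def scaleR_conv_of_real[where 'a=complex])

text \<open>The last coordinate of \<open>siegel_map\<close> is built for this: its terms in
  \<open>(hnorm z)\<^sup>2\<close> and in \<open>hdot v z\<close> cancel the constant and the mixed
  terms produced by expanding \<open>hdot\<close> of the two images, leaving only the factor
  \<open>s * s\<close>.\<close>

lemma rho_siegel_map:
  fixes z :: "complex ^ 'n::{finite,linorder}"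
  assumes "z \<in> siegel"
  shows "rho (siegel_map z v) (siegel_map z w) = complex_of_real (rho_diag z) * rho v w"
proof -
  define s where "s = complex_of_real (sqrt (rho_diag z))"
  have s: "s * s = complex_of_real (rho_diag z)"
    using assms unfolding s_def by (simp add: siegel_iff flip: of_real_mult)
  have cs: "cnj s = s" by (simp add: s_def)
  have r: "hdot a (c *\<^sub>R b) = complex_of_real c * hdot a b" for a b :: "(complex, 'n) vec" and c
    using arg_cong[OF hdot_scaleR_left[of c b a], of cnj] by (simp add: cnj_hdot)
  have "hdot (siegel_map z v) (siegel_map z w)
      = complex_of_real ((hnorm z)\<^sup>2) + s * hdot z w + s * hdot v z + s * s * hdot v w"
    unfolding hdot_siegel_map
    by (simp add: hdot_add_left hdot_add_right hdot_scaleR_left r hdot_self s_def algebra_simps)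
  moreover have "siegel_map z v $ last_ix = complex_of_real (Re (z $ last_ix))
      + \<i> * complex_of_real ((hnorm z)\<^sup>2) + s * s * v $ last_ix + 2 * \<i> * s * hdot v z" for v
    unfolding s by (simp add: siegel_map_def s_def)
  ultimately show ?thesis
    unfolding rho_def s [symmetric] by (simp add: cs cnj_hdot field_simps)
qed

lemma rho_diag_siegel_map:
  assumes "z \<in> siegel"
  shows "rho_diag (siegel_map z v) = rho_diag z * rho_diag v"
  using rho_siegel_map[OF assms, of v v] by (simp add: rho_self flip: of_real_mult)

lemma siegel_map_in_siegel_iff: "z \<in> siegel \<Longrightarrow> siegel_map z v \<in> siegel \<longleftrightarrow> v \<in> siegel"
  by (simp add: siegel_iff rho_diag_siegel_map zero_less_mult_iff)

lemma siegel_map_base_point [simp]: "siegel_map z base_point = z"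
proof (rule vec_eq_iff[THEN iffD2], intro allI)
  fix j
  show "siegel_map z base_point $ j = z $ j"
    by (cases "j = last_ix")
      (simp_all add: siegel_map_def, simp_all add: base_point_def axis_def rho_diag_def complex_eq_iff)
qed

lemma continuous_on_siegel_map [continuous_intros]:
  assumes "continuous_on S f"
  shows "continuous_on S (\<lambda>x. siegel_map z (f x))"
proof -
  have "continuous_on S (\<lambda>x. siegel_map z (f x) $ j)" for j
    by (cases "j = last_ix") (simp_all add: siegel_map_def, (intro continuous_intros assms)+)
  then show ?thesis by (rule continuous_on_vec_lambda[of S "\<lambda>j x. siegel_map z (f x) $ j", simplified])
qed

lemma siegel_map_measurable [measurable]: "siegel_map z \<in> borel_measurable borel"
  by (intro borel_measurable_continuous_onI continuous_on_siegel_map continuous_on_id)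

text \<open>\<open>siegel_map z\<close> is a diagonal affine map \<open>T\<close> followed by two
  shears of the last coordinate, which preserve volume. In \<open>T\<close> each of the n-1 complex
  coordinates scales by \<open>sqrt r\<close> and contributes \<open>r\<close>, the last scales by
  \<open>r\<close> and contributes \<open>r * r\<close>; together the Jacobian is the power
  n+1.\<close>

lemma nn_integral_siegel_map:
  fixes F :: "complex ^ 'n::{finite,linorder} \<Rightarrow> ennreal"
  assumes [measurable]: "F \<in> borel_measurable borel" and z: "z \<in> siegel"
  shows "ennreal (rho_diag z ^ (CARD('n) + 1)) * (\<integral>\<^sup>+v. F (siegel_map z v) \<partial>lborel) = (\<integral>\<^sup>+v. F v \<partial>lborel)"
proof -
  define r where "r = rho_diag z"
  have r: "r > 0" using z by (simp add: r_def siegel_iff)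
  let ?l = "last_ix :: 'n"
  define c :: "(complex, 'n) vec \<Rightarrow> real" where "c b = (if b $ ?l \<noteq> 0 then r else sqrt r)" for b
  define t :: "(complex, 'n) vec" where "t = (\<chi> j. if j = ?l
     then complex_of_real (Re (z $ ?l)) + \<i> * complex_of_real ((hnorm z)\<^sup>2) else z $ j)"
  define T where "T v = t + (\<Sum>b\<in>Basis. (c b * (v \<bullet> b)) *\<^sub>R b)" for v
  have [measurable]: "T \<in> borel_measurable borel"
    unfolding T_def by (intro borel_measurable_continuous_onI continuous_intros)
  have c_pos: "c b > 0" for b using r by (simp add: c_def)
  have c_ax: "c (axis i u) = (if i = ?l then r else sqrt r)" if "u \<noteq> 0" for i u
    using that by (auto simp: c_def axis_def)
  have "(\<Prod>b\<in>Basis. \<bar>c b\<bar>) = (\<Prod>i\<in>UNIV. if i = ?l then r * r else r)"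
    unfolding prod_Basis_complex_vec by (intro prod.cong) (use r in \<open>auto simp: c_ax\<close>)
  also have "\<dots> = r * r * (\<Prod>i\<in>UNIV - {?l}. r)"
    by (subst prod.remove[of _ ?l]) auto
  also have "\<dots> = r ^ (CARD('n) - 1 + 2)"
    unfolding prod_constant power_add by (simp add: card_Diff_singleton power2_eq_square)
  also have "CARD('n) - 1 + 2 = CARD('n) + 1"
    using zero_less_card_finite[where 'a='n] by linarith
  finally have prodc: "(\<Prod>b\<in>Basis. \<bar>c b\<bar>) = r ^ (CARD('n) + 1)" .
  have dil: "(\<integral>\<^sup>+v. G v \<partial>lborel) = ennreal (r ^ (CARD('n) + 1)) * (\<integral>\<^sup>+v. G (T v) \<partial>lborel)"
    if [measurable]: "G \<in> borel_measurable borel" for G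
  proof -
    have "(lborel :: ((complex, 'n) vec) measure) = density (distr lborel borel T) (\<lambda>_. (\<Prod>j\<in>Basis. \<bar>c j\<bar>))"
      unfolding T_def by (rule lborel_affine_euclidean) (use c_pos in \<open>auto simp: less_imp_neq[THEN not_sym]\<close>)
    then have "(\<integral>\<^sup>+v. G v \<partial>lborel)
        = (\<integral>\<^sup>+v. G v \<partial>density (distr lborel borel T) (\<lambda>_. (\<Prod>j\<in>Basis. \<bar>c j\<bar>)))"
      by simp
    also have "\<dots> = ennreal (r ^ (CARD('n) + 1)) * (\<integral>\<^sup>+v. G (T v) \<partial>lborel)"
      unfolding prodc by (simp add: nn_integral_density nn_integral_distr nn_integral_cmult)
    finally show ?thesis .
  qed
  have T_nth: "T v $ j = t $ j + (if j = ?l then r else sqrt r) *\<^sub>R v $ j" for v j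
  proof -
    have "T v = t + (\<chi> j. (if j = ?l then r else sqrt r) *\<^sub>R v $ j)"
    proof (rule euclidean_eqI)
      fix b :: "(complex, 'n) vec" assume b: "b \<in> Basis"
      then obtain i u where iu: "b = axis i u" "u \<in> {1, \<i>}" by (auto simp: Basis_complex_vec)
      then have "u \<noteq> 0" by auto
      show "T v \<bullet> b = (t + (\<chi> j. (if j = ?l then r else sqrt r) *\<^sub>R v $ j)) \<bullet> b"
        using b unfolding T_def inner_add_left
        by (simp add: inner_sum_left_Basis) (simp add: iu c_ax[OF \<open>u \<noteq> 0\<close>] inner_axis)
    qed
    then show ?thesis by simp
  qed
  \<comment> \<open>The Heisenberg term as a function of the image point: off the last coordinate
    \<open>T v - z\<close> equals \<open>sqrt r\<close> times \<open>v\<close>. It does not see the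
    last coordinate, as the shear lemma requires.\<close>
  define h where "h u = 2 * \<i> * hdot (u - z) z" for u
  define g1 where "g1 u = Re (h u)" for u
  define g2 where "g2 u = Im (h u)" for u
  have hinv: "h (u + a *\<^sub>R axis ?l b) = h u" for u a b
    by (simp add: h_def hdot_def axis_def)
  have [measurable]: "g1 \<in> borel_measurable borel" "g2 \<in> borel_measurable borel"
    unfolding g1_def g2_def h_def by (intro borel_measurable_continuous_onI continuous_intros)+
  \<comment> \<open>A complex translation of the last coordinate is split into two real shears;
    evaluating \<open>g2\<close> after the first one changes nothing, since \<open>h\<close> is
    invariant along the last axis.\<close>
  have split: "siegel_map z v = T v + g1 (T v) *\<^sub>R axis ?l 1 + g2 (T v + g1 (T v) *\<^sub>R axis ?l 1) *\<^sub>R axis ?l \<i>" for v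
  proof -
    have hT: "h (T v) = 2 * \<i> * complex_of_real (sqrt r) * hdot v z"
      unfolding h_def hdot_def sum_distrib_left
      by (intro sum.cong) (auto simp: T_nth t_def scaleR_conv_of_real[where 'a=complex])
    have "g1 (T v) *\<^sub>R axis ?l 1 + g2 (T v) *\<^sub>R axis ?l \<i> = axis ?l (h (T v))"
      by (simp add: vec_eq_iff axis_def g1_def g2_def complex_eq_iff)
    moreover have "siegel_map z v = T v + axis ?l (h (T v))"
      unfolding hT by (simp add: vec_eq_iff siegel_map_def T_nth t_def axis_def r_def scaleR_conv_of_real[where 'a=complex] algebra_simps)
    moreover have "g2 (T v + g1 (T v) *\<^sub>R axis ?l 1) = g2 (T v)"
      by (simp add: g2_def hinv)
    ultimately show ?thesis by (simp add: add.assoc)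
  qed
  have "ennreal (r ^ (CARD('n) + 1)) * (\<integral>\<^sup>+v. F (siegel_map z v) \<partial>lborel)
      = (\<integral>\<^sup>+u. F (u + g1 u *\<^sub>R axis ?l 1 + g2 (u + g1 u *\<^sub>R axis ?l 1) *\<^sub>R axis ?l \<i>) \<partial>lborel)"
    unfolding split by (rule dil[symmetric]) measurable
  also have "\<dots> = (\<integral>\<^sup>+u. F (u + g2 u *\<^sub>R axis ?l \<i>) \<partial>lborel)"
    by (rule nn_integral_lborel_shear[where F = "\<lambda>u. F (u + g2 u *\<^sub>R axis ?l \<i>)" and g = g1])
      (simp_all add: g1_def hinv axis_eq_0_iff)
  also have "\<dots> = (\<integral>\<^sup>+u. F u \<partial>lborel)"
    by (rule nn_integral_lborel_shear) (measurable, simp_all add: g2_def hinv axis_eq_0_iff)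
  finally show ?thesis by (simp add: r_def)
qed

text \<open>Clears \<open>artanh\<close> and the square root by monotonicity. Openness,
  measurability, symmetry in the two points and the behaviour under \<open>siegel_map\<close> are
  all read off from the resulting polynomial inequality.\<close>

lemma bergman_ball_iff:
  fixes z w :: "complex ^ 'n::{finite,linorder}"
  assumes z: "z \<in> siegel" and r: "r > 0"
  shows "w \<in> bergman_ball z r \<longleftrightarrow>
    w \<in> siegel \<and> (1 - (tanh r)\<^sup>2) * (cmod (rho z w))\<^sup>2 < rho_diag z * rho_diag w"
proof (cases "w \<in> siegel")
  case True
  define R where "R = cmod (rho z w)"
  define x where "x = 1 - rho_diag z * rho_diag w / R\<^sup>2"
  have R: "R > 0" using cmod_rho_pos[OF z True] by (simp add: R_def)
  have pos: "rho_diag z > 0" "rho_diag w > 0" using z True by (auto simp: siegel_iff)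
  \<comment> \<open>The arithmetic-geometric mean inequality places \<open>x\<close> in the interval
    [0,1), where \<open>artanh\<close> of its root is given by a genuine logarithm and is
    increasing.\<close>
  have "4 * (rho_diag z * rho_diag w) \<le> (rho_diag z + rho_diag w)\<^sup>2"
    using zero_le_power2[of "rho_diag z - rho_diag w"] by (simp add: power2_eq_square algebra_simps)
  also have "\<dots> \<le> (2 * R)\<^sup>2"
    using rho_diag_add_le[of z w] pos
    by (intro power_mono) (auto simp: R_def, smt (verit) zero_le_power2)
  finally have "rho_diag z * rho_diag w \<le> R\<^sup>2" by simp
  then have x: "0 \<le> x" "x < 1" using R pos by (simp_all add: x_def)
  then have sx: "0 \<le> sqrt x" "sqrt x < 1" by auto
  have t: "0 < tanh r" using r by simp
  have "bergman_dist z w = artanh (sqrt x)"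
    by (simp add: bergman_dist_def x_def R_def)
  moreover have "artanh (sqrt x) < r \<longleftrightarrow> sqrt x < tanh r"
  proof -
    have 1: "tanh r < 1" by (simp add: tanh_real_lt_1)
    have "artanh (sqrt x) < r \<longleftrightarrow> artanh (sqrt x) < artanh (tanh r)"
      by (simp add: artanh_tanh_real)
    also have "\<dots> \<longleftrightarrow> (1 + sqrt x) / (1 - sqrt x) < (1 + tanh r) / (1 - tanh r)"
    proof -
      have "0 < (1 + sqrt x) / (1 - sqrt x)" "0 < (1 + tanh r) / (1 - tanh r)"
        using sx t 1 by (auto intro!: divide_pos_pos add_pos_nonneg)
      from ln_less_cancel_iff[OF this] show ?thesis by (simp add: artanh_def)
    qed
    also have "\<dots> \<longleftrightarrow> sqrt x < tanh r"
      using sx 1 by (simp add: divide_simps) (simp add: algebra_simps)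
    finally show ?thesis .
  qed
  moreover have "sqrt x < tanh r \<longleftrightarrow> x < (tanh r)\<^sup>2"
    using x t by (metis less_eq_real_def real_less_lsqrt real_less_rsqrt real_sqrt_less_iff real_sqrt_unique)
  moreover have "x < (tanh r)\<^sup>2 \<longleftrightarrow> (1 - (tanh r)\<^sup>2) * R\<^sup>2 < rho_diag z * rho_diag w"
    using R by (simp add: x_def field_simps)
  ultimately show ?thesis using True by (simp add: bergman_ball_def R_def)
qed (simp add: bergman_ball_def)

section \<open>Mean value inequalities\<close>

lemma holomorphic_vec_imp_continuous_on: "holomorphic_vec f S \<Longrightarrow> continuous_on S f"
  unfolding holomorphic_vec_def by (meson continuous_on_eq_continuous_within has_derivative_continuous)

text \<open>Complex linearity turns the chain rule along a complex line into multiplication by the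
  number \<open>f' v\<close>, which makes one-variable Cauchy theory available on every
  slice.\<close>

lemma holomorphic_vec_slice:
  fixes f :: "complex ^ 'n::finite \<Rightarrow> complex"
  assumes f: "holomorphic_vec f S" and S: "open S" and l: "a + l *s v \<in> S"
  shows "(\<lambda>l. f (a + l *s v)) field_differentiable (at l)"
proof -
  obtain f' where f': "(f has_derivative f') (at (a + l *s v))" and lin: "\<And>c v. f' (c *s v) = c * f' v"
    using f l S unfolding holomorphic_vec_def by (metis at_within_open)
  have "bounded_linear (\<lambda>l. l *s v)"
    by (intro linear_conv_bounded_linear[THEN iffD1] linearI)
      (simp_all add: vec_eq_iff algebra_simps)
  then have "((\<lambda>l. a + l *s v) has_derivative (\<lambda>h. h *s v)) (at l)"
    using bounded_linear.has_derivative[of "\<lambda>l. l *s v" "\<lambda>x. x" "\<lambda>x. x" "at l"]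
    by (auto intro!: derivative_eq_intros)
  from has_derivative_compose[OF this f'] have "((\<lambda>l. f (a + l *s v)) has_derivative (\<lambda>h. f' v * h)) (at l)"
    by (simp add: lin mult.commute)
  then show ?thesis
    unfolding field_differentiable_def has_field_derivative_def by blast
qed

text \<open>Cauchy's formula at the centre followed by the triangle inequality. The circle is
  parametrised over [0,1], so the mean carries total mass 1.\<close>

lemma norm_center_le_circle_mean:
  assumes cont: "continuous_on (cball 0 1) g" and hol: "g holomorphic_on ball 0 1"
  shows "ennreal (cmod (g 0)) \<le>
    (\<integral>\<^sup>+t. ennreal (cmod (g (exp (2 * of_real pi * \<i> * complex_of_real t)))) * indicator {0..1} t \<partial>lborel)"
proof -
  define e where "e t = exp (2 * of_real pi * \<i> * complex_of_real t)" for t :: real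
  have e: "cmod (e t) = 1" for t by (simp add: e_def norm_exp_eq_Re)
  have e0: "e t \<noteq> 0" for t by (simp add: e_def)
  have ce: "continuous_on S e" for S unfolding e_def by (intro continuous_intros)
  have cg: "continuous_on {0..1} (\<lambda>t. g (e t))"
    by (rule continuous_on_compose2[OF cont ce]) (auto simp: e)
  have "((\<lambda>u. g u / (u - 0)) has_contour_integral (2 * of_real pi * \<i> * g 0)) (circlepath 0 1)"
    by (rule Cauchy_integral_circlepath[OF cont hol]) simp
  then have "((\<lambda>t. g (circlepath 0 1 t) / circlepath 0 1 t * vector_derivative (circlepath 0 1) (at t within {0..1}))
      has_integral (2 * of_real pi * \<i> * g 0)) {0..1}"
    by (simp add: has_contour_integral_def)
  then have "((\<lambda>t. 2 * of_real pi * \<i> * g (e t)) has_integral (2 * of_real pi * \<i> * g 0)) {0..1}"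
    by (rule has_integral_eq[rotated])
      (simp add: vector_derivative_circlepath01, simp add: circlepath e_def)
  from has_integral_mult_right[OF this, of "1 / (2 * of_real pi * \<i>)"]
  have I: "((\<lambda>t. g (e t)) has_integral g 0) {0..1}" by simp
  have n: "(\<lambda>t. cmod (g (e t))) integrable_on {0..1}"
    by (intro integrable_continuous_interval continuous_intros cg)
  have "cmod (g 0) \<le> integral {0..1} (\<lambda>t. cmod (g (e t)))"
    using integral_norm_bound_integral[of "\<lambda>t. g (e t)" "{0..1}" "\<lambda>t. cmod (g (e t))"] I n
    by (simp add: has_integral_iff)
  also have "ennreal \<dots> = (\<integral>\<^sup>+t. ennreal (cmod (g (e t))) * indicator {0..1} t \<partial>lborel)"
    by (rule nn_integral_has_integral_lebesgue'[symmetric]) (use n in auto)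
  finally show ?thesis by (simp add: e_def ennreal_leI)
qed

lemma borel_measurable_continuous_on_open_indicator:
  fixes f :: "'a::topological_space \<Rightarrow> 'b::real_normed_vector"
  assumes "continuous_on S f" "open S"
  shows "(\<lambda>x. indicator S x *\<^sub>R f x) \<in> borel_measurable borel"
  using borel_measurable_continuous_on_indicator[OF _ assms(1)] assms(2) by simp

text \<open>Elements of the Bergman spaces are arbitrary off the half-space, so measurability is
  asserted only for the product with the indicator.\<close>

lemma measurable_norm_powr_on_open:
  fixes f :: "'a::topological_space \<Rightarrow> complex"
  assumes "continuous_on S f" "open S"
  shows "(\<lambda>x. ennreal (cmod (f x) powr q) * indicator S x) \<in> borel_measurable borel"
proof -
  have [measurable]: "(\<lambda>x. indicator S x *\<^sub>R f x) \<in> borel_measurable borel"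
    by (rule borel_measurable_continuous_on_open_indicator[OF assms])
  have [measurable]: "S \<in> sets borel" using assms(2) by simp
  have "(\<lambda>x. ennreal (cmod (indicator S x *\<^sub>R f x) powr q) * indicator S x) \<in> borel_measurable borel"
    by measurable
  moreover have "(\<lambda>x. ennreal (cmod (indicator S x *\<^sub>R f x) powr q) * indicator S x)
      = (\<lambda>x. ennreal (cmod (f x) powr q) * indicator S x)"
    by (auto simp: indicator_def)
  ultimately show ?thesis by simp
qed

text \<open>Each \<open>y\<close> in the centred ball spans a disc in the slice through
  \<open>a\<close>, on which the circle mean inequality holds. Integrating over \<open>y\<close> and
  exchanging the integrals, the rotation by \<open>e t\<close> leaves the integral over the ball
  unchanged, so the average over \<open>t\<close> drops out.\<close>

lemma holomorphic_vec_ball_mean: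
  fixes f :: "complex ^ 'n::finite \<Rightarrow> complex"
  assumes f: "holomorphic_vec f S" and S: "open S" and sub: "cball a s \<subseteq> S" and s: "s > 0"
  shows "ennreal (cmod (f a)) * emeasure lborel (ball a s) \<le> (\<integral>\<^sup>+x\<in>ball a s. ennreal (cmod (f x)) \<partial>lborel)"
proof -
  define G where "G x = ennreal (cmod (f x)) * indicator (ball a s) x" for x
  have cont: "continuous_on (ball a s) f"
    using holomorphic_vec_imp_continuous_on[OF f] sub ball_subset_cball continuous_on_subset by blast
  have [measurable]: "G \<in> borel_measurable borel"
    using measurable_norm_powr_on_open[OF cont, of 1] unfolding G_def by simp
  define e where "e t = exp (2 * of_real pi * \<i> * complex_of_real t)" for t :: real
  have e: "cmod (e t) = 1" for t by (simp add: e_def norm_exp_eq_Re)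
  have me: "(\<lambda>p. a + e (snd p) *s fst p) \<in> borel_measurable (borel \<Otimes>\<^sub>M borel :: ((complex ^ 'n) \<times> real) measure)"
    unfolding borel_prod e_def by (intro borel_measurable_continuous_onI continuous_intros)
  have me2 [measurable]: "(\<lambda>y. a + e t *s y) \<in> borel_measurable (borel :: (complex ^ 'n) measure)" for t
    by (intro borel_measurable_continuous_onI continuous_intros)
  have pt: "ennreal (cmod (f a)) * indicator (ball 0 s) y
      \<le> (\<integral>\<^sup>+t. G (a + e t *s y) * indicator {0..1} t \<partial>lborel)" for y
  proof (cases "norm y < s")
    case y: True
    have mem: "a + l *s y \<in> ball a s" if "cmod l \<le> 1" for l
    proof -
      have "cmod l * norm y \<le> 1 * norm y" by (intro mult_right_mono that) simp
      then show ?thesis using y by (simp add: dist_norm norm_vector_smult)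
    qed
    have mem': "a + l *s y \<in> S" if "cmod l \<le> 1" for l
      using mem[OF that] sub by (auto simp: subset_iff)
    have d: "(\<lambda>l. f (a + l *s y)) field_differentiable (at l)" if "cmod l \<le> 1" for l
      by (rule holomorphic_vec_slice[OF f S mem'[OF that]])
    have "ennreal (cmod (f (a + 0 *s y))) \<le>
      (\<integral>\<^sup>+t. ennreal (cmod (f (a + e t *s y))) * indicator {0..1} t \<partial>lborel)"
      unfolding e_def
    proof (rule norm_center_le_circle_mean)
      show "continuous_on (cball 0 1) (\<lambda>l. f (a + l *s y))"
        by (intro continuous_at_imp_continuous_on ballI field_differentiable_imp_continuous_at d) simp
      show "(\<lambda>l. f (a + l *s y)) holomorphic_on ball 0 1"
        unfolding holomorphic_on_def by (auto intro!: field_differentiable_at_within[OF d])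
    qed
    also have "\<dots> = (\<integral>\<^sup>+t. G (a + e t *s y) * indicator {0..1} t \<partial>lborel)"
      using mem by (intro nn_integral_cong) (simp add: G_def e)
    finally show ?thesis using y by simp
  qed simp
  have "ennreal (cmod (f a)) * emeasure lborel (ball a s)
      = ennreal (cmod (f a)) * emeasure lborel (ball (0 :: complex ^ 'n) s)"
    using s by (simp add: emeasure_ball)
  also have "\<dots> = (\<integral>\<^sup>+(y :: (complex, 'n) vec). ennreal (cmod (f a)) * indicator (ball 0 s) y \<partial>lborel)"
    by (subst nn_integral_cmult_indicator) simp_all
  also have "\<dots> \<le> (\<integral>\<^sup>+y. (\<integral>\<^sup>+t. G (a + e t *s y) * indicator {0..1} t \<partial>lborel) \<partial>lborel)"
    by (intro nn_integral_mono pt)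
  also have "\<dots> = (\<integral>\<^sup>+t. (\<integral>\<^sup>+y. G (a + e t *s y) * indicator {0..1} t \<partial>lborel) \<partial>lborel)"
  proof (rule lborel_Fubini)
    have [measurable]: "(\<lambda>p. G (a + e (snd p) *s fst p)) \<in> borel_measurable (borel \<Otimes>\<^sub>M borel)"
      by (rule measurable_compose[OF me]) measurable
    show "(\<lambda>(y, t). G (a + e t *s y) * indicator {0..1} t) \<in> borel_measurable (borel \<Otimes>\<^sub>M borel)"
      unfolding case_prod_unfold by measurable
  qed
  also have "\<dots> = (\<integral>\<^sup>+t. (\<integral>\<^sup>+x. G x \<partial>lborel) * indicator {0..1::real} t \<partial>lborel)"
  proof (rule nn_integral_cong)
    fix t :: real
    have "(\<integral>\<^sup>+y. G (a + e t *s y) \<partial>lborel) = (\<integral>\<^sup>+x. G x \<partial>lborel)"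
      using nn_integral_lborel_rotate[of "\<lambda>x. G (a + x)" "e t"] nn_integral_lborel_translate[of G a]
      by (simp add: e add.commute)
    then show "(\<integral>\<^sup>+y. G (a + e t *s y) * indicator {0..1} t \<partial>lborel) = (\<integral>\<^sup>+x. G x \<partial>lborel) * indicator {0..1} t"
      by (simp add: nn_integral_multc)
  qed
  also have "\<dots> = (\<integral>\<^sup>+x. G x \<partial>lborel)"
    by (simp add: nn_integral_cmult)
  finally show ?thesis by (simp add: G_def)
qed

text \<open>Above the threshold \<open>a\<close> the factor \<open>(x / a) powr (q - 1)\<close> is
  at least 1. The free threshold lets this play the part of Jensen's or Hoelder's inequality: it is
  chosen afterwards to balance the two terms.\<close>

lemma le_add_powr:
  fixes x a q :: real
  assumes "0 \<le> x" "0 < a" "1 \<le> q"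
  shows "x \<le> a + a powr (1 - q) * x powr q"
proof (cases "x \<le> a")
  case True
  then show ?thesis by (smt (verit) mult_nonneg_nonneg powr_ge_zero)
next
  case False
  then have "x = x powr (1 - q) * x powr q" using assms by (simp flip: powr_add)
  also have "\<dots> \<le> a powr (1 - q) * x powr q"
    using False assms by (intro mult_right_mono powr_mono2') auto
  finally show ?thesis using assms by linarith
qed

text \<open>
  For \<open>q < 1\<close> this is the Hardy-Littlewood argument: the maximum \<open>M\<close> of \<open>(\<delta> - \<bar>x - a\<bar>)\<^bsup>D/q\<^esup> \<bar>f x\<bar>\<close>
  over the ball controls \<open>\<bar>f\<bar>\<^bsup>1-q\<^esup>\<close> near the maximum point, where the mean value inequality for
  \<open>\<bar>f\<bar>\<close> can then be absorbed.
\<close>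

lemma holomorphic_vec_powr_ball_mean:
  fixes \<delta> q :: real
  assumes q: "q > 0" and d: "\<delta> > 0"
  obtains C where "C > 0"
    "\<And>f :: complex ^ 'n::finite \<Rightarrow> complex. \<And>S a. holomorphic_vec f S \<Longrightarrow> open S \<Longrightarrow> cball a \<delta> \<subseteq> S \<Longrightarrow>
       ennreal (cmod (f a) powr q) \<le> ennreal C * (\<integral>\<^sup>+x\<in>ball a \<delta>. ennreal (cmod (f x) powr q) \<partial>lborel)"
proof -
  let ?D = "DIM(complex ^ 'n)"
  define D where "D = real ?D"
  define \<nu> where "\<nu> = unit_ball_vol (real ?D)"
  have \<nu>: "\<nu> > 0" by (simp add: \<nu>_def)
  have vol: "emeasure lborel (ball (a :: complex ^ 'n) s) = ennreal (\<nu> * s powr D)" if "s > 0" for a s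
  proof -
    have "s powr D = s ^ ?D" using that by (simp only: D_def powr_realpow)
    then show ?thesis using that by (simp add: emeasure_ball \<nu>_def)
  qed
  have [measurable]: "ball b s \<in> sets borel" for b :: "(complex, 'n) vec" and s
    by simp
  show ?thesis
  proof (cases "q \<ge> 1")
    case q1: True
    define C where "C = 2 powr q / (\<nu> * \<delta> powr D)"
    have C: "C > 0" using \<nu> d by (simp add: C_def)
    show ?thesis
    proof (rule that[OF C])
      fix f :: "complex ^ 'n::finite \<Rightarrow> complex" and S a
      assume f: "holomorphic_vec f S" and S: "open S" and sub: "cball a \<delta> \<subseteq> S"
      let ?I = "\<integral>\<^sup>+x\<in>ball a \<delta>. ennreal (cmod (f x) powr q) \<partial>lborel"
      \<comment> \<open>Half the central value, so that the term \<open>A\<close> times the volume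
        on the right is absorbed by \<open>2 * A\<close> times the volume on the left.\<close>
      define A where "A = cmod (f a) / 2"
      have cont: "continuous_on (ball a \<delta>) f"
        using holomorphic_vec_imp_continuous_on[OF f] sub ball_subset_cball continuous_on_subset by blast
      have [measurable]: "(\<lambda>x. ennreal (cmod (f x) powr q) * indicator (ball a \<delta>) x) \<in> borel_measurable borel"
        by (rule measurable_norm_powr_on_open[OF cont]) simp
      show "ennreal (cmod (f a) powr q) \<le> ennreal C * ?I"
      proof (cases "A = 0 \<or> ?I = \<infinity>")
        case True
        then show ?thesis using C by (auto simp: A_def ennreal_mult_top)
      next
        case False
        then have A: "A > 0" by (simp add: A_def)
        from False obtain i where i: "?I = ennreal i" "i \<ge> 0" by (cases ?I) auto
        have "ennreal (2 * A) * ennreal (\<nu> * \<delta> powr D) \<le> (\<integral>\<^sup>+x\<in>ball a \<delta>. ennreal (cmod (f x)) \<partial>lborel)"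
          using holomorphic_vec_ball_mean[OF f S sub d] by (simp add: vol[OF d] A_def)
        also have "\<dots> \<le> (\<integral>\<^sup>+x. ennreal A * indicator (ball a \<delta>) x
            + ennreal (A powr (1 - q)) * (ennreal (cmod (f x) powr q) * indicator (ball a \<delta>) x) \<partial>lborel)"
          using le_add_powr[OF norm_ge_zero A q1] A
          by (intro nn_integral_mono) (auto simp: indicator_def ennreal_leI simp flip: ennreal_plus ennreal_mult)
        also have "\<dots> = ennreal A * ennreal (\<nu> * \<delta> powr D) + ennreal (A powr (1 - q)) * ?I"
          by (simp add: nn_integral_add nn_integral_cmult vol[OF d])
        finally have "2 * A * (\<nu> * \<delta> powr D) \<le> A * (\<nu> * \<delta> powr D) + A powr (1 - q) * i"
          using A \<nu> i by (simp flip: ennreal_plus ennreal_mult)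
        then have "A * (\<nu> * \<delta> powr D) \<le> A powr (1 - q) * i" by simp
        then have "A powr (q - 1) * (A * (\<nu> * \<delta> powr D)) \<le> A powr (q - 1) * (A powr (1 - q) * i)"
          by (intro mult_left_mono) auto
        also have "\<dots> = i" using A by (simp flip: mult.assoc powr_add)
        also have "A powr (q - 1) * (A * (\<nu> * \<delta> powr D)) = A powr q * (\<nu> * \<delta> powr D)"
          using A powr_mult_base[of A "q - 1"] by (simp add: algebra_simps)
        finally have "A powr q \<le> i / (\<nu> * \<delta> powr D)"
          using \<nu> d by (simp add: field_simps)
        from mult_left_mono[OF this, of "2 powr q"]
        have "2 powr q * A powr q \<le> C * i" by (simp add: C_def)
        then have "cmod (f a) powr q \<le> C * i"
          by (simp add: A_def powr_divide)
        then show ?thesis using i C by (simp flip: ennreal_mult)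
      qed
    qed
  next
    case False
    then have q1: "q < 1" by simp
    define C where "C = 2 powr (D / q) / (\<nu> * \<delta> powr D)"
    have C: "C > 0" using \<nu> d by (simp add: C_def)
    show ?thesis
    proof (rule that[OF C])
      fix f :: "complex ^ 'n::finite \<Rightarrow> complex" and S a
      assume f: "holomorphic_vec f S" and S: "open S" and sub: "cball a \<delta> \<subseteq> S"
      let ?I = "\<integral>\<^sup>+x\<in>ball a \<delta>. ennreal (cmod (f x) powr q) \<partial>lborel"
      have cont: "continuous_on (cball a \<delta>) f"
        using holomorphic_vec_imp_continuous_on[OF f] sub continuous_on_subset by blast
      have [measurable]: "(\<lambda>x. ennreal (cmod (f x) powr q) * indicator (ball b s) x) \<in> borel_measurable borel"
        if "ball b s \<subseteq> ball a \<delta>" for b s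
        by (rule measurable_norm_powr_on_open[OF continuous_on_subset[OF cont]]) (use that in auto)
      define \<phi> where "\<phi> x = (\<delta> - dist a x) powr (D / q) * cmod (f x)" for x
      have Dq: "D / q > 0" using q by (simp add: D_def)
      have "continuous_on (cball a \<delta>) \<phi>"
        unfolding \<phi>_def using Dq by (intro continuous_intros continuous_on_powr' cont) auto
      then obtain w where w: "w \<in> cball a \<delta>" and max: "\<And>x. x \<in> cball a \<delta> \<Longrightarrow> \<phi> x \<le> \<phi> w"
        using continuous_attains_sup[of "cball a \<delta>" \<phi>] d by auto
      define M where "M = \<phi> w"
      have a: "\<delta> powr (D / q) * cmod (f a) \<le> M" using max[of a] d by (simp add: \<phi>_def M_def)
      show "ennreal (cmod (f a) powr q) \<le> ennreal C * ?I"
      proof (cases "M = 0 \<or> ?I = \<infinity>")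
        case True
        then show ?thesis
        proof
          assume "M = 0"
          then have "cmod (f a) = 0" using a d
            by (metis mult_nonneg_nonneg norm_ge_zero order_antisym mult_eq_0_iff powr_eq_0_iff less_irrefl powr_ge_zero)
          then show ?thesis by simp
        qed (use C in \<open>auto simp: ennreal_mult_top\<close>)
      next
        case False
        then obtain i where i: "?I = ennreal i" "i \<ge> 0" by (cases ?I) auto
        have M: "M > 0" using False by (simp add: M_def \<phi>_def less_le)
        have wd: "dist a w < \<delta>" using M w by (auto simp: M_def \<phi>_def less_le)
        \<comment> \<open>Half the distance from the maximum point to the sphere: on
          \<open>ball w s\<close> the weight is at least \<open>s powr (D / q)\<close>, hence the
          upper bound \<open>B\<close> for \<open>f\<close> there.\<close>
        define s where "s = (\<delta> - dist a w) / 2"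
        have s: "s > 0" using wd by (simp add: s_def)
        have x: "dist a x \<le> \<delta> - s" if "dist w x \<le> s" for x
          using dist_triangle[of a x w] that by (simp add: s_def field_simps)
        have csub: "cball w s \<subseteq> S"
          using x s sub by (force simp: subset_iff)
        have bsub: "ball w s \<subseteq> ball a \<delta>"
        proof
          fix y assume "y \<in> ball w s"
          then show "y \<in> ball a \<delta>" using x[of y] s by simp
        qed
        define B where "B = M * s powr (- (D / q))"
        have B: "B > 0" using M s by (simp add: B_def)
        have fB: "cmod (f x) \<le> B" if "x \<in> ball w s" for x
        proof -
          have "dist a x \<le> \<delta> - s" using x that by auto
          then have "s powr (D / q) * cmod (f x) \<le> \<phi> x"
            unfolding \<phi>_def using s Dq by (intro mult_right_mono powr_mono2) auto
          also have "\<dots> \<le> M" unfolding M_def using bsub that by (intro max) auto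
          finally show ?thesis using s by (simp add: B_def powr_minus field_simps)
        qed
        \<comment> \<open>At \<open>w\<close> the weight is exactly
          \<open>(2 * s) powr (D / q)\<close>, so the central value falls short of the bound
          \<open>B\<close> only by a fixed factor.\<close>
        have fw: "cmod (f w) = B * 2 powr (- (D / q))"
        proof -
          have "\<delta> - dist a w = 2 * s" by (simp add: s_def)
          then have "M = (2 * s) powr (D / q) * cmod (f w)" by (simp only: M_def \<phi>_def)
          then show ?thesis using s by (simp add: B_def powr_mult powr_minus field_simps)
        qed
        have "ennreal (cmod (f w)) * ennreal (\<nu> * s powr D) \<le> (\<integral>\<^sup>+x\<in>ball w s. ennreal (cmod (f x)) \<partial>lborel)"
          using holomorphic_vec_ball_mean[OF f S csub s] by (simp add: vol[OF s])
        also have "\<dots> \<le> (\<integral>\<^sup>+x. ennreal (B powr (1 - q)) * (ennreal (cmod (f x) powr q) * indicator (ball w s) x) \<partial>lborel)"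
        proof (intro nn_integral_mono)
          fix x
          have "cmod (f x) \<le> B powr (1 - q) * cmod (f x) powr q" if "x \<in> ball w s"
          proof (cases "f x = 0")
            case fx: False
            have "cmod (f x) = cmod (f x) powr (1 - q) * cmod (f x) powr q"
              using fx by (simp flip: powr_add)
            also have "\<dots> \<le> B powr (1 - q) * cmod (f x) powr q"
              using fB[OF that] q1 by (intro mult_right_mono powr_mono2) auto
            finally show ?thesis .
          qed simp
          then show "ennreal (cmod (f x)) * indicator (ball w s) x
              \<le> ennreal (B powr (1 - q)) * (ennreal (cmod (f x) powr q) * indicator (ball w s) x)"
            by (auto simp: indicator_def ennreal_leI simp flip: ennreal_mult)
        qed
        also have "\<dots> = ennreal (B powr (1 - q)) * (\<integral>\<^sup>+x\<in>ball w s. ennreal (cmod (f x) powr q) \<partial>lborel)"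
          using bsub by (simp add: nn_integral_cmult)
        also have "\<dots> \<le> ennreal (B powr (1 - q)) * ?I"
          using bsub by (intro mult_left_mono nn_integral_mono) (auto simp: indicator_def)
        finally have "cmod (f w) * (\<nu> * s powr D) \<le> B powr (1 - q) * i"
          using \<nu> i by (simp flip: ennreal_mult)
        then have "B powr (q - 1) * (cmod (f w) * (\<nu> * s powr D)) \<le> B powr (q - 1) * (B powr (1 - q) * i)"
          by (intro mult_left_mono) auto
        also have "\<dots> = i" using B by (simp flip: mult.assoc powr_add)
        also have "B powr (q - 1) * (cmod (f w) * (\<nu> * s powr D))
            = (B powr (q - 1) * B) * s powr D * (2 powr (- (D / q)) * \<nu>)"
          by (simp add: fw)
        \<comment> \<open>The exponent \<open>D / q\<close> of the weight was chosen for this: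
          \<open>B powr q\<close> carries \<open>s powr (- D)\<close>, which cancels the volume of
          \<open>ball w s\<close>, and the bound becomes independent of the position of
          \<open>w\<close>.\<close>
        also have "B powr (q - 1) * B = M powr q * s powr (- D)"
        proof -
          have "B powr (q - 1) * B = B powr q"
            using B powr_mult_base[of B "q - 1"] by (simp add: algebra_simps)
          also have "\<dots> = M powr q * s powr (- D)"
            using M s q by (simp add: B_def powr_mult powr_powr)
          finally show ?thesis .
        qed
        also have "M powr q * s powr (- D) * s powr D * (2 powr (- (D / q)) * \<nu>) = M powr q * (2 powr (- (D / q)) * \<nu>)"
          using s by (simp add: powr_minus)
        finally have MI: "M powr q * (2 powr (- (D / q)) * \<nu>) \<le> i" .
        have "\<delta> powr D * cmod (f a) powr q = (\<delta> powr (D / q) * cmod (f a)) powr q"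
          using q d by (simp add: powr_mult powr_powr)
        also have "\<dots> \<le> M powr q" using a q d by (intro powr_mono2) auto
        finally have "\<delta> powr D * cmod (f a) powr q * (2 powr (- (D / q)) * \<nu>) \<le> i"
          using MI \<nu> by (smt (verit) mult_right_mono mult_nonneg_nonneg powr_ge_zero)
        then have "cmod (f a) powr q \<le> C * i"
          using d \<nu> by (simp add: C_def powr_minus field_simps)
        then show ?thesis using i C by (simp flip: ennreal_mult)
      qed
    qed
  qed
qed

section \<open>Bergman balls\<close>

text \<open>\<open>siegel_map z\<close> is affine with complex linear part, because its variable
  enters \<open>hdot\<close> only in the linear slot.\<close>

lemma holomorphic_vec_siegel_map:
  fixes f :: "complex ^ 'n::{finite,linorder} \<Rightarrow> complex"
  assumes f: "holomorphic_vec f siegel" and z: "z \<in> siegel"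
  shows "holomorphic_vec (\<lambda>v. f (siegel_map z v)) siegel"
  unfolding holomorphic_vec_def
proof
  fix v :: "(complex, 'n) vec" assume v: "v \<in> siegel"
  then have "siegel_map z v \<in> siegel" using siegel_map_in_siegel_iff[OF z] by simp
  then obtain f' where f': "(f has_derivative f') (at (siegel_map z v))" and lin: "\<And>c v. f' (c *s v) = c * f' v"
    using f unfolding holomorphic_vec_def by (metis at_within_open open_siegel)
  define L where "L u = siegel_map z u - siegel_map z 0" for u
  have L_smult: "L (c *s u) = c *s L u" for c u
    by (simp add: L_def siegel_map_def vec_eq_iff hdot_smult_left algebra_simps) (simp add: hdot_def)
  have "L (u + w) = L u + L w" for u w
    by (simp add: L_def siegel_map_def vec_eq_iff hdot_add_left algebra_simps) (simp add: hdot_def)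
  moreover have "L (r *\<^sub>R u) = r *\<^sub>R L u" for r u
  proof -
    have *: "r *\<^sub>R x = complex_of_real r *s x" for x :: "(complex, 'n) vec"
      by (simp add: vec_eq_iff scaleR_conv_of_real[where 'a=complex])
    show ?thesis unfolding * by (rule L_smult)
  qed
  ultimately have "bounded_linear L"
    by (intro linear_conv_bounded_linear[THEN iffD1] linearI)
  then have "(L has_derivative L) (at v)" by (rule bounded_linear_imp_has_derivative)
  from has_derivative_add_const[OF this, of "siegel_map z 0"]
  have "(siegel_map z has_derivative L) (at v)" by (simp add: L_def)
  from has_derivative_compose[OF this f']
  have "((\<lambda>v. f (siegel_map z v)) has_derivative (\<lambda>h. f' (L h))) (at v within siegel)"
    by (simp add: has_derivative_at_withinI)
  moreover have "\<forall>c u. f' (L (c *s u)) = c * f' (L u)" by (simp add: L_smult lin)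
  ultimately show "\<exists>f'. ((\<lambda>v. f (siegel_map z v)) has_derivative f') (at v within siegel) \<and>
      (\<forall>c u. f' (c *s u) = c * f' u)" by (intro exI[of _ "\<lambda>h. f' (L h)"]) simp
qed

lemma tanh_sq_less_1: "(tanh r)\<^sup>2 < (1::real)"
  using tanh_real_bounds[of r] by (auto simp: abs_square_less_1 abs_less_iff)

text \<open>Both sides of the inequality defining the ball scale by the square of
  \<open>rho_diag z\<close>.\<close>

lemma siegel_map_in_bergman_ball_iff:
  assumes z: "z \<in> siegel" and r: "r > 0"
  shows "siegel_map z v \<in> bergman_ball z r \<longleftrightarrow> v \<in> bergman_ball base_point r"
proof -
  have p: "rho_diag z > 0" using z by (simp add: siegel_iff)
  have "cmod (rho z (siegel_map z v)) = rho_diag z * cmod (rho base_point v)"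
    using rho_siegel_map[OF z, of base_point v] p by (simp add: norm_mult)
  moreover have "c * (rho_diag z * R)\<^sup>2 < rho_diag z * (rho_diag z * d) \<longleftrightarrow> c * R\<^sup>2 < d" for c R d
  proof -
    have "c * (rho_diag z * R)\<^sup>2 = (rho_diag z)\<^sup>2 * (c * R\<^sup>2)"
      "rho_diag z * (rho_diag z * d) = (rho_diag z)\<^sup>2 * d"
      by (simp_all add: power2_eq_square mult_ac)
    then show ?thesis using p by (simp only: mult_less_cancel_left_pos zero_less_power)
  qed
  ultimately show ?thesis
    unfolding bergman_ball_iff[OF z r] bergman_ball_iff[OF base_point_in_siegel r]
    by (simp only: siegel_map_in_siegel_iff[OF z] rho_diag_siegel_map[OF z] rho_diag_base_point mult_1)
qed

lemma open_bergman_ball: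
  fixes z :: "complex ^ 'n::{finite,linorder}"
  assumes z: "z \<in> siegel" and r: "r > 0"
  shows "open (bergman_ball z r)"
proof -
  have "bergman_ball z r = siegel \<inter> {w. (1 - (tanh r)\<^sup>2) * (cmod (rho z w))\<^sup>2 < rho_diag z * rho_diag w}"
    using bergman_ball_iff[OF z r] by auto
  also have "open \<dots>"
    by (intro open_Int open_siegel open_Collect_less continuous_intros)
  finally show ?thesis .
qed

lemma center_in_bergman_ball: "z \<in> siegel \<Longrightarrow> r > 0 \<Longrightarrow> z \<in> bergman_ball z r"
  using tanh_sq_less_1[of r]
  by (simp add: bergman_ball_iff rho_self power2_eq_square siegel_iff)

lemma bergman_ball_commute:
  assumes "z \<in> siegel" "w \<in> siegel" "r > 0"
  shows "w \<in> bergman_ball z r \<longleftrightarrow> z \<in> bergman_ball w r"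
  using assms by (simp add: bergman_ball_iff cmod_rho_commute[of z w] mult.commute)

text \<open>With \<open>c = 1 - (tanh r)\<^sup>2\<close>, the ball condition and
  \<open>rho_diag w \<le> 2 * R\<close> give \<open>c * R\<^sup>2 \<le> 2 * rho_diag z * R\<close>;
  one power of \<open>R\<close> cancels. The remaining comparison follows by exchanging the two
  points.\<close>

lemma bergman_ball_bounds:
  assumes r: "r > 0"
  obtains B where "B > 0"
    "\<And>z w :: complex ^ 'n::{finite,linorder}. z \<in> siegel \<Longrightarrow> w \<in> bergman_ball z r \<Longrightarrow>
      rho_diag w \<le> B * rho_diag z \<and> rho_diag z \<le> B * rho_diag w \<and> cmod (rho z w) \<le> B * rho_diag z"
proof -
  define c where "c = 1 - (tanh r)\<^sup>2"
  have c: "c > 0" using tanh_sq_less_1[of r] by (simp add: c_def)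
  have *: "cmod (rho z w) \<le> 2 / c * rho_diag z \<and> rho_diag w \<le> 4 / c * rho_diag z"
    if z: "z \<in> siegel" and w: "w \<in> bergman_ball z r" for z w :: "complex ^ 'n::{finite,linorder}"
  proof -
    define R where "R = cmod (rho z w)"
    have ws: "w \<in> siegel" and lt: "c * R\<^sup>2 < rho_diag z * rho_diag w"
      using w bergman_ball_iff[OF z r] by (auto simp: c_def R_def)
    have R: "R > 0" using cmod_rho_pos[OF z ws] by (simp add: R_def)
    have wR: "rho_diag w \<le> 2 * R" using rho_diag_le'[OF z ws] by (simp add: R_def)
    have zp: "rho_diag z > 0" using z by (simp add: siegel_iff)
    have "c * R\<^sup>2 \<le> rho_diag z * (2 * R)"
      using lt mult_left_mono[OF wR, of "rho_diag z"] zp by linarith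
    then have "c * R \<le> 2 * rho_diag z" using R by (simp add: power2_eq_square)
    then have 1: "R \<le> 2 / c * rho_diag z" using c by (simp add: field_simps)
    moreover have "rho_diag w \<le> 2 * (2 / c * rho_diag z)" using wR 1 by linarith
    then have "rho_diag w \<le> 4 / c * rho_diag z" by simp
    ultimately show ?thesis by (simp add: R_def)
  qed
  show ?thesis
  proof (rule that[of "4 / c"])
    fix z w :: "complex ^ 'n::{finite,linorder}"
    assume z: "z \<in> siegel" and w: "w \<in> bergman_ball z r"
    have ws: "w \<in> siegel" using w by (simp add: bergman_ball_def)
    have zw: "z \<in> bergman_ball w r" using bergman_ball_commute[OF z ws r] w by simp
    have "2 / c * rho_diag z \<le> 4 / c * rho_diag z"
      using c z by (intro mult_right_mono divide_right_mono) (auto simp: siegel_iff)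
    then show "rho_diag w \<le> 4 / c * rho_diag z \<and> rho_diag z \<le> 4 / c * rho_diag w \<and> cmod (rho z w) \<le> 4 / c * rho_diag z"
      using *[OF z w] *[OF ws zw] by linarith
  qed (use c in simp)
qed

lemma set_nn_integral_siegel_map:
  fixes F :: "complex ^ 'n::{finite,linorder} \<Rightarrow> ennreal"
  assumes z: "z \<in> siegel" and m: "(\<lambda>w. F w * indicator A w) \<in> borel_measurable borel"
    and iff: "\<And>v. siegel_map z v \<in> A \<longleftrightarrow> v \<in> B"
  shows "ennreal (rho_diag z ^ (CARD('n) + 1)) * (\<integral>\<^sup>+v\<in>B. F (siegel_map z v) \<partial>lborel) = (\<integral>\<^sup>+v\<in>A. F v \<partial>lborel)"
proof -
  have "indicator A (siegel_map z v) = (indicator B v :: ennreal)" for v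
    by (simp add: indicator_def iff)
  then show ?thesis using nn_integral_siegel_map[OF m z] by simp
qed

lemma emeasure_bergman_ball:
  fixes z :: "complex ^ 'n::{finite,linorder}"
  assumes z: "z \<in> siegel" and r: "r > 0"
  shows "emeasure lborel (bergman_ball z r) =
    ennreal (rho_diag z ^ (CARD('n) + 1)) * emeasure lborel (bergman_ball (base_point :: (complex, 'n) vec) r)"
proof -
  note [measurable] = borel_open[OF open_bergman_ball[OF z r]]
    borel_open[OF open_bergman_ball[OF base_point_in_siegel r]]
  show ?thesis
    using set_nn_integral_siegel_map[OF z, of "\<lambda>_. 1" "bergman_ball z r" "bergman_ball base_point r"]
    by (simp add: siegel_map_in_bergman_ball_iff[OF z r])
qed

text \<open>Finite because the bound on \<open>rho base_point w\<close> confines the last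
  coordinate, and membership in the half-space then confines the others through
  \<open>(hnorm w)\<^sup>2 \<le> Im (w $ last_ix)\<close>; positive because the ball is open and
  nonempty.\<close>

lemma emeasure_bergman_ball_base_point:
  assumes r: "r > 0"
  obtains V where "V > 0" "emeasure lborel (bergman_ball (base_point :: complex ^ 'n::{finite,linorder}) r) = ennreal V"
proof -
  let ?E = "bergman_ball (base_point :: (complex, 'n) vec) r"
  have o: "open ?E" by (rule open_bergman_ball[OF base_point_in_siegel r])
  obtain B where B: "B > 0"
    "\<And>z w :: (complex, 'n) vec. z \<in> siegel \<Longrightarrow> w \<in> bergman_ball z r \<Longrightarrow>
      rho_diag w \<le> B * rho_diag z \<and> rho_diag z \<le> B * rho_diag w \<and> cmod (rho z w) \<le> B * rho_diag z"
    by (rule bergman_ball_bounds[OF r, where 'n = 'n]) (rule that)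
  have "bounded ?E"
    unfolding bounded_iff
  proof (intro exI[of _ "\<Sum>i\<in>(UNIV::'n set). 2 + 2 * B"] ballI)
    fix w assume w: "w \<in> ?E"
    then have ws: "w \<in> siegel" by (simp add: bergman_ball_def)
    have "cmod (rho base_point w) \<le> B" using B(2)[OF base_point_in_siegel w] by simp
    then have 1: "cmod (w $ last_ix + \<i>) \<le> 2 * B"
      using cmod_rho_commute[of w base_point] by (simp add: rho_base_point norm_mult)
    have l: "cmod (w $ last_ix) \<le> 2 + 2 * B"
      using norm_triangle_ineq4[of "w $ last_ix + \<i>" \<i>] 1 by simp
    have "(hnorm w)\<^sup>2 \<le> Im (w $ last_ix)" using ws by (simp add: siegel_def)
    also have "\<dots> \<le> 2 * B" using abs_Im_le_cmod[of "w $ last_ix + \<i>"] 1 by simp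
    finally have h: "(hnorm w)\<^sup>2 \<le> 2 * B" .
    have "hnorm w \<le> 1 + (hnorm w)\<^sup>2"
      by (smt (verit) hnorm_nonneg mult_left_mono power2_eq_square zero_le_power2 mult_cancel_left1)
    then have h': "hnorm w \<le> 2 + 2 * B" using h by linarith
    have "cmod (w $ i) \<le> 2 + 2 * B" for i
    proof (cases "i = last_ix")
      case False
      then have "cmod (w $ i) \<le> hnorm w"
        unfolding hnorm_L2_set by (intro member_le_L2_set) auto
      then show ?thesis using h' by simp
    qed (use l in simp)
    then show "norm w \<le> (\<Sum>i\<in>(UNIV::'n set). 2 + 2 * B)"
      unfolding norm_vec_def by (intro order_trans[OF L2_set_le_sum] sum_mono) auto
  qed
  then have fin: "emeasure lborel ?E < \<infinity>"
    by (rule emeasure_bounded_finite)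
  have "emeasure lborel ?E \<noteq> 0"
  proof
    assume "emeasure lborel ?E = 0"
    moreover obtain e where e: "e > 0" "ball base_point e \<subseteq> ?E"
      using o center_in_bergman_ball[OF base_point_in_siegel r] open_contains_ball by blast
    ultimately have "emeasure lborel (ball (base_point :: (complex, 'n) vec) e) = 0"
      using emeasure_mono[OF e(2), of lborel] o by auto
    moreover have "0 < unit_ball_vol (real DIM((complex, 'n) vec)) * e ^ DIM((complex, 'n) vec)"
      using e(1) by (intro mult_pos_pos zero_less_power) simp_all
    ultimately show False using e(1) by (metis emeasure_ball ennreal_eq_0_iff less_imp_le not_le)
  qed
  then show ?thesis using that fin
    by (cases "emeasure lborel ?E") (auto simp: ennreal_eq_0_iff not_le)
qed

text \<open>A Euclidean ball inside the Bergman ball at the base point depends on \<open>r\<close>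
  alone, so its constant serves all \<open>z\<close>; the Jacobian of \<open>siegel_map z\<close>
  supplies the factor on the left.\<close>

lemma powr_mean_value_bergman_ball:
  fixes r q :: real
  assumes r: "r > 0" and q: "q > 0"
  obtains C where "C > 0"
    "\<And>(f :: complex ^ 'n::{finite,linorder} \<Rightarrow> complex) z. holomorphic_vec f siegel \<Longrightarrow> z \<in> siegel \<Longrightarrow>
       ennreal (cmod (f z) powr q * rho_diag z ^ (CARD('n) + 1))
       \<le> ennreal C * (\<integral>\<^sup>+w\<in>bergman_ball z r. ennreal (cmod (f w) powr q) \<partial>lborel)"
proof -
  let ?E = "bergman_ball (base_point :: (complex, 'n) vec) r"
  obtain d where d: "d > 0" "cball base_point d \<subseteq> ?E"
    using open_bergman_ball[OF base_point_in_siegel r] center_in_bergman_ball[OF base_point_in_siegel r]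
      open_contains_cball by blast
  have Es: "?E \<subseteq> siegel" by (auto simp: bergman_ball_def)
  obtain C where C: "C > 0"
    "\<And>f :: (complex, 'n) vec \<Rightarrow> complex. \<And>S a. holomorphic_vec f S \<Longrightarrow> open S \<Longrightarrow> cball a d \<subseteq> S \<Longrightarrow>
       ennreal (cmod (f a) powr q) \<le> ennreal C * (\<integral>\<^sup>+x\<in>ball a d. ennreal (cmod (f x) powr q) \<partial>lborel)"
    by (rule holomorphic_vec_powr_ball_mean[OF q d(1), where 'n = 'n]) (rule that)
  show ?thesis
  proof (rule that[OF C(1)])
    fix f :: "(complex, 'n) vec \<Rightarrow> complex" and z :: "(complex, 'n) vec"
    assume f: "holomorphic_vec f siegel" and z: "z \<in> siegel"
    let ?p = "rho_diag z ^ (CARD('n) + 1)"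
    have p: "?p \<ge> 0" using z by (simp add: siegel_iff)
    have cont: "continuous_on (bergman_ball z r) f"
      using holomorphic_vec_imp_continuous_on[OF f] by (rule continuous_on_subset) (auto simp: bergman_ball_def)
    note m = measurable_norm_powr_on_open[OF cont open_bergman_ball[OF z r], of q]
    have "ennreal (cmod (f (siegel_map z base_point)) powr q)
        \<le> ennreal C * (\<integral>\<^sup>+x\<in>ball base_point d. ennreal (cmod (f (siegel_map z x)) powr q) \<partial>lborel)"
      using C(2)[OF holomorphic_vec_siegel_map[OF f z] open_siegel order_trans[OF d(2) Es]] .
    also have "\<dots> \<le> ennreal C * (\<integral>\<^sup>+x\<in>?E. ennreal (cmod (f (siegel_map z x)) powr q) \<partial>lborel)"
    proof (rule mult_left_mono[OF nn_integral_mono])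
      fix x
      have "x \<in> ball base_point d \<Longrightarrow> x \<in> ?E" using d(2) by auto
      then show "ennreal (cmod (f (siegel_map z x)) powr q) * indicator (ball base_point d) x
          \<le> ennreal (cmod (f (siegel_map z x)) powr q) * indicator ?E x"
        by (cases "x \<in> ball base_point d") simp_all
    qed simp
    finally have "ennreal ?p * ennreal (cmod (f z) powr q)
        \<le> ennreal ?p * (ennreal C * (\<integral>\<^sup>+x\<in>?E. ennreal (cmod (f (siegel_map z x)) powr q) \<partial>lborel))"
      by (intro mult_left_mono) simp_all
    also have "\<dots> = ennreal C * (ennreal ?p * (\<integral>\<^sup>+x\<in>?E. ennreal (cmod (f (siegel_map z x)) powr q) \<partial>lborel))"
      by (simp only: mult_ac)
    also have "ennreal ?p * (\<integral>\<^sup>+x\<in>?E. ennreal (cmod (f (siegel_map z x)) powr q) \<partial>lborel)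
        = (\<integral>\<^sup>+w\<in>bergman_ball z r. ennreal (cmod (f w) powr q) \<partial>lborel)"
      using siegel_map_in_bergman_ball_iff[OF z r] by (intro set_nn_integral_siegel_map[OF z m])
    finally show "ennreal (cmod (f z) powr q * ?p)
        \<le> ennreal C * (\<integral>\<^sup>+w\<in>bergman_ball z r. ennreal (cmod (f w) powr q) \<partial>lborel)"
      using p by (simp add: ennreal_mult' mult.commute)
  qed
qed

section \<open>Forelli-Rudin estimates\<close>

lemma nn_integral_powr_at_top_finite:
  fixes a :: real
  assumes "a > 1"
  shows "(\<integral>\<^sup>+x. ennreal (x powr (- a)) * indicator {1..} x \<partial>lborel) < \<infinity>"
  using nn_integral_has_integral_lebesgue'[OF _ has_integral_powr_to_inf[of "- a" 1]] assms by simp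

lemma nn_integral_one_plus_abs_powr_finite:
  fixes a :: real
  assumes a: "a > 1"
  shows "(\<integral>\<^sup>+x. ennreal ((1 + \<bar>x\<bar>) powr (- a)) \<partial>lborel) < \<infinity>"
proof -
  define h where "h x = ennreal (x powr (- a)) * indicator {1..} x" for x :: real
  have [measurable]: "h \<in> borel_measurable borel" unfolding h_def by measurable
  have "(\<integral>\<^sup>+x. ennreal ((1 + \<bar>x\<bar>) powr (- a)) \<partial>lborel) \<le> (\<integral>\<^sup>+x. h (1 + x) + h (1 - x) \<partial>lborel)"
    by (intro nn_integral_mono) (auto simp: h_def indicator_def)
  also have "\<dots> = (\<integral>\<^sup>+x. h x \<partial>lborel) + (\<integral>\<^sup>+x. h x \<partial>lborel)"
    using nn_integral_real_affine[of h 1 1] nn_integral_real_affine[of h "-1" 1]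
    by (simp add: nn_integral_add)
  also have "\<dots> < \<infinity>"
    using nn_integral_powr_at_top_finite[OF a] by (simp add: h_def ennreal_add_less_top)
  finally show ?thesis .
qed

lemma nn_integral_powr_times_powr_finite:
  fixes t b :: real
  assumes t: "t > -1" and b: "b > t + 1"
  shows "(\<integral>\<^sup>+y. ennreal (y powr t * (1 + y) powr (- b)) * indicator {0<..} y \<partial>lborel) < \<infinity>"
proof -
  have "(\<integral>\<^sup>+y. ennreal (y powr t * (1 + y) powr (- b)) * indicator {0<..} y \<partial>lborel)
      \<le> (\<integral>\<^sup>+y. ennreal (y powr t) * indicator {0..1} y
          + ennreal (y powr (- (b - t))) * indicator {1..} y \<partial>lborel)"
  proof (intro nn_integral_mono)
    fix y :: real
    consider "y \<le> 0" | "0 < y" "y \<le> 1" | "1 < y" by linarith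
    then show "ennreal (y powr t * (1 + y) powr (- b)) * indicator {0<..} y
      \<le> ennreal (y powr t) * indicator {0..1} y + ennreal (y powr (- (b - t))) * indicator {1..} y"
    proof cases
      case 2
      have "(1 + y) powr (- b) \<le> 1 powr (- b)"
        using 2 b t by (intro powr_mono2') auto
      then have "y powr t * (1 + y) powr (- b) \<le> y powr t * 1"
        by (intro mult_left_mono) auto
      then have "ennreal (y powr t * (1 + y) powr (- b)) \<le> ennreal (y powr t)"
        by (intro ennreal_leI) simp
      then show ?thesis using 2 by (simp add: add_increasing2)
    next
      case 3
      have "y powr t * (1 + y) powr (- b) \<le> y powr t * y powr (- b)"
        using 3 b t by (intro mult_left_mono powr_mono2') auto
      also have "\<dots> = y powr (- (b - t))" by (simp flip: powr_add)
      finally show ?thesis using 3 by (simp add: ennreal_leI)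
    qed simp
  qed
  also have "\<dots> = (\<integral>\<^sup>+y. ennreal (y powr t) * indicator {0..1} y \<partial>lborel)
      + (\<integral>\<^sup>+y. ennreal (y powr (- (b - t))) * indicator {1..} y \<partial>lborel)"
    by (rule nn_integral_add) measurable
  also have "\<dots> < \<infinity>"
    using nn_integral_has_integral_lebesgue'[OF _ has_integral_powr_from_0[OF t, of 1]]
      nn_integral_powr_at_top_finite[of "b - t"] b by (simp add: ennreal_add_less_top)
  finally show ?thesis .
qed

text \<open>
  After the shear \<open>w\<^sub>n \<mapsto> w\<^sub>n + \<i>\<bar>w'\<bar>\<^sup>2\<close> the kernel is bounded by a negative power of
  \<open>S = 1 + \<bar>Re w\<^sub>n\<bar> + Im w\<^sub>n + \<bar>w'\<bar>\<^sup>2\<close>, and distributing the exponent over the coordinates leaves a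
  product of integrable functions of one variable.
\<close>

lemma Forelli_Rudin_base_point:
  fixes t s :: real
  assumes t: "t > -1" and s: "s > real CARD('n) + 1 + t"
  shows "(\<integral>\<^sup>+v\<in>siegel. ennreal (rho_diag v powr t * cmod (rho base_point v) powr (- s))
           \<partial>(lborel :: (complex ^ 'n::{finite,linorder}) measure)) < \<infinity>"
proof -
  let ?l = "last_ix :: 'n" and ?N = "real CARD('n) + 1"
  \<comment> \<open>The excess of \<open>s\<close> over the critical exponent, shared equally by n+1
    factors: real part and imaginary part of the last coordinate, and each of the other n-1 complex
    coordinates.\<close>
  define e where "e = (s - (?N + t)) / ?N"
  have N: "?N > 0" by simp
  have e: "e > 0" unfolding e_def using s N by (intro divide_pos_pos) auto
  have s_eq: "s = (1 + e) + (1 + t + e) + (1 + e) * real (CARD('n) - 1)"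
  proof -
    have c: "real (CARD('n) - 1) = real CARD('n) - 1"
      using zero_less_card_finite[where 'a='n] by simp
    have "?N * e = s - (?N + t)" using N by (simp add: e_def del: of_nat_add)
    then show ?thesis unfolding c by (simp add: algebra_simps)
  qed
  define F where "F v = ennreal (rho_diag v powr t * cmod (rho base_point v) powr (- s)) * indicator siegel v"
    for v :: "(complex, 'n) vec"
  have [measurable]: "F \<in> borel_measurable borel"
    unfolding F_def by measurable
  define f where "f b x = (if b = axis ?l \<i> then ennreal (x powr t * (1 + x) powr (- (1 + t + e))) * indicator {0<..} x
      else ennreal ((1 + \<bar>x\<bar>) powr (- (1 + e))))" for b :: "(complex, 'n) vec" and x :: real
  have [measurable]: "f b \<in> borel_measurable borel" for b
    unfolding f_def by (cases "b = axis ?l \<i>") simp_all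
  have fin: "(\<integral>\<^sup>+x. f b x \<partial>lborel) < \<infinity>" for b
    using nn_integral_one_plus_abs_powr_finite[of "1 + e"] nn_integral_powr_times_powr_finite[OF t, of "1 + t + e"] e
    by (cases "b = axis ?l \<i>") (simp_all add: f_def)
  define K where "K = 4 powr s * 2 powr ((1 + e) * real (CARD('n) - 1))"
  have K: "K > 0" by (simp add: K_def)
  have bound: "F (v + (hnorm v)\<^sup>2 *\<^sub>R axis ?l \<i>) \<le> ennreal K * (\<Prod>b\<in>Basis. f b (v \<bullet> b))" for v
  proof -
    define x y where "x = Re (v $ ?l)" and "y = Im (v $ ?l)"
    have hn: "hnorm (v + (hnorm v)\<^sup>2 *\<^sub>R axis ?l \<i>) = hnorm v"
      by (simp add: hnorm_def axis_def)
    have rd: "rho_diag (v + (hnorm v)\<^sup>2 *\<^sub>R axis ?l \<i>) = y"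
      unfolding rho_diag_def hn by (simp add: y_def)
    show ?thesis
    proof (cases "y > 0")
      case y: True
      define S where "S = 1 + \<bar>x\<bar> + y + (hnorm v)\<^sup>2"
      have S: "S \<ge> 1 + \<bar>x\<bar>" "S \<ge> 1 + y" "S > 0" "S \<ge> 1 + (hnorm v)\<^sup>2"
        using y by (auto simp: S_def add_pos_nonneg)
      define q where "q = v $ ?l + \<i> * complex_of_real ((hnorm v)\<^sup>2) + \<i>"
      have "cmod (rho base_point (v + (hnorm v)\<^sup>2 *\<^sub>R axis ?l \<i>)) = cmod q / 2"
        unfolding cmod_rho_commute[of base_point] rho_base_point
        by (simp add: norm_mult q_def scaleR_conv_of_real[where 'a=complex] mult.commute)
      moreover have "S \<le> 2 * cmod q"
        using abs_Re_le_cmod[of q] abs_Im_le_cmod[of q] y zero_le_power2[of "hnorm v"]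
        unfolding q_def S_def x_def y_def by simp
      ultimately have R: "cmod (rho base_point (v + (hnorm v)\<^sup>2 *\<^sub>R axis ?l \<i>)) \<ge> S / 4" by simp
      have e1: "(1 + e) > 0" using e by simp
      \<comment> \<open>One factor serves two real variables, because \<open>S\<close> dominates the
        square of the modulus of \<open>v $ i\<close> and therefore half the product
        \<open>(1 + a) * (1 + b)\<close>.\<close>
      have pi: "S powr (- (1 + e)) \<le> 2 powr (1 + e) * ((1 + \<bar>Re (v $ i)\<bar>) powr (- (1 + e)) * (1 + \<bar>Im (v $ i)\<bar>) powr (- (1 + e)))"
        if i: "i \<noteq> ?l" for i
      proof -
        define a b where "a = \<bar>Re (v $ i)\<bar>" and "b = \<bar>Im (v $ i)\<bar>"
        have ab: "a \<ge> 0" "b \<ge> 0" by (auto simp: a_def b_def)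
        have "a\<^sup>2 + b\<^sup>2 = (cmod (v $ i))\<^sup>2" by (simp add: a_def b_def cmod_power2)
        also have "\<dots> \<le> (hnorm v)\<^sup>2"
          unfolding hnorm_L2_set using i by (intro power_mono member_le_L2_set) auto
        finally have "a\<^sup>2 + b\<^sup>2 \<le> S - 1" using S by linarith
        moreover have "(1 + a) * (1 + b) \<le> 2 + a\<^sup>2 + b\<^sup>2"
          using zero_le_power2[of "1 - a"] zero_le_power2[of "1 - b"] zero_le_power2[of "a - b"]
          by (simp add: power2_eq_square algebra_simps)
        ultimately have "(1 + a) * (1 + b) / 2 \<le> S" using S(1) abs_ge_zero[of x] by linarith
        then have "S powr (- (1 + e)) \<le> ((1 + a) * (1 + b) / 2) powr (- (1 + e))"
          using ab e by (intro powr_mono2') auto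
        also have "\<dots> = 2 powr (1 + e) * ((1 + a) powr (- (1 + e)) * (1 + b) powr (- (1 + e)))"
        proof -
          have "(x * y / 2) powr (- d) = 2 powr d * (x powr (- d) * y powr (- d))" if "x \<ge> 0" "y \<ge> 0" for x y d :: real
            using that by (simp add: powr_divide powr_mult powr_minus field_simps)
          from this[of "1 + a" "1 + b" "1 + e"] show ?thesis using ab by simp
        qed
        finally show ?thesis by (simp add: a_def b_def)
      qed
      define P where "P i = (1 + \<bar>Re (v $ i)\<bar>) powr (- (1 + e)) * (1 + \<bar>Im (v $ i)\<bar>) powr (- (1 + e))" for i
      have Pn: "P i \<ge> 0" for i by (simp add: P_def)
      have "cmod (rho base_point (v + (hnorm v)\<^sup>2 *\<^sub>R axis ?l \<i>)) powr (- s) \<le> (S / 4) powr (- s)"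
        using R S s t by (intro powr_mono2') auto
      also have "\<dots> = 4 powr s * S powr (- s)"
        using S by (simp add: powr_divide powr_minus_divide)
      also have "S powr (- s) = S powr (- (1 + e)) * S powr (- (1 + t + e)) * (\<Prod>i\<in>UNIV - {?l}. S powr (- (1 + e)))"
      proof -
        have "(\<Prod>i\<in>UNIV - {?l}. S powr (- (1 + e))) = S powr (- (1 + e) * real (CARD('n) - 1))"
          using S by (simp add: card_Diff_singleton powr_powr flip: powr_realpow)
        then have "S powr (- (1 + e)) * S powr (- (1 + t + e)) * (\<Prod>i\<in>UNIV - {?l}. S powr (- (1 + e)))
            = S powr (- (1 + e) + - (1 + t + e) + - (1 + e) * real (CARD('n) - 1))"
          by (simp only: powr_add)
        also have "- (1 + e) + - (1 + t + e) + - (1 + e) * real (CARD('n) - 1) = - s"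
          unfolding s_eq mult_minus_left by linarith
        finally show ?thesis ..
      qed
      also have "\<dots> \<le> (1 + \<bar>x\<bar>) powr (- (1 + e)) * (1 + y) powr (- (1 + t + e)) * (\<Prod>i\<in>UNIV - {?l}. 2 powr (1 + e) * P i)"
        using S y t e pi by (intro mult_mono prod_mono powr_mono2' prod_nonneg) (auto simp: P_def)
      finally have 1: "cmod (rho base_point (v + (hnorm v)\<^sup>2 *\<^sub>R axis ?l \<i>)) powr (- s)
         \<le> 4 powr s * ((1 + \<bar>x\<bar>) powr (- (1 + e)) * (1 + y) powr (- (1 + t + e)) * (\<Prod>i\<in>UNIV - {?l}. 2 powr (1 + e) * P i))"
        by simp
      have 2: "4 powr s * (\<Prod>i\<in>UNIV - {?l}. 2 powr (1 + e) * P i) = K * (\<Prod>i\<in>UNIV - {?l}. P i)"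
        by (simp add: prod.distrib K_def card_Diff_singleton powr_powr flip: powr_realpow)
      have "F (v + (hnorm v)\<^sup>2 *\<^sub>R axis ?l \<i>)
          \<le> ennreal (y powr t * (4 powr s * ((1 + \<bar>x\<bar>) powr (- (1 + e)) * (1 + y) powr (- (1 + t + e)) * (\<Prod>i\<in>UNIV - {?l}. 2 powr (1 + e) * P i))))"
        unfolding F_def rd using y 1 by (simp add: siegel_iff rd ennreal_leI mult_left_mono)
      also have "\<dots> = ennreal (K * ((1 + \<bar>x\<bar>) powr (- (1 + e)) * (y powr t * (1 + y) powr (- (1 + t + e))) * (\<Prod>i\<in>UNIV - {?l}. P i)))"
      proof -
        have "u * (c * (A * B * Q)) = K * (A * (u * B) * Q')" if "c * Q = K * Q'" for u c A B Q Q' :: real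
        proof -
          have "u * (c * (A * B * Q)) = (c * Q) * (u * A * B)" by (simp only: mult_ac)
          then show ?thesis unfolding that by (simp only: mult_ac)
        qed
        from this[OF 2] show ?thesis by (rule arg_cong)
      qed
      also have "\<dots> = ennreal K * (f (axis ?l 1) x * f (axis ?l \<i>) y * (\<Prod>i\<in>UNIV - {?l}. ennreal (P i)))"
        using K y by (simp add: f_def axis_eq_axis complex_eq_iff ennreal_mult prod_ennreal Pn prod_nonneg)
      also have "(\<Prod>i\<in>UNIV - {?l}. ennreal (P i)) = (\<Prod>i\<in>UNIV - {?l}. f (axis i 1) (v \<bullet> axis i 1) * f (axis i \<i>) (v \<bullet> axis i \<i>))"
        by (intro prod.cong) (auto simp: f_def axis_eq_axis P_def inner_axis inner_complex_def ennreal_mult)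
      also have "f (axis ?l 1) x * f (axis ?l \<i>) y * (\<Prod>i\<in>UNIV - {?l}. f (axis i 1) (v \<bullet> axis i 1) * f (axis i \<i>) (v \<bullet> axis i \<i>))
          = (\<Prod>b\<in>Basis. f b (v \<bullet> b))"
        unfolding prod_Basis_complex_vec
        by (subst prod.remove[of UNIV ?l]) (auto simp: inner_axis inner_complex_def x_def y_def)
      finally show ?thesis .
    next
      case False
      then show ?thesis by (simp add: F_def siegel_iff rd)
    qed
  qed
  have "(\<integral>\<^sup>+v. F v \<partial>lborel) = (\<integral>\<^sup>+v. F (v + (hnorm v)\<^sup>2 *\<^sub>R axis ?l \<i>) \<partial>lborel)"
  proof (rule nn_integral_lborel_shear[symmetric])
    show "(\<lambda>v. (hnorm v)\<^sup>2) \<in> borel_measurable (borel :: (complex, 'n) vec measure)"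
      by (intro borel_measurable_continuous_onI continuous_intros)
  qed (simp_all add: hnorm_def axis_def vec_eq_iff)
  also have "\<dots> \<le> (\<integral>\<^sup>+v. ennreal K * (\<Prod>b\<in>Basis. f b (v \<bullet> b)) \<partial>lborel)"
    by (intro nn_integral_mono bound)
  also have "\<dots> = ennreal K * (\<integral>\<^sup>+v. (\<Prod>b\<in>Basis. f b (v \<bullet> b)) \<partial>lborel)"
    by (rule nn_integral_cmult) measurable
  also have "\<dots> = ennreal K * (\<Prod>b\<in>Basis. \<integral>\<^sup>+x. f b x \<partial>lborel)"
    by (subst nn_integral_lborel_prod) simp_all
  also have "\<dots> < \<infinity>"
  proof -
    have "(\<Prod>b\<in>Basis. \<integral>\<^sup>+x. f b x \<partial>lborel) \<noteq> top"
      using fin by (auto simp: ennreal_prod_eq_top dest: less_imp_neq)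
    then show ?thesis by (simp add: ennreal_mult_less_top less_top)
  qed
  finally show ?thesis by (simp add: F_def)
qed

text \<open>Under the pull-back by \<open>siegel_map z\<close> the Jacobian, the weight and the
  kernel contribute the powers n+1, \<open>t\<close> and \<open>- s\<close> of
  \<open>rho_diag z\<close>; what remains is the integral at the base point.\<close>

lemma Forelli_Rudin:
  fixes t s :: real
  assumes t: "t > -1" and s: "s > real CARD('n) + 1 + t"
  obtains C where "C > 0"
    "\<And>z :: complex ^ 'n::{finite,linorder}. z \<in> siegel \<Longrightarrow>
      (\<integral>\<^sup>+w\<in>siegel. ennreal (rho_diag w powr t * cmod (rho z w) powr (- s)) \<partial>lborel)
      \<le> ennreal (C * rho_diag z powr (real CARD('n) + 1 + t - s))"
proof -
  define F where "F z w = ennreal (rho_diag w powr t * cmod (rho z w) powr (- s))" for z w :: "(complex, 'n) vec"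
  obtain J where J: "J \<ge> 0" "(\<integral>\<^sup>+v\<in>siegel. F base_point v \<partial>lborel) = ennreal J"
    using Forelli_Rudin_base_point[OF t s] unfolding F_def by (cases rule: ennreal_cases) auto
  show ?thesis
  proof (rule that[of "J + 1"])
    fix z :: "(complex, 'n) vec" assume z: "z \<in> siegel"
    define p where "p = rho_diag z"
    have p: "p > 0" using z by (simp add: siegel_iff p_def)
    have m: "(\<lambda>w. F z w * indicator siegel w) \<in> borel_measurable borel"
      unfolding F_def by measurable
    have eq: "F z (siegel_map z v) = ennreal (p powr (t - s)) * F base_point v" if v: "v \<in> siegel" for v
    proof -
      have "cmod (rho z (siegel_map z v)) = p * cmod (rho base_point v)"
        using rho_siegel_map[OF z, of base_point v] p by (simp add: norm_mult p_def)
      moreover have "p powr (t - s) = p powr t * p powr (- s)" by (simp flip: powr_add)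
      ultimately show ?thesis using p v
        by (simp add: F_def rho_diag_siegel_map[OF z] p_def[symmetric] powr_mult siegel_iff mult_ac flip: ennreal_mult)
    qed
    have "(\<integral>\<^sup>+w\<in>siegel. F z w \<partial>lborel)
        = ennreal (p ^ (CARD('n) + 1)) * (\<integral>\<^sup>+v\<in>siegel. F z (siegel_map z v) \<partial>lborel)"
      unfolding p_def by (rule set_nn_integral_siegel_map[OF z m, symmetric]) (rule siegel_map_in_siegel_iff[OF z])
    also have "(\<integral>\<^sup>+v\<in>siegel. F z (siegel_map z v) \<partial>lborel)
        = (\<integral>\<^sup>+v. ennreal (p powr (t - s)) * (F base_point v * indicator siegel v) \<partial>lborel)"
      by (intro nn_integral_cong) (simp add: eq indicator_def)
    also have "\<dots> = ennreal (p powr (t - s)) * ennreal J"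
      by (subst nn_integral_cmult) (simp_all add: J, simp add: F_def)
    also have "ennreal (p ^ (CARD('n) + 1)) * (ennreal (p powr (t - s)) * ennreal J)
        = ennreal (J * (p powr real (CARD('n) + 1) * p powr (t - s)))"
      using p J by (simp only: powr_realpow) (simp add: mult_ac flip: ennreal_mult)
    also have "p powr real (CARD('n) + 1) * p powr (t - s) = p powr (real CARD('n) + 1 + t - s)"
      by (simp add: algebra_simps flip: powr_add)
    also have "ennreal (J * p powr (real CARD('n) + 1 + t - s)) \<le> ennreal ((J + 1) * p powr (real CARD('n) + 1 + t - s))"
      by (intro ennreal_leI mult_right_mono) auto
    finally show "(\<integral>\<^sup>+w\<in>siegel. ennreal (rho_diag w powr t * cmod (rho z w) powr (- s)) \<partial>lborel)
      \<le> ennreal ((J + 1) * rho_diag z powr (real CARD('n) + 1 + t - s))"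
      by (simp add: F_def p_def)
  qed (use J in simp)
qed

section \<open>Averaging functions, Carleson measures and the Berezin transform\<close>

lemma M_plus_space: "\<mu> \<in> M_plus \<Longrightarrow> space \<mu> = siegel"
  unfolding M_plus_def using sets_eq_imp_space_eq[of \<mu> "restrict_space borel siegel"]
  by (auto simp: space_restrict_space)

lemma M_plus_sets: "\<mu> \<in> M_plus \<Longrightarrow> sets \<mu> = sets (restrict_space borel siegel)"
  unfolding M_plus_def by simp

lemma M_plus_open_sets: "\<mu> \<in> M_plus \<Longrightarrow> open A \<Longrightarrow> A \<subseteq> siegel \<Longrightarrow> A \<in> sets \<mu>"
  by (simp add: M_plus_sets sets_restrict_space_iff)

lemma M_plus_measurable:
  assumes "\<mu> \<in> M_plus" "g \<in> borel_measurable borel"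
  shows "g \<in> borel_measurable \<mu>"
  using measurable_restrict_space1[OF assms(2)] measurable_cong_sets[OF M_plus_sets[OF assms(1)] refl] by blast

lemma cmod_last_plus_i_ge_1: "z \<in> siegel \<Longrightarrow> 1 \<le> cmod (z $ last_ix + \<i>)"
proof -
  assume "z \<in> siegel"
  moreover have "0 \<le> (hnorm z)\<^sup>2" by simp
  ultimately have "0 < Im (z $ last_ix)" unfolding siegel_def mem_Collect_eq by linarith
  then show ?thesis using abs_Im_le_cmod[of "z $ last_ix + \<i>"] by simp
qed

text \<open>The sets where \<open>u\<close> is at least \<open>1 / k\<close> exhaust the space, and
  Markov's inequality bounds their measures.\<close>

lemma sigma_finite_measure_pos_integrable:
  assumes u [measurable]: "u \<in> borel_measurable M" and fin: "(\<integral>\<^sup>+x. u x \<partial>M) \<noteq> \<infinity>"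
    and pos: "\<And>x. x \<in> space M \<Longrightarrow> u x > 0"
  shows "sigma_finite_measure M"
proof
  define A where "A k = {x \<in> space M. 1 \<le> of_nat k * u x}" for k :: nat
  have "A k \<in> sets M" for k unfolding A_def by measurable
  moreover have "(\<Union>k. A k) = space M"
  proof (intro equalityI subsetI)
    fix x assume x: "x \<in> space M"
    show "x \<in> (\<Union>k. A k)"
    proof (cases "u x = \<infinity>")
      case True
      then have "x \<in> A 1" using x by (simp add: A_def)
      then show ?thesis by blast
    next
      case False
      then obtain c where c: "u x = ennreal c" "c > 0"
        using pos[OF x] by (cases "u x") auto
      obtain k :: nat where "1 / c < real k" using reals_Archimedean2 by blast
      then have "1 \<le> real k * c" using c by (simp add: field_simps)
      then have "x \<in> A k"
        using x c by (simp add: A_def ennreal_of_nat_eq_real_of_nat flip: ennreal_mult ennreal_1)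
      then show ?thesis by blast
    qed
  qed (auto simp: A_def)
  moreover have "emeasure M (A k) \<noteq> \<infinity>" for k
  proof -
    have "emeasure M (A k) \<le> of_nat k * (\<integral>\<^sup>+x. u x * indicator (space M) x \<partial>M)"
      unfolding A_def by (rule nn_integral_Markov_inequality) auto
    also have "(\<integral>\<^sup>+x. u x * indicator (space M) x \<partial>M) = (\<integral>\<^sup>+x. u x \<partial>M)"
      by (intro nn_integral_cong) simp
    also have "of_nat k * \<dots> < \<infinity>"
      using fin by (simp add: ennreal_mult_less_top ennreal_of_nat_eq_real_of_nat less_top)
    finally show ?thesis by simp
  qed
  ultimately show "\<exists>B. countable B \<and> B \<subseteq> sets M \<and> \<Union> B = space M \<and> (\<forall>a\<in>B. emeasure M a \<noteq> \<infinity>)"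
    by (intro exI[of _ "range A"]) auto
qed

lemma M_plus_sigma_finite:
  fixes \<mu> :: "(complex ^ 'n::{finite,linorder}) measure"
  assumes "\<mu> \<in> M_plus"
  shows "sigma_finite_measure \<mu>"
proof -
  obtain \<alpha> where a: "(\<integral>\<^sup>+ z. ennreal (cmod (z $ last_ix + \<i>) powr (- \<alpha>)) \<partial>\<mu>) < \<infinity>"
    using assms unfolding M_plus_def by auto
  have [measurable]: "(\<lambda>z. z $ last_ix + \<i>) \<in> borel_measurable (borel :: (complex, 'n) vec measure)"
    by (intro borel_measurable_continuous_onI continuous_intros)
  show ?thesis
  proof (rule sigma_finite_measure_pos_integrable)
    show "(\<lambda>z. ennreal (cmod (z $ last_ix + \<i>) powr (- \<alpha>))) \<in> borel_measurable \<mu>"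
      by (rule M_plus_measurable[OF assms]) measurable
    show "(\<integral>\<^sup>+ z. ennreal (cmod (z $ last_ix + \<i>) powr (- \<alpha>)) \<partial>\<mu>) \<noteq> \<infinity>" using a by simp
    fix z assume "z \<in> space \<mu>"
    then show "0 < ennreal (cmod (z $ last_ix + \<i>) powr (- \<alpha>))"
      using cmod_last_plus_i_ge_1[of z] M_plus_space[OF assms] by auto
  qed
qed

lemma bounded_averaging_iff:
  fixes \<mu> :: "(complex ^ 'n::{finite,linorder}) measure"
  assumes r: "r > 0"
  shows "bounded_on_siegel (averaging \<mu> r) \<longleftrightarrow>
    (\<exists>C>0. \<forall>z\<in>siegel. emeasure \<mu> (bergman_ball z r) \<le> ennreal (C * rho_diag z ^ (CARD('n) + 1)))"
proof -
  obtain V where V: "V > 0" "emeasure lborel (bergman_ball (base_point :: (complex, 'n) vec) r) = ennreal V"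
    by (rule emeasure_bergman_ball_base_point[OF r, where 'n = 'n]) (rule that)
  have vol: "emeasure lborel (bergman_ball z r) = ennreal (rho_diag z ^ (CARD('n) + 1) * V)"
    and pos: "rho_diag z ^ (CARD('n) + 1) * V > 0" if z: "z \<in> siegel" for z :: "(complex, 'n) vec"
  proof -
    have p: "rho_diag z > 0" using z by (simp add: siegel_iff)
    then show "rho_diag z ^ (CARD('n) + 1) * V > 0" using V by simp
    show "emeasure lborel (bergman_ball z r) = ennreal (rho_diag z ^ (CARD('n) + 1) * V)"
      using p V unfolding emeasure_bergman_ball[OF z r] V(2) by (subst ennreal_mult) auto
  qed
  show ?thesis
  proof
    assume "bounded_on_siegel (averaging \<mu> r)"
    then obtain C where C: "\<And>z. z \<in> siegel \<Longrightarrow> averaging \<mu> r z \<le> ennreal C"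
      unfolding bounded_on_siegel_def by blast
    \<comment> \<open>\<open>C\<close> may be zero or negative, in which case
      \<open>ennreal C\<close> is 0; \<open>\<bar>C\<bar> + 1\<close> is a positive constant at
      least as large.\<close>
    have "emeasure \<mu> (bergman_ball z r) \<le> ennreal ((\<bar>C\<bar> + 1) * V * rho_diag z ^ (CARD('n) + 1))" if z: "z \<in> siegel" for z
    proof -
      let ?v = "rho_diag z ^ (CARD('n) + 1) * V"
      have "emeasure \<mu> (bergman_ball z r) = emeasure \<mu> (bergman_ball z r) * ennreal ?v / ennreal ?v"
        by (rule mult_divide_eq_ennreal[symmetric]) (use pos[OF z] in auto)
      also have "\<dots> = averaging \<mu> r z * ennreal ?v"
        by (simp add: averaging_def vol[OF z] ennreal_divide_times ennreal_times_divide mult.commute)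
      also have "\<dots> \<le> ennreal (\<bar>C\<bar> + 1) * ennreal ?v"
        by (intro mult_right_mono order_trans[OF C[OF z]] ennreal_leI) auto
      also have "\<dots> = ennreal ((\<bar>C\<bar> + 1) * ?v)"
        using pos[OF z] by (intro ennreal_mult[symmetric]) auto
      finally show ?thesis by (simp only: mult_ac)
    qed
    then show "\<exists>C>0. \<forall>z\<in>siegel. emeasure \<mu> (bergman_ball z r) \<le> ennreal (C * rho_diag z ^ (CARD('n) + 1))"
      using V by (intro exI[of _ "(\<bar>C\<bar> + 1) * V"]) auto
  next
    assume "\<exists>C>0. \<forall>z\<in>siegel. emeasure \<mu> (bergman_ball z r) \<le> ennreal (C * rho_diag z ^ (CARD('n) + 1))"
    then obtain C where C: "C > 0"
      "\<And>z. z \<in> siegel \<Longrightarrow> emeasure \<mu> (bergman_ball z r) \<le> ennreal (C * rho_diag z ^ (CARD('n) + 1))"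
      by blast
    have "averaging \<mu> r z \<le> ennreal (C / V)" if z: "z \<in> siegel" for z
      unfolding averaging_def
    proof (rule divide_le_posI_ennreal)
      show "0 < emeasure lborel (bergman_ball z r)" using pos[OF z] vol[OF z] by simp
      have "emeasure lborel (bergman_ball z r) * ennreal (C / V)
          = ennreal (rho_diag z ^ (CARD('n) + 1) * V * (C / V))"
        unfolding vol[OF z] using pos[OF z] V C by (intro ennreal_mult[symmetric]) auto
      also have "rho_diag z ^ (CARD('n) + 1) * V * (C / V) = C * rho_diag z ^ (CARD('n) + 1)"
        using V by simp
      finally show "emeasure \<mu> (bergman_ball z r) \<le> emeasure lborel (bergman_ball z r) * ennreal (C / V)"
        using C(2)[OF z] by simp
    qed
    then show "bounded_on_siegel (averaging \<mu> r)" unfolding bounded_on_siegel_def by blast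
  qed
qed

text \<open>The common end of the three implications into (iii). The exponent \<open>s\<close> stays
  free because they supply different ones: \<open>real m * q\<close> from a Carleson inequality,
  \<open>2 * (n + 1)\<close> from the Berezin transform, \<open>real (2 * m)\<close> from the
  Toeplitz operator.\<close>

lemma bounded_averaging_of_kernel_bound:
  fixes \<mu> :: "(complex ^ 'n::{finite,linorder}) measure"
  assumes \<mu>: "\<mu> \<in> M_plus" and r: "r > 0" and s: "s \<ge> 0" and C: "C > 0"
    and bound: "\<And>u. u \<in> siegel \<Longrightarrow> (\<integral>\<^sup>+w. ennreal (cmod (rho u w) powr (- s)) \<partial>\<mu>)
      \<le> ennreal (C * rho_diag u powr (real CARD('n) + 1 - s))"
  shows "bounded_on_siegel (averaging \<mu> r)"
proof -
  obtain B where B: "B > 0"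
    "\<And>z w :: (complex, 'n) vec. z \<in> siegel \<Longrightarrow> w \<in> bergman_ball z r \<Longrightarrow>
      rho_diag w \<le> B * rho_diag z \<and> rho_diag z \<le> B * rho_diag w \<and> cmod (rho z w) \<le> B * rho_diag z"
    by (rule bergman_ball_bounds[OF r, where 'n = 'n]) (rule that)
  have "emeasure \<mu> (bergman_ball u r) \<le> ennreal (C * B powr s * rho_diag u ^ (CARD('n) + 1))"
    if u: "u \<in> siegel" for u
  proof -
    define p where "p = rho_diag u"
    have p: "p > 0" using u by (simp add: p_def siegel_iff)
    have D [measurable]: "bergman_ball u r \<in> sets \<mu>"
      by (rule M_plus_open_sets[OF \<mu> open_bergman_ball[OF u r]]) (auto simp: bergman_ball_def)
    have "emeasure \<mu> (bergman_ball u r) = (\<integral>\<^sup>+w. indicator (bergman_ball u r) w \<partial>\<mu>)"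
      by simp
    also have "\<dots> \<le> (\<integral>\<^sup>+w. ennreal ((B * p) powr s) * ennreal (cmod (rho u w) powr (- s)) \<partial>\<mu>)"
    proof (intro nn_integral_mono)
      fix w
      show "indicator (bergman_ball u r) w \<le> ennreal ((B * p) powr s) * ennreal (cmod (rho u w) powr (- s))"
      proof (cases "w \<in> bergman_ball u r")
        case True
        then have w: "w \<in> siegel" by (simp add: bergman_ball_def)
        have R: "cmod (rho u w) > 0" by (rule cmod_rho_pos[OF u w])
        have "cmod (rho u w) powr s \<le> (B * p) powr s"
          using B(2)[OF u True] s R by (intro powr_mono2) (auto simp: p_def)
        then have "cmod (rho u w) powr s * cmod (rho u w) powr (- s) \<le> (B * p) powr s * cmod (rho u w) powr (- s)"
          by (intro mult_right_mono) auto
        then have "1 \<le> (B * p) powr s * cmod (rho u w) powr (- s)"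
          using R by (simp flip: powr_add)
        then have "ennreal 1 \<le> ennreal ((B * p) powr s * cmod (rho u w) powr (- s))" by (rule ennreal_leI)
        then show ?thesis using True by (simp add: ennreal_mult)
      qed simp
    qed
    also have "\<dots> = ennreal ((B * p) powr s) * (\<integral>\<^sup>+w. ennreal (cmod (rho u w) powr (- s)) \<partial>\<mu>)"
      by (intro nn_integral_cmult M_plus_measurable[OF \<mu>]) measurable
    also have "\<dots> \<le> ennreal ((B * p) powr s) * ennreal (C * p powr (real CARD('n) + 1 - s))"
      unfolding p_def by (intro mult_left_mono bound[OF u]) simp
    also have "\<dots> = ennreal ((B * p) powr s * (C * p powr (real CARD('n) + 1 - s)))"
      using C by (intro ennreal_mult[symmetric]) auto
    also have "(B * p) powr s * (C * p powr (real CARD('n) + 1 - s))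
        = C * B powr s * (p powr s * p powr (real CARD('n) + 1 - s))"
      using B p by (simp add: powr_mult mult_ac)
    also have "p powr s * p powr (real CARD('n) + 1 - s) = p powr (real (CARD('n) + 1))"
      by (simp add: add.commute flip: powr_add)
    also have "\<dots> = p ^ (CARD('n) + 1)" by (rule powr_realpow[OF p])
    finally show ?thesis by (simp add: p_def)
  qed
  then show ?thesis unfolding bounded_averaging_iff[OF r]
    using B(1) C by (intro exI[of _ "C * B powr s"]) auto
qed

lemma carleson_of_bounded_averaging:
  fixes \<mu> :: "(complex ^ 'n::{finite,linorder}) measure"
  assumes \<mu>: "\<mu> \<in> M_plus" and r: "r > 0" and q: "q > 0"
    and bdd: "bounded_on_siegel (averaging \<mu> r)"
  obtains C where "C > 0" "\<And>f. holomorphic_vec f siegel \<Longrightarrow>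
    (\<integral>\<^sup>+z. ennreal (cmod (f z) powr q) \<partial>\<mu>) \<le> ennreal C * pintegral q f"
proof -
  let ?N = "CARD('n) + 1"
  obtain A where A: "A > 0" "\<And>z. z \<in> siegel \<Longrightarrow> emeasure \<mu> (bergman_ball z r) \<le> ennreal (A * rho_diag z ^ ?N)"
    using bdd unfolding bounded_averaging_iff[OF r] by blast
  obtain B where B: "B > 0"
    "\<And>z w :: (complex, 'n) vec. z \<in> siegel \<Longrightarrow> w \<in> bergman_ball z r \<Longrightarrow>
      rho_diag w \<le> B * rho_diag z \<and> rho_diag z \<le> B * rho_diag w \<and> cmod (rho z w) \<le> B * rho_diag z"
    by (rule bergman_ball_bounds[OF r, where 'n = 'n]) (rule that)
  obtain M where M: "M > 0"
    "\<And>(f :: (complex, 'n) vec \<Rightarrow> complex) z. holomorphic_vec f siegel \<Longrightarrow> z \<in> siegel \<Longrightarrow>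
       ennreal (cmod (f z) powr q * rho_diag z ^ ?N)
       \<le> ennreal M * (\<integral>\<^sup>+w\<in>bergman_ball z r. ennreal (cmod (f w) powr q) \<partial>lborel)"
    by (rule powr_mean_value_bergman_ball[OF r q, where 'n = 'n]) (rule that)
  interpret \<mu>: sigma_finite_measure \<mu> by (rule M_plus_sigma_finite[OF \<mu>])
  interpret pair_sigma_finite \<mu> "lborel :: (complex, 'n) vec measure" ..
  \<comment> \<open>The pairs at distance less than \<open>r\<close>, written through the polynomial
    inequality so that joint measurability is visible.\<close>
  define E where "E = {(w, u). w \<in> siegel \<and> u \<in> (siegel :: (complex, 'n) vec set) \<and>
     (1 - (tanh r)\<^sup>2) * (cmod (rho w u))\<^sup>2 < rho_diag w * rho_diag u}"
  have E_iff: "(w, u) \<in> E \<longleftrightarrow> w \<in> siegel \<and> u \<in> bergman_ball w r" for w u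
    using bergman_ball_iff[OF _ r, of w u] by (auto simp: E_def)
  have "{x \<in> space (borel \<Otimes>\<^sub>M borel). fst x \<in> siegel \<and> snd x \<in> (siegel :: (complex, 'n) vec set) \<and>
     (1 - (tanh r)\<^sup>2) * (cmod (rho (fst x) (snd x)))\<^sup>2 < rho_diag (fst x) * rho_diag (snd x)}
     \<in> sets (borel \<Otimes>\<^sub>M borel)"
    by measurable
  then have E_sets: "E \<in> sets (borel \<Otimes>\<^sub>M borel)"
    by (simp add: E_def case_prod_unfold space_pair_measure)
  show ?thesis
  proof (rule that[of "M * (B ^ ?N * A)"])
    fix f :: "(complex, 'n) vec \<Rightarrow> complex" assume f: "holomorphic_vec f siegel"
    define G where "G u = ennreal (cmod (f u) powr q) * indicator siegel u" for u
    have G [measurable]: "G \<in> borel_measurable borel"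
      unfolding G_def by (rule measurable_norm_powr_on_open[OF holomorphic_vec_imp_continuous_on[OF f] open_siegel])
    define H where "H w u = ennreal (inverse (rho_diag w ^ ?N)) * (G u * indicator E (w, u))" for w u
    have H0: "case_prod H \<in> borel_measurable (borel \<Otimes>\<^sub>M borel)"
      unfolding H_def case_prod_unfold using E_sets by measurable
    have f1: "fst \<in> measurable (\<mu> \<Otimes>\<^sub>M lborel) (borel :: (complex, 'n) vec measure)"
      by (rule measurable_compose[OF measurable_fst M_plus_measurable[OF \<mu>]]) simp
    have f2: "snd \<in> measurable (\<mu> \<Otimes>\<^sub>M lborel) (borel :: (complex, 'n) vec measure)"
      using measurable_snd[of \<mu> "lborel :: (complex, 'n) vec measure"] by simp
    have H: "case_prod H \<in> borel_measurable (\<mu> \<Otimes>\<^sub>M lborel)"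
      using measurable_compose[OF measurable_Pair[OF f1 f2] H0] by simp
    have pt: "ennreal (cmod (f w) powr q) \<le> ennreal M * (\<integral>\<^sup>+u. H w u \<partial>lborel)" if w: "w \<in> siegel" for w
    proof -
      have p: "rho_diag w > 0" using w by (simp add: siegel_iff)
      have [measurable]: "bergman_ball w r \<in> sets borel" by (rule borel_open[OF open_bergman_ball[OF w r]])
      have "ennreal (cmod (f w) powr q) = ennreal (inverse (rho_diag w ^ ?N)) * ennreal (cmod (f w) powr q * rho_diag w ^ ?N)"
      proof -
        have "rho_diag w ^ ?N > 0" using p by simp
        then show ?thesis using p by (simp flip: ennreal_mult del: power_Suc add: field_simps)
      qed
      also have "\<dots> \<le> ennreal (inverse (rho_diag w ^ ?N)) *
          (ennreal M * (\<integral>\<^sup>+u\<in>bergman_ball w r. ennreal (cmod (f u) powr q) \<partial>lborel))"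
        by (intro mult_left_mono M(2)[OF f w]) simp
      also have "(\<integral>\<^sup>+u\<in>bergman_ball w r. ennreal (cmod (f u) powr q) \<partial>lborel)
          = (\<integral>\<^sup>+u. G u * indicator E (w, u) \<partial>lborel)"
        using w by (intro nn_integral_cong) (auto simp: G_def indicator_def E_iff bergman_ball_def)
      also have "ennreal (inverse (rho_diag w ^ ?N)) * (ennreal M * (\<integral>\<^sup>+u. G u * indicator E (w, u) \<partial>lborel))
          = ennreal M * (ennreal (inverse (rho_diag w ^ ?N)) * (\<integral>\<^sup>+u. G u * indicator E (w, u) \<partial>lborel))"
        by (simp only: mult_ac)
      also have "ennreal (inverse (rho_diag w ^ ?N)) * (\<integral>\<^sup>+u. G u * indicator E (w, u) \<partial>lborel) = (\<integral>\<^sup>+u. H w u \<partial>lborel)"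
        unfolding H_def
      proof (rule nn_integral_cmult[symmetric])
        have "indicator E (w, u) = (indicator (bergman_ball w r) u :: ennreal)" for u
          using w by (simp add: indicator_def E_iff)
        then show "(\<lambda>u. G u * indicator E (w, u)) \<in> borel_measurable lborel" by simp
      qed
      finally show ?thesis .
    qed
    \<comment> \<open>For fixed \<open>u\<close>, symmetry confines \<open>w\<close> to the ball
      about \<open>u\<close>, where \<open>rho_diag w\<close> is comparable to
      \<open>rho_diag u\<close>. The measure bound at \<open>u\<close> then cancels the power n+1 of
      \<open>rho_diag u\<close>.\<close>
    have inner: "(\<integral>\<^sup>+w. H w u \<partial>\<mu>) \<le> ennreal (B ^ ?N * A) * G u" for u
    proof (cases "u \<in> siegel")
      case u: True
      have p: "rho_diag u > 0" using u by (simp add: siegel_iff)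
      have D [measurable]: "bergman_ball u r \<in> sets \<mu>"
        by (rule M_plus_open_sets[OF \<mu> open_bergman_ball[OF u r]]) (auto simp: bergman_ball_def)
      have "(\<integral>\<^sup>+w. H w u \<partial>\<mu>) \<le> (\<integral>\<^sup>+w. ennreal ((B / rho_diag u) ^ ?N) * G u * indicator (bergman_ball u r) w \<partial>\<mu>)"
      proof (intro nn_integral_mono)
        fix w
        show "H w u \<le> ennreal ((B / rho_diag u) ^ ?N) * G u * indicator (bergman_ball u r) w"
        proof (cases "(w, u) \<in> E")
          case True
          then have w: "w \<in> siegel" and uw: "u \<in> bergman_ball w r" by (auto simp: E_iff)
          have wu: "w \<in> bergman_ball u r" using bergman_ball_commute[OF u w r] uw by simp
          have w0: "rho_diag w > 0" using w by (simp add: siegel_iff)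
          moreover have "rho_diag u \<le> B * rho_diag w" using B(2)[OF u wu] by simp
          ultimately have "inverse (rho_diag w) \<le> B / rho_diag u" using p B(1) by (simp add: field_simps)
          then have "inverse (rho_diag w) ^ ?N \<le> (B / rho_diag u) ^ ?N"
            using w0 by (intro power_mono) simp_all
          then have "ennreal (inverse (rho_diag w ^ ?N)) \<le> ennreal ((B / rho_diag u) ^ ?N)"
            unfolding power_inverse by (rule ennreal_leI)
          then show ?thesis using True wu unfolding H_def
            by (simp add: mult_right_mono del: power_Suc)
        qed (simp add: H_def)
      qed
      also have "\<dots> = ennreal ((B / rho_diag u) ^ ?N) * G u * emeasure \<mu> (bergman_ball u r)"
        by (rule nn_integral_cmult_indicator) (rule D)
      also have "\<dots> \<le> ennreal ((B / rho_diag u) ^ ?N) * G u * ennreal (A * rho_diag u ^ ?N)"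
        by (intro mult_left_mono A(2)[OF u]) simp
      also have "\<dots> = (ennreal ((B / rho_diag u) ^ ?N) * ennreal (A * rho_diag u ^ ?N)) * G u"
        by (simp only: mult_ac)
      also have "ennreal ((B / rho_diag u) ^ ?N) * ennreal (A * rho_diag u ^ ?N) = ennreal ((B / rho_diag u) ^ ?N * (A * rho_diag u ^ ?N))"
        using B(1) A(1) p by (intro ennreal_mult[symmetric]) auto
      also have "(B / rho_diag u) ^ ?N * (A * rho_diag u ^ ?N) = B ^ ?N * A"
        using p by (simp add: power_divide del: power_Suc)
      finally show ?thesis .
    qed (simp add: H_def G_def)
    have "(\<integral>\<^sup>+z. ennreal (cmod (f z) powr q) \<partial>\<mu>) \<le> (\<integral>\<^sup>+w. ennreal M * (\<integral>\<^sup>+u. H w u \<partial>lborel) \<partial>\<mu>)"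
      using pt M_plus_space[OF \<mu>] by (intro nn_integral_mono) auto
    also have "\<dots> = ennreal M * (\<integral>\<^sup>+w. (\<integral>\<^sup>+u. H w u \<partial>lborel) \<partial>\<mu>)"
      using lborel.borel_measurable_nn_integral[OF H] by (rule nn_integral_cmult)
    also have "(\<integral>\<^sup>+w. (\<integral>\<^sup>+u. H w u \<partial>lborel) \<partial>\<mu>) = (\<integral>\<^sup>+u. (\<integral>\<^sup>+w. H w u \<partial>\<mu>) \<partial>lborel)"
      by (rule Fubini'[OF H, symmetric])
    also have "\<dots> \<le> (\<integral>\<^sup>+u. ennreal (B ^ ?N * A) * G u \<partial>lborel)"
      by (intro nn_integral_mono inner)
    also have "\<dots> = ennreal (B ^ ?N * A) * pintegral q f"
      by (subst nn_integral_cmult) (simp_all add: pintegral_def G_def[symmetric])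
    finally show "(\<integral>\<^sup>+z. ennreal (cmod (f z) powr q) \<partial>\<mu>) \<le> ennreal (M * (B ^ ?N * A)) * pintegral q f"
      using M(1) A(1) B(1) by (simp add: ennreal_mult mult_left_mono mult.assoc)
  next
    show "M * (B ^ ?N * A) > 0" using M(1) A(1) B(1) by simp
  qed
qed

section \<open>Kernel powers as test functions\<close>

lemma holomorphic_vec_mult:
  assumes "holomorphic_vec f S" "holomorphic_vec g S"
  shows "holomorphic_vec (\<lambda>x. f x * g x) S"
  unfolding holomorphic_vec_def
proof
  fix z assume z: "z \<in> S"
  obtain f' g' where d: "(f has_derivative f') (at z within S)" "(g has_derivative g') (at z within S)"
    and lin: "\<And>c v. f' (c *s v) = c * f' v" "\<And>c v. g' (c *s v) = c * g' v"
    using assms z unfolding holomorphic_vec_def by metis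
  show "\<exists>h'. ((\<lambda>x. f x * g x) has_derivative h') (at z within S) \<and> (\<forall>c v. h' (c *s v) = c * h' v)"
    by (intro exI[of _ "\<lambda>h. f z * g' h + f' h * g z"] conjI has_derivative_mult d)
      (simp add: lin algebra_simps)
qed

lemma holomorphic_vec_rho_power:
  fixes u :: "complex ^ 'n::{finite,linorder}"
  assumes u: "u \<in> siegel"
  shows "holomorphic_vec (\<lambda>w. inverse (rho w u) ^ m) siegel"
  unfolding holomorphic_vec_def
proof
  fix z :: "(complex, 'n) vec" assume z: "z \<in> siegel"
  have "(rho_lin u has_derivative rho_lin u) (at z)"
    by (rule bounded_linear_imp_has_derivative[OF bounded_linear_rho_lin])
  moreover have eq: "(\<lambda>w. rho_lin u w + rho 0 u) = (\<lambda>w. rho w u)"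
    by (rule ext) (metis add.commute add_0 rho_add_left)
  ultimately have d: "((\<lambda>w. rho w u) has_derivative rho_lin u) (at z)"
    using has_derivative_add_const[of "rho_lin u" "rho_lin u" "at z" "rho 0 u"] unfolding eq by blast
  have "rho z u \<noteq> 0" by (rule rho_nonzero[OF z u])
  then have "(\<lambda>x. inverse x ^ m) field_differentiable (at (rho z u))"
    by (intro field_differentiable_power field_differentiable_inverse field_differentiable_ident)
  then obtain D where D: "((\<lambda>x. inverse x ^ m) has_field_derivative D) (at (rho z u))"
    unfolding field_differentiable_def by blast
  have "((\<lambda>w. inverse (rho w u) ^ m) has_derivative (\<lambda>v. D * rho_lin u v)) (at z)"
    using has_derivative_compose[OF d D[unfolded has_field_derivative_def]] by simp
  then show "\<exists>f'. ((\<lambda>w. inverse (rho w u) ^ m) has_derivative f') (at z within siegel) \<and>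
      (\<forall>c v. f' (c *s v) = c * f' v)"
    by (intro exI[of _ "\<lambda>v. D * rho_lin u v"]) (simp add: rho_lin_smult has_derivative_at_withinI)
qed

lemma cmod_inverse_power_powr:
  "x \<noteq> 0 \<Longrightarrow> cmod (inverse x ^ m) powr q = cmod x powr (- (real m * q))"
  by (simp add: norm_power norm_inverse powr_powr powr_minus power_inverse inverse_powr flip: powr_realpow)

lemma rho_power_pintegral:
  fixes q :: real
  assumes m: "real m * q > real CARD('n) + 1"
  obtains C where "C > 0" "\<And>u :: complex ^ 'n::{finite,linorder}. u \<in> siegel \<Longrightarrow>
    pintegral q (\<lambda>w. inverse (rho w u) ^ m) \<le> ennreal (C * rho_diag u powr (real CARD('n) + 1 - real m * q))"
proof -
  obtain C where C: "C > 0" "\<And>z :: (complex, 'n) vec. z \<in> siegel \<Longrightarrow>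
      (\<integral>\<^sup>+w\<in>siegel. ennreal (rho_diag w powr 0 * cmod (rho z w) powr (- (real m * q))) \<partial>lborel)
      \<le> ennreal (C * rho_diag z powr (real CARD('n) + 1 + 0 - real m * q))"
    by (rule Forelli_Rudin[of 0 "real m * q", where 'n = 'n]) (use m that in auto)
  show ?thesis
  proof (rule that[OF C(1)])
    fix u :: "(complex, 'n) vec" assume u: "u \<in> siegel"
    have "pintegral q (\<lambda>w. inverse (rho w u) ^ m)
        = (\<integral>\<^sup>+w\<in>siegel. ennreal (rho_diag w powr 0 * cmod (rho u w) powr (- (real m * q))) \<partial>lborel)"
      unfolding pintegral_def
    proof (intro nn_integral_cong)
      fix w :: "(complex, 'n) vec"
      show "ennreal (cmod (inverse (rho w u) ^ m) powr q) * indicator siegel w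
        = ennreal (rho_diag w powr 0 * cmod (rho u w) powr (- (real m * q))) * indicator siegel w"
      proof (cases "w \<in> siegel")
        case True
        \<comment> \<open>This uses that \<open>rho_diag w\<close> is positive:
          \<open>0 powr 0\<close> is 0.\<close>
        then have "rho_diag w powr 0 = 1" by (simp add: siegel_iff)
        then show ?thesis
          using cmod_inverse_power_powr[OF rho_nonzero[OF True u], of m q] cmod_rho_commute[of w u] by simp
      qed simp
    qed
    then show "pintegral q (\<lambda>w. inverse (rho w u) ^ m) \<le> ennreal (C * rho_diag u powr (real CARD('n) + 1 - real m * q))"
      using C(2)[OF u] by simp
  qed
qed

lemma rho_power_in_bergman_space:
  fixes u :: "complex ^ 'n::{finite,linorder}"
  assumes m: "real m * q > real CARD('n) + 1" and u: "u \<in> siegel"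
  shows "(\<lambda>w. inverse (rho w u) ^ m) \<in> bergman_space q"
proof -
  obtain C where "\<And>u :: (complex, 'n) vec. u \<in> siegel \<Longrightarrow>
    pintegral q (\<lambda>w. inverse (rho w u) ^ m) \<le> ennreal (C * rho_diag u powr (real CARD('n) + 1 - real m * q))"
    by (rule rho_power_pintegral[OF m]) (rule that)
  from le_less_trans[OF this[OF u]] show ?thesis
    by (simp add: bergman_space_def holomorphic_vec_rho_power[OF u])
qed

lemma bounded_averaging_of_carleson:
  fixes \<mu> :: "(complex ^ 'n::{finite,linorder}) measure"
  assumes \<mu>: "\<mu> \<in> M_plus" and r: "r > 0" and q: "q > 0" and carl: "carleson q \<mu>"
  shows "bounded_on_siegel (averaging \<mu> r)"
proof -
  \<comment> \<open>An integer exponent keeps the test function free of branches; a small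
    \<open>q\<close> forces \<open>m\<close> to be large for membership in the Bergman
    space.\<close>
  obtain m :: nat where "(real CARD('n) + 1) / q < real m" using reals_Archimedean2 by blast
  then have m: "real m * q > real CARD('n) + 1" using q by (simp add: field_simps)
  obtain C where C: "C > 0" "\<And>u :: (complex, 'n) vec. u \<in> siegel \<Longrightarrow>
    pintegral q (\<lambda>w. inverse (rho w u) ^ m) \<le> ennreal (C * rho_diag u powr (real CARD('n) + 1 - real m * q))"
    by (rule rho_power_pintegral[OF m]) (rule that)
  obtain K where K: "K > 0" "\<And>f. f \<in> bergman_space q \<Longrightarrow>
      (\<integral>\<^sup>+z. ennreal (cmod (f z) powr q) \<partial>\<mu>) \<le> ennreal K * pintegral q f"
    using carl unfolding carleson_def by blast
  show ?thesis
  proof (rule bounded_averaging_of_kernel_bound[OF \<mu> r, of "real m * q" "K * C"])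
    fix u :: "(complex, 'n) vec" assume u: "u \<in> siegel"
    have "(\<integral>\<^sup>+w. ennreal (cmod (rho u w) powr (- (real m * q))) \<partial>\<mu>)
        = (\<integral>\<^sup>+w. ennreal (cmod (inverse (rho w u) ^ m) powr q) \<partial>\<mu>)"
      using M_plus_space[OF \<mu>]
      by (intro nn_integral_cong) (simp add: cmod_inverse_power_powr rho_nonzero u cmod_rho_commute[of u])
    also have "\<dots> \<le> ennreal K * pintegral q (\<lambda>w. inverse (rho w u) ^ m)"
      by (rule K(2)[OF rho_power_in_bergman_space[OF m u]])
    also have "\<dots> \<le> ennreal K * ennreal (C * rho_diag u powr (real CARD('n) + 1 - real m * q))"
      by (intro mult_left_mono C(2)[OF u]) simp
    also have "\<dots> = ennreal (K * C * rho_diag u powr (real CARD('n) + 1 - real m * q))"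
      using K(1) C(1) by (simp add: mult.assoc flip: ennreal_mult)
    finally show "(\<integral>\<^sup>+w. ennreal (cmod (rho u w) powr (- (real m * q))) \<partial>\<mu>)
      \<le> ennreal (K * C * rho_diag u powr (real CARD('n) + 1 - real m * q))" .
  qed (use q K(1) C(1) in auto)
qed

section \<open>The Berezin transform\<close>

lemma bergman_kernel_alt:
  "bergman_kernel z w =
    complex_of_real (fact CARD('n) / (4 * pi ^ CARD('n))) * inverse (rho z w) ^ (CARD('n) + 1)"
  for z :: "complex ^ 'n::{finite,linorder}"
proof -
  have "- int CARD('n) - 1 = - int (CARD('n) + 1)" by simp
  then show ?thesis
    unfolding bergman_kernel_def by (simp only: power_int_minus power_int_of_nat power_inverse)
qed

lemma cmod_normalized_kernel_sq:
  fixes u w :: "complex ^ 'n::{finite,linorder}"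
  assumes u: "u \<in> siegel" and w: "w \<in> siegel"
  shows "(cmod (normalized_kernel u w))\<^sup>2 = fact CARD('n) / (4 * pi ^ CARD('n)) *
    (rho_diag u ^ (CARD('n) + 1) * cmod (rho u w) powr (- (2 * (real CARD('n) + 1))))"
proof -
  define c :: real where "c = fact CARD('n) / (4 * pi ^ CARD('n))"
  define N where "N = CARD('n) + 1"
  have c: "c > 0" by (simp add: c_def)
  have p: "rho_diag u > 0" using u by (simp add: siegel_iff)
  have R: "cmod (rho u w) > 0" by (rule cmod_rho_pos[OF u w])
  have K: "cmod (bergman_kernel z v) = c * inverse (cmod (rho z v)) ^ N" for z v :: "(complex, 'n) vec"
    unfolding bergman_kernel_alt c_def[symmetric] N_def[symmetric] using c
    by (simp add: norm_mult norm_power norm_inverse)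
  \<comment> \<open>Squaring removes \<open>csqrt\<close>, so its choice of branch does not affect
    the result.\<close>
  have "(cmod (normalized_kernel u w))\<^sup>2 = (cmod (bergman_kernel u w))\<^sup>2 / cmod ((csqrt (bergman_kernel u u))\<^sup>2)"
    by (simp add: normalized_kernel_def norm_divide power_divide norm_power)
  also have "\<dots> = (c * inverse (cmod (rho u w)) ^ N)\<^sup>2 / (c * inverse (rho_diag u) ^ N)"
    using p by (simp add: K rho_self)
  also have "\<dots> = c * (rho_diag u ^ N * (inverse (cmod (rho u w)) ^ N)\<^sup>2)"
    using c p by (simp add: power2_eq_square field_simps power_inverse)
  also have "(inverse (cmod (rho u w)) ^ N)\<^sup>2 = cmod (rho u w) powr (- real (2 * N))"
  proof -
    have "(inverse (cmod (rho u w)) ^ N)\<^sup>2 = inverse (cmod (rho u w) ^ (2 * N))"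
      by (simp add: power_inverse power_mult mult.commute flip: power_mult)
    then show ?thesis using R by (simp only: powr_minus powr_realpow)
  qed
  finally show ?thesis by (simp add: c_def N_def add.commute)
qed

lemma berezin_eq:
  fixes \<mu> :: "(complex ^ 'n::{finite,linorder}) measure"
  assumes \<mu>: "\<mu> \<in> M_plus" and u: "u \<in> siegel"
  shows "berezin \<mu> u = ennreal (fact CARD('n) / (4 * pi ^ CARD('n)) * rho_diag u ^ (CARD('n) + 1)) *
    (\<integral>\<^sup>+w. ennreal (cmod (rho u w) powr (- (2 * (real CARD('n) + 1)))) \<partial>\<mu>)"
proof -
  have p: "rho_diag u > 0" using u by (simp add: siegel_iff)
  have "berezin \<mu> u = (\<integral>\<^sup>+w. ennreal (fact CARD('n) / (4 * pi ^ CARD('n)) * rho_diag u ^ (CARD('n) + 1)) *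
      ennreal (cmod (rho u w) powr (- (2 * (real CARD('n) + 1)))) \<partial>\<mu>)"
    unfolding berezin_def
  proof (rule nn_integral_cong)
    fix w assume "w \<in> space \<mu>"
    then have w: "w \<in> siegel" by (simp add: M_plus_space[OF \<mu>])
    show "ennreal ((cmod (normalized_kernel u w))\<^sup>2) = ennreal (fact CARD('n) / (4 * pi ^ CARD('n)) * rho_diag u ^ (CARD('n) + 1)) *
      ennreal (cmod (rho u w) powr (- (2 * (real CARD('n) + 1))))"
      unfolding cmod_normalized_kernel_sq[OF u w] mult.assoc[symmetric]
      using p by (intro ennreal_mult) auto
  qed
  also have "\<dots> = ennreal (fact CARD('n) / (4 * pi ^ CARD('n)) * rho_diag u ^ (CARD('n) + 1)) *
      (\<integral>\<^sup>+w. ennreal (cmod (rho u w) powr (- (2 * (real CARD('n) + 1)))) \<partial>\<mu>)"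
    by (intro nn_integral_cmult M_plus_measurable[OF \<mu>]) measurable
  finally show ?thesis .
qed

lemma bounded_averaging_of_berezin:
  fixes \<mu> :: "(complex ^ 'n::{finite,linorder}) measure"
  assumes \<mu>: "\<mu> \<in> M_plus" and r: "r > 0" and bdd: "bounded_on_siegel (berezin \<mu>)"
  shows "bounded_on_siegel (averaging \<mu> r)"
proof -
  define c :: real where "c = fact CARD('n) / (4 * pi ^ CARD('n))"
  have c: "c > 0" by (simp add: c_def)
  obtain C where C: "\<And>u. u \<in> siegel \<Longrightarrow> berezin \<mu> u \<le> ennreal C"
    using bdd unfolding bounded_on_siegel_def by blast
  show ?thesis
  proof (rule bounded_averaging_of_kernel_bound[OF \<mu> r, of "2 * (real CARD('n) + 1)" "(\<bar>C\<bar> + 1) / c"])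
    fix u :: "(complex, 'n) vec" assume u: "u \<in> siegel"
    define p where "p = rho_diag u"
    have p: "p > 0" using u by (simp add: p_def siegel_iff)
    let ?x = "c * p ^ (CARD('n) + 1)"
    let ?I = "\<integral>\<^sup>+w. ennreal (cmod (rho u w) powr (- (2 * (real CARD('n) + 1)))) \<partial>\<mu>"
    have x: "?x > 0" using c p by simp
    have "?I = ennreal (inverse ?x) * (ennreal ?x * ?I)"
    proof -
      have "ennreal (inverse y) * ennreal y = 1" if "y > 0" for y
        using that by (simp flip: ennreal_mult)
      from this[OF x] show ?thesis by (simp only: mult.assoc[symmetric] mult_1)
    qed
    also have "\<dots> \<le> ennreal (inverse ?x) * ennreal (\<bar>C\<bar> + 1)"
    proof (rule mult_left_mono)
      have "ennreal ?x * ?I \<le> ennreal C"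
        using C[OF u] unfolding berezin_eq[OF \<mu> u] c_def[symmetric] p_def[symmetric] .
      also have "ennreal C \<le> ennreal (\<bar>C\<bar> + 1)" by (rule ennreal_leI) simp
      finally show "ennreal ?x * ?I \<le> ennreal (\<bar>C\<bar> + 1)" .
    qed simp
    also have "\<dots> = ennreal (inverse ?x * (\<bar>C\<bar> + 1))"
      using c p by (intro ennreal_mult[symmetric]) auto
    also have "inverse ?x = inverse c * p powr (real CARD('n) + 1 - 2 * (real CARD('n) + 1))"
    proof -
      have "real CARD('n) + 1 - 2 * (real CARD('n) + 1) = - real (CARD('n) + 1)" by simp
      then show ?thesis using p by (simp only: powr_minus powr_realpow inverse_mult_distrib)
    qed
    finally show "?I \<le> ennreal ((\<bar>C\<bar> + 1) / c * rho_diag u powr (real CARD('n) + 1 - 2 * (real CARD('n) + 1)))"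
      by (simp add: p_def divide_inverse mult_ac)
  qed (use c in \<open>auto simp: add_nonneg_pos\<close>)
qed

lemma bounded_berezin_of_averaging:
  fixes \<mu> :: "(complex ^ 'n::{finite,linorder}) measure"
  assumes \<mu>: "\<mu> \<in> M_plus" and r: "r > 0" and bdd: "bounded_on_siegel (averaging \<mu> r)"
  shows "bounded_on_siegel (berezin \<mu>)"
proof -
  define c :: real where "c = fact CARD('n) / (4 * pi ^ CARD('n))"
  have c: "c > 0" by (simp add: c_def)
  define m where "m = CARD('n) + 1"
  have m: "real m * 2 > real CARD('n) + 1" by (simp add: m_def)
  obtain C where C: "C > 0" "\<And>u :: (complex, 'n) vec. u \<in> siegel \<Longrightarrow>
    pintegral 2 (\<lambda>w. inverse (rho w u) ^ m) \<le> ennreal (C * rho_diag u powr (real CARD('n) + 1 - real m * 2))"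
    by (rule rho_power_pintegral[OF m]) (rule that)
  have two: "(2::real) > 0" by simp
  obtain K where K: "K > 0" "\<And>f. holomorphic_vec f siegel \<Longrightarrow>
      (\<integral>\<^sup>+z. ennreal (cmod (f z) powr 2) \<partial>\<mu>) \<le> ennreal K * pintegral 2 f"
    by (rule carleson_of_bounded_averaging[OF \<mu> r two bdd]) (rule that)
  have "berezin \<mu> u \<le> ennreal (c * (K * C))" if u: "u \<in> siegel" for u
  proof -
    define p where "p = rho_diag u"
    have p: "p > 0" using u by (simp add: p_def siegel_iff)
    have "(\<integral>\<^sup>+w. ennreal (cmod (rho u w) powr (- (2 * (real CARD('n) + 1)))) \<partial>\<mu>)
        = (\<integral>\<^sup>+w. ennreal (cmod (inverse (rho w u) ^ m) powr 2) \<partial>\<mu>)"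
    proof (rule nn_integral_cong)
      fix w assume "w \<in> space \<mu>"
      then have w: "w \<in> siegel" by (simp add: M_plus_space[OF \<mu>])
      have "2 * (real CARD('n) + 1) = real m * 2" by (simp add: m_def)
      then show "ennreal (cmod (rho u w) powr (- (2 * (real CARD('n) + 1)))) = ennreal (cmod (inverse (rho w u) ^ m) powr 2)"
        by (simp only: cmod_inverse_power_powr[OF rho_nonzero[OF w u]] cmod_rho_commute[of u w])
    qed
    also have "\<dots> \<le> ennreal K * pintegral 2 (\<lambda>w. inverse (rho w u) ^ m)"
      by (rule K(2)[OF holomorphic_vec_rho_power[OF u]])
    also have "\<dots> \<le> ennreal K * ennreal (C * p powr (real CARD('n) + 1 - real m * 2))"
      unfolding p_def by (intro mult_left_mono C(2)[OF u]) simp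
    also have "\<dots> = ennreal (K * C * p powr (- real m))"
      using K(1) C(1) by (simp add: m_def mult.assoc flip: ennreal_mult)
    finally have "berezin \<mu> u \<le> ennreal (c * p ^ m) * ennreal (K * C * p powr (- real m))"
      unfolding berezin_eq[OF \<mu> u] c_def[symmetric] p_def[symmetric] m_def[symmetric]
      by (intro mult_left_mono) auto
    also have "\<dots> = ennreal (c * (K * C))"
      using p c K(1) C(1) by (simp add: powr_minus powr_realpow flip: ennreal_mult)
    finally show ?thesis .
  qed
  then show ?thesis unfolding bounded_on_siegel_def by blast
qed

section \<open>Differentiation of kernel integrals and Schur's test\<close>

text \<open>A second-order Taylor bound with one constant for the whole disc of radius 1/2. It will
  be applied with \<open>u\<close> the relative increment of \<open>rho\<close>, uniformly in the
  integration variable.\<close>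

lemma inverse_one_plus_power_remainder:
  "\<exists>K\<ge>0. \<forall>u::complex. cmod u \<le> 1/2 \<longrightarrow> cmod (inverse (1 + u) ^ m - 1 + of_nat m * u) \<le> K * (cmod u)\<^sup>2"
proof (induction m)
  case 0
  show ?case by (intro exI[of _ 0]) simp
next
  case (Suc m)
  then obtain K where K: "K \<ge> 0"
    "\<And>u. cmod u \<le> 1/2 \<Longrightarrow> cmod (inverse (1 + u) ^ m - 1 + of_nat m * u) \<le> K * (cmod u)\<^sup>2" by blast
  \<comment> \<open>The factor 2 bounds the inverse of \<open>1 + u\<close>; the summand
    \<open>real m + 1\<close> comes from the quadratic term of
    \<open>(1 + u) * (1 - of_nat (Suc m) * u)\<close>.\<close>
  show ?case
  proof (intro exI[of _ "2 * (K + (real m + 1))"] conjI allI impI)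
    fix u :: complex assume u: "cmod u \<le> 1/2"
    have low: "1/2 \<le> cmod (1 + u)" using norm_triangle_ineq4[of "1 + u" u] u by simp
    then have ne: "1 + u \<noteq> 0" by auto
    define E where "E = inverse (1 + u) ^ m - 1 + of_nat m * u"
    have "inverse (1 + u) ^ Suc m - 1 + of_nat (Suc m) * u
        = inverse (1 + u) * (E + 1 - of_nat m * u - (1 + u) * (1 - of_nat (Suc m) * u))"
    proof -
      define X where "X = inverse (1 + u) ^ m"
      define Y where "Y = 1 - of_nat (Suc m) * u"
      have "inverse (1 + u) * (X - (1 + u) * Y) = inverse (1 + u) * X - Y"
        using ne by (simp add: right_diff_distrib mult.assoc[symmetric])
      then show ?thesis by (simp add: E_def X_def [symmetric]) (simp add: Y_def)
    qed
    also have "E + 1 - of_nat m * u - (1 + u) * (1 - of_nat (Suc m) * u) = E + (of_nat m + 1) * u\<^sup>2"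
      by (simp add: power2_eq_square algebra_simps)
    finally have "cmod (inverse (1 + u) ^ Suc m - 1 + of_nat (Suc m) * u)
        = inverse (cmod (1 + u)) * cmod (E + (of_nat m + 1) * u\<^sup>2)"
      by (simp add: norm_mult norm_inverse)
    also have "\<dots> \<le> 2 * (K * (cmod u)\<^sup>2 + (real m + 1) * (cmod u)\<^sup>2)"
    proof (intro mult_mono)
      show "inverse (cmod (1 + u)) \<le> 2" using low le_imp_inverse_le[OF low] by simp
      have "cmod (of_nat m + 1 :: complex) = real m + 1"
        by (metis norm_of_nat of_nat_Suc add.commute)
      then show "cmod (E + (of_nat m + 1) * u\<^sup>2) \<le> K * (cmod u)\<^sup>2 + (real m + 1) * (cmod u)\<^sup>2"
        using K(2)[OF u] norm_triangle_ineq[of E "(of_nat m + 1) * u\<^sup>2"]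
        by (simp add: E_def norm_mult norm_power)
    qed auto
    finally show "cmod (inverse (1 + u) ^ Suc m - 1 + of_nat (Suc m) * u) \<le> 2 * (K + (real m + 1)) * (cmod u)\<^sup>2"
      by (simp add: algebra_simps)
  qed (use K(1) in simp)
qed

lemma bounded_linear_axis: "bounded_linear (axis i :: complex \<Rightarrow> complex ^ 'n::finite)"
  by (intro linear_conv_bounded_linear[THEN iffD1] linearI) (simp_all add: vec_eq_iff axis_def)

context
  fixes \<mu> :: "(complex ^ 'n::{finite,linorder}) measure" and g :: "complex ^ 'n::{finite,linorder} \<Rightarrow> complex" and m :: nat
  assumes \<mu>: "\<mu> \<in> M_plus"
    and int: "\<And>z. z \<in> siegel \<Longrightarrow> integrable \<mu> (\<lambda>w. g w * inverse (rho z w) ^ m)"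
begin

text \<open>For fixed \<open>z\<close> the inverse of \<open>rho z w\<close> is bounded by
  \<open>2 / rho_diag z\<close>, so further kernel powers preserve integrability and differentiation
  can be repeated.\<close>

lemma integrable_rho_power_Suc:
  assumes z: "z \<in> siegel"
  shows "integrable \<mu> (\<lambda>w. g w * inverse (rho z w) ^ Suc m)"
proof (rule Bochner_Integration.integrable_bound)
  show "integrable \<mu> (\<lambda>w. complex_of_real (2 / rho_diag z) * (g w * inverse (rho z w) ^ m))"
    by (intro integrable_mult_right int z)
  have [measurable]: "(\<lambda>w. inverse (rho z w)) \<in> borel_measurable \<mu>"
    by (rule M_plus_measurable[OF \<mu>]) measurable
  have [measurable]: "(\<lambda>w. g w * inverse (rho z w) ^ m) \<in> borel_measurable \<mu>" using int[OF z] by auto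
  have "(\<lambda>w. inverse (rho z w) * (g w * inverse (rho z w) ^ m)) \<in> borel_measurable \<mu>" by measurable
  then show "(\<lambda>w. g w * inverse (rho z w) ^ Suc m) \<in> borel_measurable \<mu>" by (simp add: mult_ac)
  show "AE w in \<mu>. norm (g w * inverse (rho z w) ^ Suc m)
      \<le> norm (complex_of_real (2 / rho_diag z) * (g w * inverse (rho z w) ^ m))"
  proof (rule AE_I2)
    fix w assume "w \<in> space \<mu>"
    then have w: "w \<in> siegel" by (simp add: M_plus_space[OF \<mu>])
    have p: "rho_diag z > 0" using z by (simp add: siegel_iff)
    have "inverse (cmod (rho z w)) \<le> 2 / rho_diag z"
      using rho_diag_le[OF z w] p cmod_rho_pos[OF z w] by (simp add: field_simps)
    from mult_right_mono[OF this, of "cmod (g w * inverse (rho z w) ^ m)"]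
    show "norm (g w * inverse (rho z w) ^ Suc m)
        \<le> norm (complex_of_real (2 / rho_diag z) * (g w * inverse (rho z w) ^ m))"
      using p by (simp add: norm_mult norm_power norm_inverse norm_divide mult_ac)
  qed
qed

text \<open>
  The kernel satisfies \<open>\<bar>rho (z + v) w - rho z w\<bar> \<le> C \<bar>v\<bar> \<bar>rho z w\<bar>\<close> uniformly in \<open>w\<close>, so the first-order
  remainder of the integrand is at most a multiple of \<open>\<bar>v\<bar>\<^sup>2\<close> times the integrand itself.
\<close>

lemma rho_power_integral_has_derivative:
  assumes z: "z \<in> siegel"
  shows "((\<lambda>z. LINT w|\<mu>. g w * inverse (rho z w) ^ m) has_derivative
    (\<lambda>v. - of_nat m * (LINT w|\<mu>. g w * inverse (rho z w) ^ Suc m * rho_lin w v))) (at z)"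
proof -
  define A where "A w = g w * inverse (rho z w) ^ m" for w
  \<comment> \<open>The relative increment: \<open>rho (z + v) w = rho z w * (1 + U v w)\<close>,
    with \<open>U\<close> bounded by a multiple of \<open>norm v\<close> uniformly in
    \<open>w\<close>.\<close>
  define U where "U v w = inverse (rho z w) * rho_lin w v" for v w
  define L where "L v = - of_nat m * (LINT w|\<mu>. A w * U v w)" for v
  define I where "I = (LINT w|\<mu>. cmod (A w))"
  have A: "integrable \<mu> A" unfolding A_def by (rule int[OF z])
  then have mA [measurable]: "A \<in> borel_measurable \<mu>" by auto
  have [measurable]: "U v \<in> borel_measurable \<mu>" for v
    unfolding U_def by (rule M_plus_measurable[OF \<mu>]) measurable
  have I: "I \<ge> 0" unfolding I_def by simp
  obtain C where C: "C > 0"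
    "\<And>v w. w \<in> siegel \<Longrightarrow> cmod (rho (z + v) w - rho z w) \<le> C * norm v * cmod (rho z w)"
    by (rule cmod_rho_perturb[OF z]) (rule that)
  have Ub: "cmod (U v w) \<le> C * norm v" if w: "w \<in> siegel" for v w
  proof -
    have "cmod (rho_lin w v) \<le> C * norm v * cmod (rho z w)"
      using C(2)[OF w, of v] by (simp add: rho_add_left)
    then show ?thesis
      using cmod_rho_pos[OF z w] by (simp only: U_def norm_mult norm_inverse pos_divide_le_eq [symmetric])
        (simp add: divide_inverse mult.commute)
  qed
  have AU: "integrable \<mu> (\<lambda>w. A w * U v w)" for v
  proof (rule Bochner_Integration.integrable_bound)
    show "integrable \<mu> (\<lambda>w. complex_of_real (C * norm v) * A w)" by (intro integrable_mult_right A)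
    show "AE w in \<mu>. norm (A w * U v w) \<le> norm (complex_of_real (C * norm v) * A w)"
    proof (rule AE_I2)
      fix w assume "w \<in> space \<mu>"
      then have w: "w \<in> siegel" by (simp add: M_plus_space[OF \<mu>])
      from mult_right_mono[OF Ub[OF w, of v], of "cmod (A w)"]
      show "norm (A w * U v w) \<le> norm (complex_of_real (C * norm v) * A w)"
        using C(1) by (simp add: norm_mult mult_ac)
    qed
  qed measurable
  have U_add: "U (a + b) w = U a w + U b w" and U_scale: "U (c *\<^sub>R a) w = complex_of_real c * U a w" for a b c w
    by (simp_all add: U_def rho_lin_add rho_lin_scaleR algebra_simps)
  have L: "bounded_linear L"
  proof (intro linear_conv_bounded_linear[THEN iffD1] linearI)
    show "L (a + b) = L a + L b" for a b
      using Bochner_Integration.integral_add[OF AU[of a] AU[of b]]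
      by (simp add: L_def U_add algebra_simps)
    show "L (c *\<^sub>R a) = c *\<^sub>R L a" for c a
    proof -
      have "(LINT w|\<mu>. A w * U (c *\<^sub>R a) w) = (LINT w|\<mu>. complex_of_real c * (A w * U a w))"
        by (simp add: U_scale mult_ac)
      also have "\<dots> = complex_of_real c * (LINT w|\<mu>. A w * U a w)" by (rule integral_mult_right_zero)
      finally show ?thesis by (simp add: L_def scaleR_conv_of_real[where 'a=complex] mult_ac)
    qed
  qed
  obtain K where K: "K \<ge> 0"
    "\<And>u::complex. cmod u \<le> 1/2 \<Longrightarrow> cmod (inverse (1 + u) ^ m - 1 + of_nat m * u) \<le> K * (cmod u)\<^sup>2"
    using inverse_one_plus_power_remainder[of m] by blast
  obtain e0 where e0: "e0 > 0" "ball z e0 \<subseteq> siegel"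
    using open_siegel z open_contains_ball by blast
  \<comment> \<open>Within this radius \<open>z + v\<close> stays in the half-space and
    \<open>U\<close> has modulus at most 1/2, the range of the Taylor bound.\<close>
  define e where "e = min e0 (1 / (2 * C))"
  have rem: "cmod ((LINT w|\<mu>. g w * inverse (rho (z + v) w) ^ m) - (LINT w|\<mu>. A w) - L v) \<le> K * C\<^sup>2 * I * (norm v)\<^sup>2"
    if v: "norm v < e" for v
  proof -
    have zv: "z + v \<in> siegel" using v e0 by (auto simp: e_def subset_iff dist_norm)
    have Cv: "C * norm v \<le> 1/2" using v C(1) by (simp add: e_def field_simps)
    have pt: "cmod (g w * inverse (rho (z + v) w) ^ m - A w + of_nat m * (A w * U v w)) \<le> K * C\<^sup>2 * (norm v)\<^sup>2 * cmod (A w)"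
      if w: "w \<in> siegel" for w
    proof -
      have ne: "rho z w \<noteq> 0" by (rule rho_nonzero[OF z w])
      have "rho (z + v) w = rho z w * (1 + U v w)"
        unfolding rho_add_left using ne by (simp add: U_def distrib_left)
      then have "g w * inverse (rho (z + v) w) ^ m - A w + of_nat m * (A w * U v w)
          = A w * (inverse (1 + U v w) ^ m - 1 + of_nat m * U v w)"
        by (simp only: A_def inverse_mult_distrib power_mult_distrib) (simp add: algebra_simps)
      moreover
      have "cmod (inverse (1 + U v w) ^ m - 1 + of_nat m * U v w) \<le> K * (C * norm v)\<^sup>2"
      proof -
        have "cmod (inverse (1 + U v w) ^ m - 1 + of_nat m * U v w) \<le> K * (cmod (U v w))\<^sup>2"
          using Ub[OF w, of v] Cv by (intro K(2)) linarith
        also have "\<dots> \<le> K * (C * norm v)\<^sup>2"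
          using Ub[OF w, of v] K(1) by (intro mult_left_mono power_mono) auto
        finally show ?thesis .
      qed
      from mult_left_mono[OF this, of "cmod (A w)"]
      have "cmod (A w * (inverse (1 + U v w) ^ m - 1 + of_nat m * U v w)) \<le> K * C\<^sup>2 * (norm v)\<^sup>2 * cmod (A w)"
        by (simp add: norm_mult power_mult_distrib mult_ac)
      ultimately show ?thesis by simp
    qed
    have "(LINT w|\<mu>. g w * inverse (rho (z + v) w) ^ m) - (LINT w|\<mu>. A w) - L v
        = (LINT w|\<mu>. g w * inverse (rho (z + v) w) ^ m - A w + of_nat m * (A w * U v w))"
      using int[OF zv] A AU[of v] by (simp add: L_def)
    also have "cmod \<dots> \<le> (LINT w|\<mu>. K * C\<^sup>2 * (norm v)\<^sup>2 * cmod (A w))"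
      using pt M_plus_space[OF \<mu>] int[OF zv] A AU[of v]
      by (intro Bochner_Integration.integral_norm_bound_integral Bochner_Integration.integrable_add
          Bochner_Integration.integrable_diff integrable_mult_right integrable_norm) auto
    also have "\<dots> = K * C\<^sup>2 * I * (norm v)\<^sup>2"
      by (simp add: I_def)
    finally show ?thesis .
  qed
  have L_eq: "(\<lambda>v. - of_nat m * (LINT w|\<mu>. g w * inverse (rho z w) ^ Suc m * rho_lin w v)) = L"
    by (rule ext) (simp add: L_def A_def U_def mult_ac)
  show ?thesis unfolding L_eq
  proof (rule has_derivativeI_sandwich[of e])
    show "e > 0" using e0 C(1) by (simp add: e_def)
    show "bounded_linear L" by (rule L)
    fix y assume y: "y \<noteq> z" "dist y z < e"
    have "cmod ((LINT w|\<mu>. g w * inverse (rho y w) ^ m) - (LINT w|\<mu>. g w * inverse (rho z w) ^ m) - L (y - z))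
       \<le> K * C\<^sup>2 * I * (norm (y - z))\<^sup>2"
      using rem[of "y - z"] y by (simp add: dist_norm A_def)
    then show "norm ((LINT w|\<mu>. g w * inverse (rho y w) ^ m) - (LINT w|\<mu>. g w * inverse (rho z w) ^ m) - L (y - z))
       / norm (y - z) \<le> K * C\<^sup>2 * I * norm (y - z)"
      using y by (simp add: divide_le_eq power2_eq_square mult_ac)
  next
    have "((\<lambda>y. K * C\<^sup>2 * I * norm (y - z)) \<longlongrightarrow> K * C\<^sup>2 * I * norm (z - z)) (at z)"
      by (intro tendsto_intros)
    then show "((\<lambda>y. K * C\<^sup>2 * I * norm (y - z)) \<longlongrightarrow> 0) (at z)" by simp
  qed
qed

lemma holomorphic_vec_rho_power_integral:
  "holomorphic_vec (\<lambda>z. LINT w|\<mu>. g w * inverse (rho z w) ^ m) siegel"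
  unfolding holomorphic_vec_def
proof
  fix z :: "(complex, 'n) vec" assume z: "z \<in> siegel"
  have "- of_nat m * (LINT w|\<mu>. g w * inverse (rho z w) ^ Suc m * rho_lin w (c *s v))
      = c * (- of_nat m * (LINT w|\<mu>. g w * inverse (rho z w) ^ Suc m * rho_lin w v))" for c v
  proof -
    have "(LINT w|\<mu>. g w * inverse (rho z w) ^ Suc m * rho_lin w (c *s v))
        = (LINT w|\<mu>. c * (g w * inverse (rho z w) ^ Suc m * rho_lin w v))"
      by (simp add: rho_lin_smult mult_ac)
    also have "\<dots> = c * (LINT w|\<mu>. g w * inverse (rho z w) ^ Suc m * rho_lin w v)"
      by (rule integral_mult_right_zero)
    finally show ?thesis by (simp add: mult_ac)
  qed
  then show "\<exists>f'. ((\<lambda>z. LINT w|\<mu>. g w * inverse (rho z w) ^ m) has_derivative f') (at z within siegel) \<and>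
      (\<forall>c v. f' (c *s v) = c * f' v)"
    using has_derivative_at_withinI[OF rho_power_integral_has_derivative[OF z]] by blast
qed

text \<open>Along the last coordinate \<open>rho_lin w\<close> is multiplication by
  \<open>- (\<i> / 2)\<close>, independent of \<open>w\<close>. The derivative is therefore an
  integral of the same form with the exponent raised by one, which makes iteration possible.\<close>

lemma rho_power_integral_slice_has_field_derivative:
  assumes z: "u + axis last_ix \<zeta> \<in> siegel"
  shows "((\<lambda>\<zeta>. LINT w|\<mu>. g w * inverse (rho (u + axis last_ix \<zeta>) w) ^ m) has_field_derivative
     of_nat m * (\<i> / 2) * (LINT w|\<mu>. g w * inverse (rho (u + axis last_ix \<zeta>) w) ^ Suc m)) (at \<zeta>)"
proof -
  have "(axis last_ix has_derivative (axis last_ix :: complex \<Rightarrow> (complex, 'n) vec)) (at \<zeta>)"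
    by (rule bounded_linear_imp_has_derivative[OF bounded_linear_axis])
  then have "((\<lambda>\<zeta>. u + axis last_ix \<zeta>) has_derivative axis last_ix) (at \<zeta>)"
    by (auto intro!: derivative_eq_intros)
  from has_derivative_compose[OF this rho_power_integral_has_derivative[OF z]]
  show ?thesis
    unfolding has_field_derivative_def
    by (simp add: rho_lin_axis_last mult_ac)
      (erule has_derivative_eq_rhs, simp add: fun_eq_iff mult_ac flip: integral_mult_right_zero)
qed

end

lemma iterated_deriv_rho_power_integral_slice:
  fixes \<mu> :: "(complex ^ 'n::{finite,linorder}) measure"
  assumes \<mu>: "\<mu> \<in> M_plus"
    and int: "\<And>z. z \<in> siegel \<Longrightarrow> integrable \<mu> (\<lambda>w. g w * inverse (rho z w) ^ m)"
    and z: "u + axis last_ix \<zeta> \<in> siegel"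
  shows "(deriv ^^ k) (\<lambda>\<zeta>. LINT w|\<mu>. g w * inverse (rho (u + axis last_ix \<zeta>) w) ^ m) \<zeta>
    = (\<Prod>j<k. of_nat (m + j) * (\<i> / 2)) * (LINT w|\<mu>. g w * inverse (rho (u + axis last_ix \<zeta>) w) ^ (m + k))"
  using z
proof (induction k arbitrary: \<zeta>)
  case (Suc k)
  \<comment> \<open>The induction hypothesis is used on this open set, not just at one point, so
    that the formula for the k-th derivative can be differentiated again.\<close>
  define T where "T = {\<zeta>. u + axis last_ix \<zeta> \<in> siegel}"
  have "continuous_on UNIV (\<lambda>\<zeta>. u + axis last_ix \<zeta>)"
    by (intro continuous_intros linear_continuous_on bounded_linear_axis)
  from open_vimage[OF open_siegel this]
  have T: "open T" by (simp add: T_def vimage_def)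
  have intk: "z \<in> siegel \<Longrightarrow> integrable \<mu> (\<lambda>w. g w * inverse (rho z w) ^ (m + k))" for z and k :: nat
  proof (induction k arbitrary: z)
    case (Suc k)
    show ?case using integrable_rho_power_Suc[OF \<mu> Suc.IH Suc.prems] by simp
  qed (simp add: int)
  define \<phi> where "\<phi> j \<zeta> = (LINT w|\<mu>. g w * inverse (rho (u + axis last_ix \<zeta>) w) ^ (m + j))" for j \<zeta>
  define c where "c k = (\<Prod>j<k. of_nat (m + j) * (\<i> / 2))" for k
  have IH: "(deriv ^^ k) (\<lambda>\<zeta>. LINT w|\<mu>. g w * inverse (rho (u + axis last_ix \<zeta>) w) ^ m) \<zeta> = c k * \<phi> k \<zeta>"
    if "\<zeta> \<in> T" for \<zeta>
    using Suc.IH[of \<zeta>] that by (simp add: T_def c_def \<phi>_def)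
  have \<zeta>: "\<zeta> \<in> T" using Suc.prems by (simp add: T_def)
  have "(\<phi> k has_field_derivative of_nat (m + k) * (\<i> / 2) * \<phi> (Suc k) \<zeta>) (at \<zeta>)"
    unfolding \<phi>_def using rho_power_integral_slice_has_field_derivative[OF \<mu> intk Suc.prems, of k] by simp
  then have "((\<lambda>\<zeta>. c k * \<phi> k \<zeta>) has_field_derivative c k * (of_nat (m + k) * (\<i> / 2) * \<phi> (Suc k) \<zeta>)) (at \<zeta>)"
    by (rule DERIV_cmult)
  then have "((deriv ^^ k) (\<lambda>\<zeta>. LINT w|\<mu>. g w * inverse (rho (u + axis last_ix \<zeta>) w) ^ m)
      has_field_derivative c k * (of_nat (m + k) * (\<i> / 2) * \<phi> (Suc k) \<zeta>)) (at \<zeta>)"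
    by (rule has_field_derivative_transform_within_open[OF _ T \<zeta>]) (simp add: IH)
  then have "(deriv ^^ Suc k) (\<lambda>\<zeta>. LINT w|\<mu>. g w * inverse (rho (u + axis last_ix \<zeta>) w) ^ m) \<zeta>
      = c k * (of_nat (m + k) * (\<i> / 2) * \<phi> (Suc k) \<zeta>)"
    by (simp add: DERIV_imp_deriv)
  also have "\<dots> = c (Suc k) * \<phi> (Suc k) \<zeta>" by (simp add: c_def mult_ac)
  finally show ?case by (simp add: c_def \<phi>_def)
qed simp

text \<open>
  Schur's test with the weight \<open>\<rho>\<^bsup>-1/p\<^esup>\<close>; in place of Hoelder's inequality, \<open>x \<le> a + a\<^bsup>1-p\<^esup> x\<^bsup>p\<^esup>\<close> is
  applied with \<open>a = M \<rho>(w)\<^bsup>-1/p\<^esup>\<close> and optimised over \<open>M\<close>.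
\<close>

lemma Schur_test_rho:
  fixes p :: real
  assumes p: "p > 1"
  obtains C where "C > 0" "\<And>(f :: complex ^ 'n::{finite,linorder} \<Rightarrow> complex) h.
    continuous_on siegel f \<Longrightarrow>
    \<forall>z\<in>siegel. 0 \<le> h z \<and> ennreal (h z) \<le>
      (\<integral>\<^sup>+w\<in>siegel. ennreal (cmod (rho z w) powr (- (real CARD('n) + 1)) * cmod (f w)) \<partial>lborel) \<Longrightarrow>
    (\<integral>\<^sup>+z\<in>siegel. ennreal (h z powr p) \<partial>lborel) \<le> ennreal C * pintegral p f"
proof -
  define N where "N = real CARD('n) + 1"
  define \<tau> where "\<tau> = 1 / p"
  have \<tau>: "0 < \<tau>" "\<tau> < 1" using p by (auto simp: \<tau>_def)
  have \<tau>p: "\<tau> * p = 1" "\<tau> * (p - 1) = 1 - \<tau>" using p by (auto simp: \<tau>_def field_simps)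
  \<comment> \<open>The weight with exponent \<open>- \<tau>\<close> is reproduced by the kernel:
    with \<open>s = N\<close> the Forelli-Rudin exponent equals \<open>t\<close>. The conditions on
    \<open>t\<close> and \<open>s\<close> amount to \<open>0 < \<tau> < 1\<close>.\<close>
  obtain A where A: "A > 0" "\<And>z :: (complex, 'n) vec. z \<in> siegel \<Longrightarrow>
      (\<integral>\<^sup>+w\<in>siegel. ennreal (rho_diag w powr (- \<tau>) * cmod (rho z w) powr (- N)) \<partial>lborel)
      \<le> ennreal (A * rho_diag z powr (- \<tau>))"
  proof (rule Forelli_Rudin[of "- \<tau>" N, where 'n = 'n])
    fix C :: real
    assume C: "C > 0" "\<And>z :: (complex, 'n) vec. z \<in> siegel \<Longrightarrow>
      (\<integral>\<^sup>+w\<in>siegel. ennreal (rho_diag w powr (- \<tau>) * cmod (rho z w) powr (- N)) \<partial>lborel)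
      \<le> ennreal (C * rho_diag z powr (real CARD('n) + 1 + - \<tau> - N))"
    show thesis by (rule that[OF C(1)]) (use C(2) in \<open>simp add: N_def\<close>)
  qed (use \<tau> in \<open>auto simp: N_def\<close>)
  \<comment> \<open>The companion weight for the integration over \<open>z\<close>, after Tonelli;
    it cancels the factor \<open>rho_diag w powr (1 - \<tau>)\<close>.\<close>
  obtain A' where A': "A' > 0" "\<And>z :: (complex, 'n) vec. z \<in> siegel \<Longrightarrow>
      (\<integral>\<^sup>+w\<in>siegel. ennreal (rho_diag w powr (\<tau> - 1) * cmod (rho z w) powr (- N)) \<partial>lborel)
      \<le> ennreal (A' * rho_diag z powr (\<tau> - 1))"
  proof (rule Forelli_Rudin[of "\<tau> - 1" N, where 'n = 'n])
    fix C :: real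
    assume C: "C > 0" "\<And>z :: (complex, 'n) vec. z \<in> siegel \<Longrightarrow>
      (\<integral>\<^sup>+w\<in>siegel. ennreal (rho_diag w powr (\<tau> - 1) * cmod (rho z w) powr (- N)) \<partial>lborel)
      \<le> ennreal (C * rho_diag z powr (real CARD('n) + 1 + (\<tau> - 1) - N))"
    show thesis by (rule that[OF C(1)]) (use C(2) in \<open>simp add: N_def\<close>)
  qed (use \<tau> in \<open>auto simp: N_def\<close>)
  define D where "D = (A + 1) powr p"
  have D: "D > 0" using A(1) by (simp add: D_def)
  show ?thesis
  proof (rule that[of "D * A'"])
    show "D * A' > 0" using D A'(1) by simp
    fix f :: "(complex, 'n) vec \<Rightarrow> complex" and h
    assume f: "continuous_on siegel f" and "\<forall>z\<in>siegel. 0 \<le> h z \<and> ennreal (h z) \<le>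
      (\<integral>\<^sup>+w\<in>siegel. ennreal (cmod (rho z w) powr (- (real CARD('n) + 1)) * cmod (f w)) \<partial>lborel)"
    then have h0: "\<And>z. z \<in> siegel \<Longrightarrow> 0 \<le> h z" and h: "\<And>z. z \<in> siegel \<Longrightarrow> ennreal (h z) \<le>
      (\<integral>\<^sup>+w\<in>siegel. ennreal (cmod (rho z w) powr (- N) * cmod (f w)) \<partial>lborel)" unfolding N_def by auto
    define G where "G w = ennreal (cmod (f w) powr p) * indicator siegel w" for w
    have [measurable]: "G \<in> borel_measurable borel"
      unfolding G_def by (rule measurable_norm_powr_on_open[OF f open_siegel])
    define k where "k z w = ennreal (cmod (rho z w) powr (- N))" for z w :: "(complex, 'n) vec"
    have mk: "(\<lambda>x. k (fst x) (snd x)) \<in> borel_measurable (borel \<Otimes>\<^sub>M borel)"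
      unfolding k_def by measurable
    have [measurable]: "k z \<in> borel_measurable borel" for z
      unfolding k_def by measurable
    define Q where "Q z = (\<integral>\<^sup>+w. k z w * (ennreal (rho_diag w powr (1 - \<tau>)) * G w) \<partial>lborel)" for z
    have main: "ennreal (h z powr p) \<le> ennreal (D * rho_diag z powr (\<tau> - 1)) * Q z" if z: "z \<in> siegel" for z
    proof (cases "Q z = \<infinity>")
      case True
      then show ?thesis using D z by (simp add: ennreal_mult_top siegel_iff)
    next
      case False
      then obtain q where q: "Q z = ennreal q" "q \<ge> 0" by (cases "Q z") auto
      define P where "P = rho_diag z"
      have P: "P > 0" using z by (simp add: P_def siegel_iff)
      have hM: "h z \<le> M * (A * P powr (- \<tau>)) + M powr (1 - p) * q" if M: "M > 0" for M
      proof -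
        have "ennreal (h z) \<le> (\<integral>\<^sup>+w\<in>siegel. ennreal (cmod (rho z w) powr (- N) * cmod (f w)) \<partial>lborel)"
          by (rule h[OF z])
        also have "\<dots> \<le> (\<integral>\<^sup>+w. ennreal M * (ennreal (rho_diag w powr (- \<tau>) * cmod (rho z w) powr (- N)) * indicator siegel w)
            + ennreal (M powr (1 - p)) * (k z w * (ennreal (rho_diag w powr (1 - \<tau>)) * G w)) \<partial>lborel)"
        proof (intro nn_integral_mono)
          fix w :: "(complex, 'n) vec"
          show "ennreal (cmod (rho z w) powr (- N) * cmod (f w)) * indicator siegel w
            \<le> ennreal M * (ennreal (rho_diag w powr (- \<tau>) * cmod (rho z w) powr (- N)) * indicator siegel w)
            + ennreal (M powr (1 - p)) * (k z w * (ennreal (rho_diag w powr (1 - \<tau>)) * G w))"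
          proof (cases "w \<in> siegel")
            case w: True
            have R: "rho_diag w > 0" using w by (simp add: siegel_iff)
            define a where "a = M * rho_diag w powr (- \<tau>)"
            have a: "a > 0" using M R by (simp add: a_def)
            have "a powr (1 - p) = M powr (1 - p) * rho_diag w powr (\<tau> * (p - 1))"
              using M R by (simp add: a_def powr_mult powr_powr algebra_simps)
            then have "cmod (f w) \<le> M * rho_diag w powr (- \<tau>) + M powr (1 - p) * rho_diag w powr (1 - \<tau>) * cmod (f w) powr p"
              using le_add_powr[OF norm_ge_zero a, of p "f w"] p by (simp add: a_def \<tau>p)
            then have "cmod (rho z w) powr (- N) * cmod (f w) \<le> cmod (rho z w) powr (- N) *
                (M * rho_diag w powr (- \<tau>) + M powr (1 - p) * rho_diag w powr (1 - \<tau>) * cmod (f w) powr p)"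
              by (intro mult_left_mono) auto
            also have "\<dots> = M * (rho_diag w powr (- \<tau>) * cmod (rho z w) powr (- N))
                + M powr (1 - p) * (cmod (rho z w) powr (- N) * (rho_diag w powr (1 - \<tau>) * cmod (f w) powr p))"
              by (simp add: algebra_simps)
            finally have "ennreal (cmod (rho z w) powr (- N) * cmod (f w)) \<le> ennreal (\<dots>)" by (rule ennreal_leI)
            then show ?thesis using w M by (simp add: k_def G_def ennreal_mult ennreal_plus)
          qed simp
        qed
        also have "\<dots> = ennreal M * (\<integral>\<^sup>+w\<in>siegel. ennreal (rho_diag w powr (- \<tau>) * cmod (rho z w) powr (- N)) \<partial>lborel)
            + ennreal (M powr (1 - p)) * Q z"
          unfolding Q_def by (simp add: nn_integral_add nn_integral_cmult)
        also have "\<dots> \<le> ennreal M * ennreal (A * P powr (- \<tau>)) + ennreal (M powr (1 - p)) * ennreal q"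
          unfolding q(1) P_def by (intro add_right_mono mult_left_mono A(2)[OF z]) simp
        also have "\<dots> = ennreal (M * (A * P powr (- \<tau>)) + M powr (1 - p) * q)"
          using M A(1) q(2) by (simp add: ennreal_mult ennreal_plus)
        finally show ?thesis using M A(1) q(2) by (subst (asm) ennreal_le_iff) auto
      qed
      have "h z powr p \<le> D * P powr (\<tau> - 1) * q"
      proof (cases "q = 0")
        case True
        define b where "b = A * P powr (- \<tau>)"
        have b: "b > 0" using A(1) P by (simp add: b_def)
        \<comment> \<open>For \<open>q = 0\<close> the right-hand side has no positive minimiser;
          small \<open>M\<close> forces the value 0.\<close>
        have "h z = 0"
        proof (rule ccontr)
          assume "h z \<noteq> 0"
          then have hz: "h z > 0" using h0[OF z] by simp
          then have "h z \<le> h z / (2 * b) * b" using hM[of "h z / (2 * b)"] b True by (simp add: b_def)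
          then show False using hz b by simp
        qed
        then show ?thesis using True p by simp
      next
        case False
        then have q0: "q > 0" using q(2) by simp
        \<comment> \<open>Chosen so that \<open>M powr (1 - p) * q\<close> equals
          \<open>M * P powr (- \<tau>)\<close>, which balances the two terms up to the factor
          \<open>A\<close>.\<close>
        define M where "M = (P powr \<tau> * q) powr \<tau>"
        have M: "M > 0" using P q0 by (simp add: M_def)
        have Mp: "M powr p = P powr \<tau> * q" using P q0 by (simp add: M_def powr_powr \<tau>p)
        have "M powr (1 - p) * q = M * (q / M powr p)" using M by (simp add: powr_diff)
        also have "q / M powr p = P powr (- \<tau>)" using P q0 by (simp add: Mp powr_minus field_simps)
        finally have "h z \<le> (A + 1) * (M * P powr (- \<tau>))" using hM[OF M] by (simp add: algebra_simps)
        then have "h z powr p \<le> ((A + 1) * (M * P powr (- \<tau>))) powr p"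
          using h0[OF z] p by (intro powr_mono2) auto
        also have "\<dots> = D * (M powr p * (P powr (- \<tau>)) powr p)"
          using A(1) M P by (simp add: powr_mult D_def)
        also have "M powr p * (P powr (- \<tau>)) powr p = P powr \<tau> * P powr (- 1) * q"
          using P by (simp add: Mp powr_powr \<tau>p)
        also have "P powr \<tau> * P powr (- 1) = P powr (\<tau> - 1)" by (simp only: powr_add [symmetric] diff_conv_add_uminus)
        finally show ?thesis by simp
      qed
      then have "ennreal (h z powr p) \<le> ennreal (D * P powr (\<tau> - 1) * q)" by (rule ennreal_leI)
      also have "\<dots> = ennreal (D * P powr (\<tau> - 1)) * Q z"
        using D q by (simp add: ennreal_mult)
      finally show ?thesis by (simp add: P_def)
    qed
    define H where "H z w = ennreal (rho_diag z powr (\<tau> - 1)) * indicator siegel z *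
        (k z w * (ennreal (rho_diag w powr (1 - \<tau>)) * G w))" for z w
    have mH: "case_prod H \<in> borel_measurable (borel \<Otimes>\<^sub>M borel)"
      unfolding H_def case_prod_unfold using mk by measurable
    have "(\<integral>\<^sup>+z\<in>siegel. ennreal (h z powr p) \<partial>lborel)
        \<le> (\<integral>\<^sup>+z. ennreal D * (\<integral>\<^sup>+w. H z w \<partial>lborel) \<partial>lborel)"
    proof (intro nn_integral_mono)
      fix z :: "(complex, 'n) vec"
      show "ennreal (h z powr p) * indicator siegel z \<le> ennreal D * (\<integral>\<^sup>+w. H z w \<partial>lborel)"
      proof (cases "z \<in> siegel")
        case True
        have "(\<integral>\<^sup>+w. H z w \<partial>lborel) = ennreal (rho_diag z powr (\<tau> - 1)) * Q z"
          unfolding H_def Q_def using True by (simp add: nn_integral_cmult)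
        then show ?thesis using main[OF True] True D by (simp add: ennreal_mult mult.assoc)
      qed simp
    qed
    also have "\<dots> = ennreal D * (\<integral>\<^sup>+z. (\<integral>\<^sup>+w. H z w \<partial>lborel) \<partial>lborel)"
    proof (rule nn_integral_cmult)
      have "case_prod H \<in> borel_measurable (borel \<Otimes>\<^sub>M lborel)"
        using mH by (simp cong: measurable_cong_sets)
      from lborel.borel_measurable_nn_integral[OF this]
      show "(\<lambda>z. \<integral>\<^sup>+w. H z w \<partial>lborel) \<in> borel_measurable lborel" by simp
    qed
    also have "(\<integral>\<^sup>+z. (\<integral>\<^sup>+w. H z w \<partial>lborel) \<partial>lborel) = (\<integral>\<^sup>+w. (\<integral>\<^sup>+z. H z w \<partial>lborel) \<partial>lborel)"
      by (rule lborel_Fubini[OF mH])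
    also have "\<dots> \<le> (\<integral>\<^sup>+w. ennreal A' * G w \<partial>lborel)"
    proof (intro nn_integral_mono)
      fix w :: "(complex, 'n) vec"
      show "(\<integral>\<^sup>+z. H z w \<partial>lborel) \<le> ennreal A' * G w"
      proof (cases "w \<in> siegel")
        case w: True
        have R: "rho_diag w > 0" using w by (simp add: siegel_iff)
        have "(\<integral>\<^sup>+z. H z w \<partial>lborel) = (\<integral>\<^sup>+z. (ennreal (rho_diag w powr (1 - \<tau>)) * G w) *
            (ennreal (rho_diag z powr (\<tau> - 1) * cmod (rho w z) powr (- N)) * indicator siegel z) \<partial>lborel)"
          by (intro nn_integral_cong) (simp add: H_def k_def ennreal_mult cmod_rho_commute[of w] mult_ac)
        also have "\<dots> = (ennreal (rho_diag w powr (1 - \<tau>)) * G w) *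
            (\<integral>\<^sup>+z\<in>siegel. ennreal (rho_diag z powr (\<tau> - 1) * cmod (rho w z) powr (- N)) \<partial>lborel)"
          by (rule nn_integral_cmult) measurable
        also have "\<dots> \<le> (ennreal (rho_diag w powr (1 - \<tau>)) * G w) * ennreal (A' * rho_diag w powr (\<tau> - 1))"
          by (intro mult_left_mono A'(2)[OF w]) simp
        also have "\<dots> = ennreal (A' * (rho_diag w powr (1 - \<tau>) * rho_diag w powr (\<tau> - 1))) * G w"
          using A'(1) by (simp add: ennreal_mult mult_ac)
        also have "rho_diag w powr (1 - \<tau>) * rho_diag w powr (\<tau> - 1) = 1"
          using R by (simp flip: powr_add)
        finally show ?thesis by simp
      qed (simp add: H_def G_def)
    qed
    also have "(\<integral>\<^sup>+w. ennreal A' * G w \<partial>lborel) = ennreal A' * pintegral p f"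
      by (simp add: nn_integral_cmult pintegral_def G_def[symmetric])
    finally show "(\<integral>\<^sup>+z\<in>siegel. ennreal (h z powr p) \<partial>lborel) \<le> ennreal (D * A') * pintegral p f"
      using D A'(1) by (simp add: ennreal_mult mult_left_mono mult.assoc)
  qed
qed

section \<open>Toeplitz operators\<close>

text \<open>\<open>bergman_norm\<close> passes through \<open>enn2real\<close>, which sends infinity
  to 0. Membership of both functions in the Bergman space excludes that case, and taking p-th powers
  gives a form suited to nonnegative integrals.\<close>

lemma toeplitz_bounded_iff_pintegral:
  fixes p :: real and \<mu> :: "(complex ^ 'n::{finite,linorder}) measure"
  assumes p: "p > 0"
  shows "toeplitz_bounded p \<mu> \<longleftrightarrow> (\<exists>C>0. \<forall>f \<in> toeplitz_domain p \<mu>.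
    toeplitz \<mu> f \<in> bergman_space p \<and> pintegral p (toeplitz \<mu> f) \<le> ennreal C * pintegral p f)"
proof
  assume "toeplitz_bounded p \<mu>"
  then obtain C where C: "\<And>f. f \<in> toeplitz_domain p \<mu> \<Longrightarrow>
      toeplitz \<mu> f \<in> bergman_space p \<and> bergman_norm p (toeplitz \<mu> f) \<le> C * bergman_norm p f"
    unfolding toeplitz_bounded_def by blast
  define D where "D = (\<bar>C\<bar> + 1) powr p"
  have "pintegral p (toeplitz \<mu> f) \<le> ennreal D * pintegral p f" if f: "f \<in> toeplitz_domain p \<mu>" for f
  proof -
    obtain x where x: "pintegral p f = ennreal x" "x \<ge> 0"
      using f unfolding toeplitz_domain_def bergman_space_def by (cases "pintegral p f") auto
    obtain y where y: "pintegral p (toeplitz \<mu> f) = ennreal y" "y \<ge> 0"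
      using C[OF f] unfolding bergman_space_def by (cases "pintegral p (toeplitz \<mu> f)") auto
    have "y powr (1 / p) \<le> C * x powr (1 / p)"
      using C[OF f] x y by (simp add: bergman_norm_def)
    also have "\<dots> \<le> (\<bar>C\<bar> + 1) * x powr (1 / p)" by (intro mult_right_mono) auto
    finally have "(y powr (1 / p)) powr p \<le> ((\<bar>C\<bar> + 1) * x powr (1 / p)) powr p"
      using p by (intro powr_mono2) auto
    then have "y \<le> D * x" using p x(2) y(2) by (simp add: powr_powr powr_mult D_def)
    then show ?thesis using x y by (simp add: D_def flip: ennreal_mult)
  qed
  then show "\<exists>C>0. \<forall>f \<in> toeplitz_domain p \<mu>.
    toeplitz \<mu> f \<in> bergman_space p \<and> pintegral p (toeplitz \<mu> f) \<le> ennreal C * pintegral p f"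
    using C by (intro exI[of _ D]) (simp add: D_def)
next
  assume "\<exists>C>0. \<forall>f \<in> toeplitz_domain p \<mu>.
    toeplitz \<mu> f \<in> bergman_space p \<and> pintegral p (toeplitz \<mu> f) \<le> ennreal C * pintegral p f"
  then obtain C where C: "C > 0" "\<And>f. f \<in> toeplitz_domain p \<mu> \<Longrightarrow>
      toeplitz \<mu> f \<in> bergman_space p \<and> pintegral p (toeplitz \<mu> f) \<le> ennreal C * pintegral p f"
    by blast
  have "bergman_norm p (toeplitz \<mu> f) \<le> C powr (1 / p) * bergman_norm p f" if f: "f \<in> toeplitz_domain p \<mu>" for f
  proof -
    obtain x where x: "pintegral p f = ennreal x" "x \<ge> 0"
      using f unfolding toeplitz_domain_def bergman_space_def by (cases "pintegral p f") auto
    obtain y where y: "pintegral p (toeplitz \<mu> f) = ennreal y" "y \<ge> 0"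
      using C(2)[OF f] unfolding bergman_space_def by (cases "pintegral p (toeplitz \<mu> f)") auto
    have "y \<le> C * x" using C(2)[OF f] C(1) x y by (simp flip: ennreal_mult)
    then have "y powr (1 / p) \<le> (C * x) powr (1 / p)" using p y by (intro powr_mono2) auto
    then show ?thesis using C(1) x y by (simp add: bergman_norm_def powr_mult)
  qed
  then show "toeplitz_bounded p \<mu>" unfolding toeplitz_bounded_def using C(2) by blast
qed

section \<open>The Toeplitz operator as a kernel integral\<close>

definition kernel_const :: "'n::finite itself \<Rightarrow> real" where
  "kernel_const TYPE('n) = fact CARD('n) / (4 * pi ^ CARD('n))"

lemma kernel_const_pos: "kernel_const TYPE('n::finite) > 0"
  by (simp add: kernel_const_def)

lemma bergman_kernel_mult:
  fixes z :: "complex ^ 'n::{finite,linorder}"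
  shows "bergman_kernel z w * x = complex_of_real (kernel_const TYPE('n)) * (x * inverse (rho z w) ^ (CARD('n) + 1))"
  by (simp add: bergman_kernel_alt kernel_const_def)

lemma toeplitz_eq:
  fixes z :: "complex ^ 'n::{finite,linorder}"
  shows "toeplitz \<mu> f z = complex_of_real (kernel_const TYPE('n)) * (LINT w|\<mu>. f w * inverse (rho z w) ^ (CARD('n) + 1))"
  unfolding toeplitz_def bergman_kernel_mult by (rule integral_mult_right_zero)

lemma integrable_bergman_kernel_iff:
  fixes z :: "complex ^ 'n::{finite,linorder}"
  shows "integrable \<mu> (\<lambda>w. bergman_kernel z w * f w) \<longleftrightarrow> integrable \<mu> (\<lambda>w. f w * inverse (rho z w) ^ (CARD('n) + 1))"
proof -
  let ?h = "\<lambda>w. f w * inverse (rho z w) ^ (CARD('n) + 1)" and ?c = "complex_of_real (kernel_const TYPE('n))"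
  have "?c \<noteq> 0" using kernel_const_pos[where 'n = 'n] by simp
  then have eq: "(\<lambda>w. inverse ?c * (?c * ?h w)) = ?h" by (simp add: fun_eq_iff)
  show ?thesis
    unfolding bergman_kernel_mult
    using integrable_mult_right[of ?c \<mu> ?h] integrable_mult_right[of "inverse ?c" \<mu> "\<lambda>w. ?c * ?h w"]
    unfolding eq by blast
qed

text \<open>Absolute convergence at every point, built into the domain, is the hypothesis for
  differentiation under the integral. Holomorphy is thus known before boundedness, and serves both
  directions.\<close>

lemma holomorphic_vec_toeplitz:
  fixes \<mu> :: "(complex ^ 'n::{finite,linorder}) measure"
  assumes \<mu>: "\<mu> \<in> M_plus" and f: "f \<in> toeplitz_domain p \<mu>"
  shows "holomorphic_vec (toeplitz \<mu> f) siegel"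
proof -
  have "holomorphic_vec (\<lambda>z. LINT w|\<mu>. f w * inverse (rho z w) ^ (CARD('n) + 1)) siegel"
    using f by (intro holomorphic_vec_rho_power_integral[OF \<mu>])
      (simp add: toeplitz_domain_def integrable_bergman_kernel_iff del: power_Suc)
  moreover have "holomorphic_vec (\<lambda>z. complex_of_real (kernel_const TYPE('n))) siegel"
    unfolding holomorphic_vec_def by (intro ballI exI[of _ "\<lambda>_. 0"]) simp
  ultimately show ?thesis
    using holomorphic_vec_mult unfolding toeplitz_eq[abs_def] by blast
qed

lemma toeplitz_bounded_of_averaging:
  fixes \<mu> :: "(complex ^ 'n::{finite,linorder}) measure" and p r :: real
  assumes \<mu>: "\<mu> \<in> M_plus" and r: "r > 0" and p: "p > 1"
    and bdd: "bounded_on_siegel (averaging \<mu> r)"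
  shows "toeplitz_bounded p \<mu>"
proof -
  let ?c = "kernel_const TYPE('n)" and ?N = "CARD('n) + 1"
  have c: "?c > 0" by (rule kernel_const_pos)
  have one: "(1::real) > 0" by simp
  obtain K where K: "K > 0" "\<And>f. holomorphic_vec f siegel \<Longrightarrow>
      (\<integral>\<^sup>+z. ennreal (cmod (f z) powr 1) \<partial>\<mu>) \<le> ennreal K * pintegral 1 f"
    by (rule carleson_of_bounded_averaging[OF \<mu> r one bdd]) (rule that)
  obtain S where S: "S > 0" "\<And>(f :: (complex, 'n) vec \<Rightarrow> complex) h.
    continuous_on siegel f \<Longrightarrow>
    \<forall>z\<in>siegel. 0 \<le> h z \<and> ennreal (h z) \<le>
      (\<integral>\<^sup>+w\<in>siegel. ennreal (cmod (rho z w) powr (- (real CARD('n) + 1)) * cmod (f w)) \<partial>lborel) \<Longrightarrow>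
    (\<integral>\<^sup>+z\<in>siegel. ennreal (h z powr p) \<partial>lborel) \<le> ennreal S * pintegral p f"
    by (rule Schur_test_rho[OF p, where 'n = 'n]) (rule that)
  define D where "D = (?c * K) powr p * S"
  have cK: "?c * K > 0" using c K(1) by simp
  have cKp: "(?c * K) powr p > 0" unfolding powr_gt_zero using cK by linarith
  then have D: "D > 0" using S(1) unfolding D_def by (rule mult_pos_pos)
  have "toeplitz \<mu> f \<in> bergman_space p \<and> pintegral p (toeplitz \<mu> f) \<le> ennreal D * pintegral p f"
    if f: "f \<in> toeplitz_domain p \<mu>" for f
  proof -
    have fb: "holomorphic_vec f siegel" "pintegral p f < \<infinity>"
      and int: "\<And>z. z \<in> siegel \<Longrightarrow> integrable \<mu> (\<lambda>w. f w * inverse (rho z w) ^ ?N)"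
      using f unfolding toeplitz_domain_def bergman_space_def by (auto simp: integrable_bergman_kernel_iff simp del: power_Suc)
    \<comment> \<open>Normalised by the kernel and Carleson constants so that the hypothesis of
      Schur's test holds with constant 1.\<close>
    define h where "h z = cmod (toeplitz \<mu> f z) / (?c * K)" for z
    have hk: "ennreal (h z) \<le> (\<integral>\<^sup>+w\<in>siegel. ennreal (cmod (rho z w) powr (- (real CARD('n) + 1)) * cmod (f w)) \<partial>lborel)"
      if z: "z \<in> siegel" for z
    proof -
      let ?G = "\<integral>\<^sup>+w\<in>siegel. ennreal (cmod (rho z w) powr (- (real CARD('n) + 1)) * cmod (f w)) \<partial>lborel"
      \<comment> \<open>As a function of \<open>w\<close>, \<open>rho z w\<close> is
        antiholomorphic; its conjugate \<open>rho w z\<close> has the same modulus and yields a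
        holomorphic product to which the Carleson inequality applies.\<close>
      have hol: "holomorphic_vec (\<lambda>w. f w * inverse (rho w z) ^ ?N) siegel"
        by (intro holomorphic_vec_mult fb holomorphic_vec_rho_power z)
      have eq: "pintegral 1 (\<lambda>w. f w * inverse (rho w z) ^ ?N) = ?G"
        unfolding pintegral_def
      proof (intro nn_integral_cong)
        fix w :: "(complex, 'n) vec"
        show "ennreal (cmod (f w * inverse (rho w z) ^ ?N) powr 1) * indicator siegel w
          = ennreal (cmod (rho z w) powr (- (real CARD('n) + 1)) * cmod (f w)) * indicator siegel w"
        proof (cases "w \<in> siegel")
          case True
          have "cmod (inverse (rho w z) ^ ?N) = cmod (rho z w) powr (- (real CARD('n) + 1))"
            using cmod_inverse_power_powr[OF rho_nonzero[OF True z], of ?N 1] cmod_rho_commute[of w z]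
            by (simp add: add.commute del: power_Suc)
          then show ?thesis by (simp add: norm_mult mult.commute del: power_Suc)
        qed simp
      qed
      have "ennreal (cmod (LINT w|\<mu>. f w * inverse (rho z w) ^ ?N))
          \<le> (\<integral>\<^sup>+w. ennreal (cmod (f w * inverse (rho z w) ^ ?N)) \<partial>\<mu>)"
        by (rule integral_norm_bound_ennreal[OF int[OF z]])
      also have "\<dots> = (\<integral>\<^sup>+w. ennreal (cmod (f w * inverse (rho w z) ^ ?N) powr 1) \<partial>\<mu>)"
        by (simp add: norm_mult norm_power norm_inverse cmod_rho_commute[of z])
      also have "\<dots> \<le> ennreal K * ?G"
        using K(2)[OF hol] unfolding eq .
      finally have 1: "ennreal (cmod (LINT w|\<mu>. f w * inverse (rho z w) ^ ?N)) \<le> ennreal K * ?G" .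
      have "h z = inverse K * cmod (LINT w|\<mu>. f w * inverse (rho z w) ^ ?N)"
        unfolding h_def toeplitz_eq norm_mult using c K(1) by (simp add: field_simps del: power_Suc)
      then have "ennreal (h z) = ennreal (inverse K) * ennreal (cmod (LINT w|\<mu>. f w * inverse (rho z w) ^ ?N))"
        using K(1) by (simp add: ennreal_mult del: power_Suc)
      also have "\<dots> \<le> ennreal (inverse K) * (ennreal K * ?G)" by (intro mult_left_mono 1) simp
      also have "\<dots> = ?G"
      proof -
        have "ennreal (inverse K) * ennreal K = 1" using K(1) by (simp flip: ennreal_mult)
        then show ?thesis by (simp only: mult.assoc[symmetric] mult_1)
      qed
      finally show ?thesis .
    qed
    have h0: "0 \<le> h z" for z using cK by (simp add: h_def)
    note mS = measurable_norm_powr_on_open[OF holomorphic_vec_imp_continuous_on[OF holomorphic_vec_toeplitz[OF \<mu> f]] open_siegel, of p]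
    have hp: "cmod (toeplitz \<mu> f z) powr p = (?c * K) powr p * h z powr p" for z
    proof -
      have "cmod (toeplitz \<mu> f z) = (?c * K) * h z"
        unfolding h_def using less_imp_neq[OF cK] by (metis nonzero_mult_div_cancel_left times_divide_eq_right)
      then show ?thesis using cK h0[of z] by (simp add: powr_mult)
    qed
    have hp': "h z powr p = inverse ((?c * K) powr p) * cmod (toeplitz \<mu> f z) powr p" for z
      unfolding hp using less_imp_neq[OF cKp] by simp
    have "pintegral p (toeplitz \<mu> f)
        = (\<integral>\<^sup>+z. ennreal ((?c * K) powr p) * (ennreal (h z powr p) * indicator siegel z) \<partial>lborel)"
      unfolding pintegral_def hp by (simp add: ennreal_mult mult.assoc)
    also have "\<dots> = ennreal ((?c * K) powr p) * (\<integral>\<^sup>+z\<in>siegel. ennreal (h z powr p) \<partial>lborel)"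
    proof (rule nn_integral_cmult)
      have "(\<lambda>z. ennreal (inverse ((?c * K) powr p)) * (ennreal (cmod (toeplitz \<mu> f z) powr p) * indicator siegel z)) \<in> borel_measurable borel"
        using mS by measurable
      then show "(\<lambda>z. ennreal (h z powr p) * indicator siegel z) \<in> borel_measurable lborel"
        by (simp only: hp' ennreal_mult''[OF powr_ge_zero] mult.assoc measurable_lborel2)
    qed
    also have "\<dots> \<le> ennreal ((?c * K) powr p) * (ennreal S * pintegral p f)"
      using h0 hk by (intro mult_left_mono S(2)[OF holomorphic_vec_imp_continuous_on[OF fb(1)]]) auto
    also have "\<dots> = ennreal D * pintegral p f"
      using S(1) by (simp add: D_def ennreal_mult mult.assoc)
    finally have le: "pintegral p (toeplitz \<mu> f) \<le> ennreal D * pintegral p f" .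
    also have "\<dots> < \<infinity>" using fb(2) by (simp add: ennreal_mult_less_top)
    finally show ?thesis
      using le holomorphic_vec_toeplitz[OF \<mu> f] by (simp add: bergman_space_def)
  qed
  then show ?thesis using D p by (subst toeplitz_bounded_iff_pintegral) auto
qed

text \<open>For fixed \<open>z\<close> the kernel is bounded in \<open>w\<close>, and the test
  function is at most a multiple of the m-th inverse power of the modulus of
  \<open>w $ last_ix + \<i>\<close>. That modulus is at least 1, so \<open>m \<ge> \<alpha>\<close>
  brings the integrand below the weight of the growth condition.\<close>

lemma rho_power_in_toeplitz_domain:
  fixes \<mu> :: "(complex ^ 'n::{finite,linorder}) measure"
  assumes \<mu>: "\<mu> \<in> M_plus" and fin: "(\<integral>\<^sup>+ z. ennreal (cmod (z $ last_ix + \<i>) powr (- \<alpha>)) \<partial>\<mu>) < \<infinity>"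
    and m: "real m \<ge> \<alpha>" "real m * p > real CARD('n) + 1" and u: "u \<in> siegel"
  shows "(\<lambda>w. inverse (rho w u) ^ m) \<in> toeplitz_domain p \<mu>"
proof -
  have "integrable \<mu> (\<lambda>w. inverse (rho w u) ^ m * inverse (rho z w) ^ (CARD('n) + 1))" if z: "z \<in> siegel" for z
  proof (rule integrableI_bounded)
    have [measurable]: "(\<lambda>w. rho w u) \<in> borel_measurable borel" by measurable
    have "(\<lambda>w. inverse (rho w u) ^ m * inverse (rho z w) ^ (CARD('n) + 1)) \<in> borel_measurable borel" by measurable
    then show "(\<lambda>w. inverse (rho w u) ^ m * inverse (rho z w) ^ (CARD('n) + 1)) \<in> borel_measurable \<mu>"
      by (rule M_plus_measurable[OF \<mu>])
    obtain C where C: "C > 0" "\<And>w. w \<in> siegel \<Longrightarrow> cmod (rho base_point w) \<le> C * cmod (rho u w)"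
      by (rule cmod_rho_compare[OF u, of base_point]) (rule that)
    define B where "B = (2 / rho_diag z) ^ (CARD('n) + 1) * (2 * C) ^ m"
    have zp: "rho_diag z > 0" using z by (simp add: siegel_iff)
    have B: "B \<ge> 0" using zp C(1) by (simp add: B_def)
    have "(\<integral>\<^sup>+w. ennreal (norm (inverse (rho w u) ^ m * inverse (rho z w) ^ (CARD('n) + 1))) \<partial>\<mu>)
        \<le> (\<integral>\<^sup>+w. ennreal B * ennreal (cmod (w $ last_ix + \<i>) powr (- \<alpha>)) \<partial>\<mu>)"
    proof (rule nn_integral_mono)
      fix w assume "w \<in> space \<mu>"
      then have w: "w \<in> siegel" by (simp add: M_plus_space[OF \<mu>])
      define x where "x = cmod (w $ last_ix + \<i>)"
      have x: "x \<ge> 1" unfolding x_def by (rule cmod_last_plus_i_ge_1[OF w])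
      have Rz: "cmod (rho z w) > 0" and Ru: "cmod (rho w u) > 0"
        using cmod_rho_pos[OF z w] cmod_rho_pos[OF w u] by auto
      have "x = 2 * cmod (rho base_point w)"
        unfolding x_def cmod_rho_commute[of base_point] rho_base_point by (simp add: norm_mult)
      then have "x \<le> 2 * C * cmod (rho w u)" using C(2)[OF w] cmod_rho_commute[of w u] by simp
      then have 1: "inverse (cmod (rho w u)) \<le> 2 * C * inverse x" using x Ru by (simp add: field_simps)
      have 2: "inverse (cmod (rho z w)) \<le> 2 / rho_diag z"
        using rho_diag_le[OF z w] zp Rz by (simp add: field_simps)
      have "norm (inverse (rho w u) ^ m * inverse (rho z w) ^ (CARD('n) + 1))
          = inverse (cmod (rho w u)) ^ m * inverse (cmod (rho z w)) ^ (CARD('n) + 1)"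
        by (simp only: norm_mult norm_power norm_inverse)
      also have "\<dots> \<le> (2 * C * inverse x) ^ m * (2 / rho_diag z) ^ (CARD('n) + 1)"
        using 1 2 Ru Rz x C(1) by (intro mult_mono power_mono zero_le_power) auto
      also have "\<dots> = B * inverse x ^ m" by (simp add: B_def power_mult_distrib mult_ac del: power_Suc)
      also have "inverse x ^ m = x powr (- real m)" using x by (simp add: powr_minus powr_realpow power_inverse)
      also have "B * x powr (- real m) \<le> B * x powr (- \<alpha>)"
        using x m(1) B by (intro mult_left_mono powr_mono) auto
      finally show "ennreal (norm (inverse (rho w u) ^ m * inverse (rho z w) ^ (CARD('n) + 1)))
          \<le> ennreal B * ennreal (cmod (w $ last_ix + \<i>) powr (- \<alpha>))"
        using B by (simp add: x_def ennreal_leI flip: ennreal_mult)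
    qed
    also have "\<dots> = ennreal B * (\<integral>\<^sup>+w. ennreal (cmod (w $ last_ix + \<i>) powr (- \<alpha>)) \<partial>\<mu>)"
    proof (rule nn_integral_cmult)
      have [measurable]: "(\<lambda>z. z $ last_ix + \<i>) \<in> borel_measurable (borel :: (complex, 'n) vec measure)"
        by (intro borel_measurable_continuous_onI continuous_intros)
      show "(\<lambda>w. ennreal (cmod (w $ last_ix + \<i>) powr (- \<alpha>))) \<in> borel_measurable \<mu>"
        by (rule M_plus_measurable[OF \<mu>]) measurable
    qed
    also have "\<dots> < \<infinity>" using fin by (simp add: ennreal_mult_less_top)
    finally show "(\<integral>\<^sup>+w. ennreal (norm (inverse (rho w u) ^ m * inverse (rho z w) ^ (CARD('n) + 1))) \<partial>\<mu>) < \<infinity>" .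
  qed
  then show ?thesis
    using rho_power_in_bergman_space[OF m(2) u]
    by (simp add: toeplitz_domain_def integrable_bergman_kernel_iff del: power_Suc)
qed

text \<open>
  Testing on \<open>f(w) = rho(w,u)\<^bsup>-m\<^esup>\<close> with \<open>m = n + 1 + k\<close> large enough for \<open>f\<close> to lie in the domain, the
  \<open>k\<close>-th derivative of \<open>T\<^sub>\<mu> f\<close> in the last coordinate at \<open>u\<close> is a multiple of the positive integral
  \<open>\<integral> \<bar>rho(u,w)\<bar>\<^bsup>-2m\<^esup> d\<mu>(w)\<close>; Cauchy's estimate bounds it by the norm of \<open>T\<^sub>\<mu> f\<close>.
\<close>

lemma bounded_averaging_of_toeplitz:
  fixes \<mu> :: "(complex ^ 'n::{finite,linorder}) measure" and p r :: real
  assumes \<mu>: "\<mu> \<in> M_plus" and r: "r > 0" and p: "p > 1" and bdd: "toeplitz_bounded p \<mu>"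
  shows "bounded_on_siegel (averaging \<mu> r)"
proof -
  let ?c = "kernel_const TYPE('n)"
  define N where "N = CARD('n) + 1"
  have c: "?c > 0" by (rule kernel_const_pos)
  have p0: "p > 0" using p by simp
  obtain T where T: "T > 0" "\<And>f. f \<in> toeplitz_domain p \<mu> \<Longrightarrow>
      toeplitz \<mu> f \<in> bergman_space p \<and> pintegral p (toeplitz \<mu> f) \<le> ennreal T * pintegral p f"
    using bdd unfolding toeplitz_bounded_iff_pintegral[OF p0] by blast
  obtain \<alpha> where \<alpha>: "(\<integral>\<^sup>+ z. ennreal (cmod (z $ last_ix + \<i>) powr (- \<alpha>)) \<partial>\<mu>) < \<infinity>"
    using \<mu> unfolding M_plus_def by auto
  obtain k :: nat where k: "\<alpha> \<le> real k" using real_arch_simple by blast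
  define m where "m = N + k"
  have m\<alpha>: "\<alpha> \<le> real m" using k by (simp add: m_def)
  have mp: "real m * p > real CARD('n) + 1"
  proof -
    have "real CARD('n) + 1 < (real CARD('n) + 1) * p" using p by simp
    also have "\<dots> \<le> real m * p" using p by (intro mult_right_mono) (auto simp: m_def N_def)
    finally show ?thesis .
  qed
  obtain F where F: "F > 0" "\<And>u :: (complex, 'n) vec. u \<in> siegel \<Longrightarrow>
    pintegral p (\<lambda>w. inverse (rho w u) ^ m) \<le> ennreal (F * rho_diag u powr (real CARD('n) + 1 - real m * p))"
    by (rule rho_power_pintegral[OF mp]) (rule that)
  have one: "(1::real) > 0" by simp
  obtain M where M: "M > 0"
    "\<And>(f :: (complex, 'n) vec \<Rightarrow> complex) z. holomorphic_vec f siegel \<Longrightarrow> z \<in> siegel \<Longrightarrow>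
       ennreal (cmod (f z) powr p * rho_diag z ^ (CARD('n) + 1))
       \<le> ennreal M * (\<integral>\<^sup>+w\<in>bergman_ball z 1. ennreal (cmod (f w) powr p) \<partial>lborel)"
    by (rule powr_mean_value_bergman_ball[OF one p0, where 'n = 'n]) (rule that)
  \<comment> \<open>\<open>M\<close> comes from the mean value inequality, \<open>T\<close> from
    boundedness, \<open>F\<close> from the size of the test function, and the power of 2 from
    replacing \<open>rho_diag z\<close> by \<open>R / 2\<close>.\<close>
  define E where "E = (M * T * F * 2 powr real N) powr (1 / p)"
  have MTF: "M * T * F * 2 powr real N > 0" using M(1) T(1) F(1) by simp
  have E: "E > 0" unfolding E_def powr_gt_zero using MTF by linarith
  \<comment> \<open>The coefficient produced by \<open>k\<close> differentiations; it is nonzero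
    because \<open>N > 0\<close>, so it can be divided out.\<close>
  define P where "P = cmod (\<Prod>j<k. of_nat (N + j) * (\<i> / 2))"
  have "N > 0" by (simp add: N_def)
  then have P: "P > 0" by (simp add: P_def del: of_nat_add)
  define C where "C = fact k * E * 2 ^ k / (?c * P)"
  have C: "C > 0" using E c P by (simp add: C_def)
  show ?thesis
  proof (rule bounded_averaging_of_kernel_bound[OF \<mu> r _ C, of "real (2 * m)"])
    fix u :: "(complex, 'n) vec" assume u: "u \<in> siegel"
    define R where "R = rho_diag u"
    have R: "R > 0" using u by (simp add: R_def siegel_iff)
    define f where "f = (\<lambda>w. inverse (rho w u) ^ m)"
    have f: "f \<in> toeplitz_domain p \<mu>"
      unfolding f_def by (rule rho_power_in_toeplitz_domain[OF \<mu> \<alpha> m\<alpha> mp u])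
    then have int: "integrable \<mu> (\<lambda>w. f w * inverse (rho z w) ^ N)" if "z \<in> siegel" for z
      using that by (simp add: toeplitz_domain_def integrable_bergman_kernel_iff N_def del: power_Suc)
    define g where "g z = (LINT w|\<mu>. f w * inverse (rho z w) ^ N)" for z
    have Tg: "toeplitz \<mu> f z = complex_of_real ?c * g z" for z by (simp only: toeplitz_eq g_def N_def)
    have rd: "rho_diag (u + axis last_ix \<zeta>) = R + Im \<zeta>" for \<zeta>
    proof -
      have "hnorm (u + axis last_ix \<zeta>) = hnorm u" by (simp add: hnorm_def axis_def)
      then show ?thesis by (simp add: R_def rho_diag_def)
    qed
    \<comment> \<open>Moving the last coordinate within this closed disc costs at most half of
      \<open>rho_diag\<close>; Cauchy's estimate on it yields the factor \<open>2 ^ k\<close> in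
      \<open>C\<close>.\<close>
    have in_siegel: "R / 2 \<le> rho_diag (u + axis last_ix \<zeta>)" "u + axis last_ix \<zeta> \<in> siegel" if "cmod \<zeta> \<le> R / 2" for \<zeta>
    proof -
      show "R / 2 \<le> rho_diag (u + axis last_ix \<zeta>)" using that abs_Im_le_cmod[of \<zeta>] unfolding rd by linarith
      then show "u + axis last_ix \<zeta> \<in> siegel" using R unfolding siegel_iff by linarith
    qed
    have eval: "cmod (toeplitz \<mu> f z) \<le> E * R powr (- real m)" if z: "z \<in> siegel" and zR: "R / 2 \<le> rho_diag z" for z
    proof -
      have "ennreal (cmod (toeplitz \<mu> f z) powr p * rho_diag z ^ N)
          \<le> ennreal M * (\<integral>\<^sup>+w\<in>bergman_ball z 1. ennreal (cmod (toeplitz \<mu> f w) powr p) \<partial>lborel)"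
        unfolding N_def by (rule M(2)[OF holomorphic_vec_toeplitz[OF \<mu> f] z])
      also have "\<dots> \<le> ennreal M * pintegral p (toeplitz \<mu> f)"
        unfolding pintegral_def
        by (intro mult_left_mono nn_integral_mono) (auto simp: indicator_def bergman_ball_def)
      also have "\<dots> \<le> ennreal M * (ennreal T * ennreal (F * R powr (real CARD('n) + 1 - real m * p)))"
      proof (rule mult_left_mono)
        have "pintegral p (toeplitz \<mu> f) \<le> ennreal T * pintegral p f" using T(2)[OF f] by simp
        also have "\<dots> \<le> ennreal T * ennreal (F * R powr (real CARD('n) + 1 - real m * p))"
          using F(2)[OF u] unfolding f_def[symmetric] R_def by (rule mult_left_mono) simp
        finally show "pintegral p (toeplitz \<mu> f) \<le> ennreal T * ennreal (F * R powr (real CARD('n) + 1 - real m * p))" .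
      qed simp
      also have "\<dots> = ennreal (M * T * F * R powr (real N - real m * p))"
        using M(1) T(1) F(1) by (simp add: N_def mult.assoc add.commute flip: ennreal_mult)
      finally have "cmod (toeplitz \<mu> f z) powr p * rho_diag z ^ N \<le> M * T * F * R powr (real N - real m * p)"
        using M(1) T(1) F(1) by (subst (asm) ennreal_le_iff) auto
      moreover have "cmod (toeplitz \<mu> f z) powr p * (R / 2) ^ N \<le> cmod (toeplitz \<mu> f z) powr p * rho_diag z ^ N"
        using zR R by (intro mult_left_mono power_mono) auto
      ultimately have "cmod (toeplitz \<mu> f z) powr p * (R / 2) ^ N \<le> M * T * F * R powr (real N - real m * p)"
        by linarith
      moreover have "(R / 2) ^ N = R powr real N / 2 powr real N"
        using R by (simp add: powr_realpow power_divide)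
      moreover have "R powr (real N - real m * p) = R powr real N * R powr (- (real m * p))"
        by (simp flip: powr_add)
      ultimately have "cmod (toeplitz \<mu> f z) powr p * (R powr real N / 2 powr real N) \<le> M * T * F * (R powr real N * R powr (- (real m * p)))"
        by simp
      then have "cmod (toeplitz \<mu> f z) powr p \<le> M * T * F * 2 powr real N * R powr (- (real m * p))"
        using R by (simp add: field_simps)
      then have "(cmod (toeplitz \<mu> f z) powr p) powr (1 / p) \<le> (M * T * F * 2 powr real N * R powr (- (real m * p))) powr (1 / p)"
        using p by (intro powr_mono2) auto
      also have "\<dots> = E * (R powr (- (real m * p))) powr (1 / p)"
        using MTF by (simp add: powr_mult E_def)
      also have "(R powr (- (real m * p))) powr (1 / p) = R powr (- real m)"
        using p by (simp add: powr_powr)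
      also have "(cmod (toeplitz \<mu> f z) powr p) powr (1 / p) = cmod (toeplitz \<mu> f z)"
        using p by (simp add: powr_powr)
      finally show ?thesis .
    qed
    define \<phi> where "\<phi> \<zeta> = g (u + axis last_ix \<zeta>)" for \<zeta>
    have diff: "\<phi> field_differentiable (at \<zeta>)" if "cmod \<zeta> \<le> R / 2" for \<zeta>
      using rho_power_integral_slice_has_field_derivative[OF \<mu> int in_siegel(2)[OF that]]
      unfolding \<phi>_def[abs_def] g_def[abs_def] field_differentiable_def by blast
    have "cmod ((deriv ^^ k) \<phi> 0) \<le> fact k * (E * R powr (- real m) / ?c) / (R / 2) ^ k"
    proof (rule Cauchy_inequality)
      show "\<phi> holomorphic_on ball 0 (R / 2)"
        unfolding holomorphic_on_def by (auto intro!: field_differentiable_at_within[OF diff])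
      show "continuous_on (cball 0 (R / 2)) \<phi>"
        by (intro continuous_at_imp_continuous_on ballI field_differentiable_imp_continuous_at diff) simp
      show "0 < R / 2" using R by simp
      fix \<zeta> :: complex assume "cmod (0 - \<zeta>) = R / 2"
      then have z: "cmod \<zeta> \<le> R / 2" by simp
      have "?c * cmod (\<phi> \<zeta>) \<le> E * R powr (- real m)"
        using eval[OF in_siegel(2)[OF z] in_siegel(1)[OF z]] c by (simp add: Tg norm_mult \<phi>_def)
      then show "cmod (\<phi> \<zeta>) \<le> E * R powr (- real m) / ?c" using c by (simp add: field_simps)
    qed
    also have "(deriv ^^ k) \<phi> 0 = (\<Prod>j<k. of_nat (N + j) * (\<i> / 2)) * (LINT w|\<mu>. f w * inverse (rho u w) ^ (N + k))"
    proof -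
      have a0: "axis last_ix 0 = (0 :: (complex, 'n) vec)" by (simp add: vec_eq_iff axis_def)
      have "u + axis last_ix 0 \<in> siegel" using u by (simp add: a0)
      from iterated_deriv_rho_power_integral_slice[OF \<mu> int this, of k]
      show ?thesis by (simp add: \<phi>_def[abs_def] g_def[abs_def] a0)
    qed
    also have "(LINT w|\<mu>. f w * inverse (rho u w) ^ (N + k)) = complex_of_real (LINT w|\<mu>. cmod (rho u w) powr (- real (2 * m)))"
    proof -
      have "f w * inverse (rho u w) ^ (N + k) = complex_of_real (cmod (rho u w) powr (- real (2 * m)))" if w: "w \<in> siegel" for w
      proof -
        have "f w * inverse (rho u w) ^ (N + k) = inverse (rho u w * cnj (rho u w)) ^ m"
          unfolding f_def m_def[symmetric] cnj_rho by (simp add: power_mult_distrib mult.commute)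
        also have "rho u w * cnj (rho u w) = complex_of_real ((cmod (rho u w))\<^sup>2)"
          by (simp add: complex_norm_square [symmetric])
        also have "inverse (complex_of_real ((cmod (rho u w))\<^sup>2)) ^ m = complex_of_real (inverse (cmod (rho u w) ^ (2 * m)))"
          by (simp add: power_mult power_inverse)
        also have "inverse (cmod (rho u w) ^ (2 * m)) = cmod (rho u w) powr (- real (2 * m))"
          using cmod_rho_pos[OF u w] by (simp only: powr_minus powr_realpow)
        finally show ?thesis .
      qed
      then have "(LINT w|\<mu>. f w * inverse (rho u w) ^ (N + k)) = (LINT w|\<mu>. complex_of_real (cmod (rho u w) powr (- real (2 * m))))"
        by (intro Bochner_Integration.integral_cong) (auto simp: M_plus_space[OF \<mu>])
      then show ?thesis by simp
    qed
    finally have le: "P * (LINT w|\<mu>. cmod (rho u w) powr (- real (2 * m))) \<le> fact k * (E * R powr (- real m) / ?c) / (R / 2) ^ k"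
      by (simp add: norm_mult P_def)
    \<comment> \<open>Integrability is essential for returning to the nonnegative integral: the
      Bochner integral of a non-integrable function is 0, and a bound on it would say
      nothing.\<close>
    have int2: "integrable \<mu> (\<lambda>w. cmod (rho u w) powr (- real (2 * m)))"
    proof -
      have intk: "integrable \<mu> (\<lambda>w. f w * inverse (rho z w) ^ (N + j))" if "z \<in> siegel" for z j
        using that
      proof (induction j arbitrary: z)
        case (Suc j)
        show ?case using integrable_rho_power_Suc[OF \<mu> Suc.IH Suc.prems] by simp
      qed (simp add: int)
      have "integrable \<mu> (\<lambda>w. cmod (f w * inverse (rho u w) ^ (N + k)))"
        by (rule integrable_norm[OF intk[OF u]])
      moreover have "cmod (f w * inverse (rho u w) ^ (N + k)) = cmod (rho u w) powr (- real (2 * m))" if w: "w \<in> siegel" for w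
      proof -
        have "cmod (f w * inverse (rho u w) ^ (N + k)) = inverse (cmod (rho u w) ^ (m + m))"
          unfolding f_def m_def[symmetric]
          by (simp add: norm_mult norm_power norm_inverse cmod_rho_commute[of w] power_add power_inverse)
        then show ?thesis using cmod_rho_pos[OF u w] by (simp only: powr_minus powr_realpow mult_2)
      qed
      ultimately show ?thesis
        by (subst Bochner_Integration.integrable_cong[OF refl]) (auto simp: M_plus_space[OF \<mu>])
    qed
    have "(LINT w|\<mu>. cmod (rho u w) powr (- real (2 * m))) \<le> C * (R powr (- real m) / R ^ k)"
      using le P c R by (simp add: C_def field_simps)
    also have "R powr (- real m) / R ^ k = R powr (real CARD('n) + 1 - real (2 * m))"
    proof -
      have "R powr (- real m) / R ^ k = R powr (- real m - real k)"
        using R by (simp add: powr_diff powr_realpow)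
      also have "- real m - real k = real CARD('n) + 1 - real (2 * m)" by (simp add: m_def N_def)
      finally show ?thesis .
    qed
    finally have "(LINT w|\<mu>. cmod (rho u w) powr (- real (2 * m))) \<le> C * R powr (real CARD('n) + 1 - real (2 * m))" .
    then show "(\<integral>\<^sup>+w. ennreal (cmod (rho u w) powr (- real (2 * m))) \<partial>\<mu>)
        \<le> ennreal (C * rho_diag u powr (real CARD('n) + 1 - real (2 * m)))"
      using nn_integral_eq_integral[OF int2] by (simp add: R_def ennreal_leI)
  qed simp
qed

theorem theorem1p1:
  fixes \<mu> :: "(complex ^ 'n::{finite,linorder}) measure" and r p q :: real
  assumes "r > 0" and "1 < p" and "0 < q" and "\<mu> \<in> M_plus"
  shows "(toeplitz_bounded p \<mu> \<longleftrightarrow> bounded_on_siegel (berezin \<mu>)) \<and>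
         (bounded_on_siegel (berezin \<mu>) \<longleftrightarrow> bounded_on_siegel (averaging \<mu> r)) \<and>
         (bounded_on_siegel (averaging \<mu> r) \<longleftrightarrow> carleson q \<mu>)"
proof -
  have "toeplitz_bounded p \<mu> \<longleftrightarrow> bounded_on_siegel (averaging \<mu> r)"
    using toeplitz_bounded_of_averaging bounded_averaging_of_toeplitz assms by blast
  moreover have "bounded_on_siegel (berezin \<mu>) \<longleftrightarrow> bounded_on_siegel (averaging \<mu> r)"
    using bounded_averaging_of_berezin bounded_berezin_of_averaging assms by blast
  moreover have "bounded_on_siegel (averaging \<mu> r) \<longleftrightarrow> carleson q \<mu>"
  proof
    assume "bounded_on_siegel (averaging \<mu> r)"
    then obtain C where "C > 0" "\<And>f. holomorphic_vec f siegel \<Longrightarrow>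
        (\<integral>\<^sup>+z. ennreal (cmod (f z) powr q) \<partial>\<mu>) \<le> ennreal C * pintegral q f"
      using carleson_of_bounded_averaging[OF assms(4,1,3)] by blast
    then show "carleson q \<mu>" unfolding carleson_def bergman_space_def by blast
  qed (rule bounded_averaging_of_carleson[OF assms(4,1,3)])
  ultimately show ?thesis by blast
qed

end
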